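(* Let $X,Y,Z\subset\mathbb{R}$ be compact, let $\mu_X\in\mathcal{P}(X)$, $\mu_Y\in\mathcal{P}(Y)$, $\mu_Z\in\mathcal{P}(Z)$ satisfy $\mu_X\preceq_c\mu_Y\preceq_c\mu_Z$, and let $c_1:X\times Y\to\mathbb{R}$, $c_2:Y\times Z\to\mathbb{R}$, $c_3:X\times Z\to\mathbb{R}$ be continuous. For $\varepsilon>0$ let $\pi_\varepsilon$ be a solution of the three-period martingale optimal transport problem of minimizing $\int c_\varepsilon\,d\pi$ over $\pi\in\Pi_M(\mu_X,\mu_Y,\mu_Z)$, with cost $$c_\varepsilon(x,y,z)=c_1(x,y)+c_2(y,z)+\varepsilon c_3(x,z).$$ Let $\pi_0=\mu_Y\otimes\kappa_Y^{XZ}$ be a (weak) limit point of $\pi_\varepsilon$ as $\varepsilon\to0^+$. Then there exist a measure $\pi^{XY}=\mu_Y\otimes\kappa_Y^X$ that is optimal in the two-period martingale optimal transport problem between $\mu_X$ and $\mu_Y$ with cost $c_1$, and a measure $\pi^{YZ}=\mu_Y\otimes\kappa_Y^Z$ that is optimal in the two-period martingale optimal transport problem between $\mu_Y$ and $\mu_Z$ with cost $c_2$, such that for $\mu_Y$-almost every $y$ the conditional probability $\kappa_Y^{XZ}(y,dx\,dz)$ is a minimizer of $$\min_{\pi\in\Pi^{\mathrm{Bar}}(F,\sigma_X,\sigma_Z)}\int c_3(x,z)\,d\pi(x,z)$$ with marginals $\sigma_X=\kappa_Y^X(y,dx)$, $\sigma_Z=\kappa_Y^Z(y,dz)$ and constant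 function $F(x)=y$.
   Context: $\mathcal{P}(X)$ is the set of Borel probability measures on $X$. Convex order: $\mu\preceq_c\nu$ means $\int\varphi\,d\mu\le\int\varphi\,d\nu$ for all convex $\varphi:\mathbb{R}\to\mathbb{R}$. $\Pi(\cdot,\dots,\cdot)$ denotes the set of couplings (joint probability measures) with the given marginals. $\mu\otimes\kappa$ denotes the joint measure with marginal $\mu$ and conditional probability kernel $\kappa$; $\kappa_Y^{XZ}$, $\kappa_Y^X$, $\kappa_Y^Z$ are conditional probabilities given $y$ of $(x,z)$, $x$, $z$ respectively. Martingale couplings: $\Pi_M(\mu_X,\mu_Y)$ is the set of $\pi=\mu_X\otimes\kappa_X^Y\in\Pi(\mu_X,\mu_Y)$ with $\int y\,\kappa_X^Y(x,dy)=x$ for $\mu_X$-a.e. $x$ (similarly $\Pi_M(\mu_Y,\mu_Z)$). $\Pi_M(\mu_X,\mu_Y,\mu_Z)$ is the set of $\pi\in\Pi(\mu_X,\mu_Y,\mu_Z)$ such that the conditional mean of $y$ given $x$ is $x$, and the conditional mean of $z$ given $(x,y)$ is $y$, $\pi$-a.s. The two-period martingale optimal transport problem with cost $c$ between two measures is the minimization of $\int c\,d\pi$ over their martingale couplings. For probability measures $\sigma_X\in\mathcal P(X)$, $\sigma_Z\in\mathcal P(Z)$ and $F:X\to\mathbb{R}$, $\Pi^{\mathrm{Bar}}(F,\sigma_X,\sigma_Z)$ is the set of $\pi=\sigma_X\otimes\kappa_X^Z\in\Pi(\sigma_X,\sigma_Z)$ with $\int z\,\kappa_X^Z(x,dz)=F(x)$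 for $\sigma_X$-a.e. $x$. *)

theory Defs
  imports "HOL-Probability.Probability"
begin

abbreviation borel_on :: "'a::topological_space set \<Rightarrow> 'a measure" where
  "borel_on S \<equiv> restrict_space borel S"

definition borel_probs :: "'a::topological_space set \<Rightarrow> 'a measure set" where
  "borel_probs S = {\<mu>. prob_space \<mu> \<and> sets \<mu> = sets (borel_on S)}"

text \<open>Only used for compactly supported probability measures, for which every convex function
  on the line is integrable.\<close>

definition convex_order :: "real measure \<Rightarrow> real measure \<Rightarrow> bool"  (infix "\<preceq>\<^sub>c" 50) where
  "\<mu> \<preceq>\<^sub>c \<nu> \<longleftrightarrow>
    (\<forall>\<phi>. convex_on UNIV \<phi> \<longrightarrow> (\<integral>x. \<phi> x \<partial>\<mu>) \<le> (\<integral>x. \<phi> x \<partial>\<nu>))"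

definition prob_kernels :: "'a measure \<Rightarrow> 'b measure \<Rightarrow> ('a \<Rightarrow> 'b measure) set" where
  "prob_kernels M N = measurable M (prob_algebra N)"

text \<open>The measure \<open>M \<otimes> \<kappa>\<close>: the mixture of the measures \<open>\<delta>\<^sub>x \<otimes> \<kappa> x\<close> over \<open>M\<close>; see
  \<open>emeasure_kernel_product\<close> below.\<close>

definition kernel_product :: "'a measure \<Rightarrow> ('a \<Rightarrow> 'b measure) \<Rightarrow> ('a \<times> 'b) measure" where
  "kernel_product M \<kappa> = M \<bind> (\<lambda>x. distr (\<kappa> x) (M \<Otimes>\<^sub>M \<kappa> x) (Pair x))"

lemma kernel_product_alt:
  assumes "\<kappa> \<in> prob_kernels M N" "space M \<noteq> {}"
  shows "kernel_product M \<kappa> = M \<bind> (\<lambda>x. distr (\<kappa> x) (M \<Otimes>\<^sub>M N) (Pair x))"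
    and "(\<lambda>x. distr (\<kappa> x) (M \<Otimes>\<^sub>M N) (Pair x)) \<in> M \<rightarrow>\<^sub>M subprob_algebra (M \<Otimes>\<^sub>M N)"
proof -
  have sets_\<kappa>: "sets (\<kappa> x) = sets N" if "x \<in> space M" for x
    using measurable_space[OF assms(1)[unfolded prob_kernels_def] that]
    by (simp add: space_prob_algebra)
  have "distr (\<kappa> x) (M \<Otimes>\<^sub>M \<kappa> x) (Pair x) = distr (\<kappa> x) (M \<Otimes>\<^sub>M N) (Pair x)"
    if "x \<in> space M" for x
    using sets_\<kappa>[OF that] by (intro distr_cong sets_pair_measure_cong) simp_all
  then show "kernel_product M \<kappa> = M \<bind> (\<lambda>x. distr (\<kappa> x) (M \<Otimes>\<^sub>M N) (Pair x))"
    unfolding kernel_product_def by (intro bind_cong_All) simp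
  have "\<kappa> \<in> M \<rightarrow>\<^sub>M subprob_algebra N"
    using assms(1) unfolding prob_kernels_def by (rule measurable_prob_algebraD)
  then show "(\<lambda>x. distr (\<kappa> x) (M \<Otimes>\<^sub>M N) (Pair x)) \<in> M \<rightarrow>\<^sub>M subprob_algebra (M \<Otimes>\<^sub>M N)"
    by (rule measurable_distr2[rotated]) simp
qed

lemma sets_kernel_product:
  assumes "\<kappa> \<in> prob_kernels M N" "space M \<noteq> {}"
  shows "sets (kernel_product M \<kappa>) = sets (M \<Otimes>\<^sub>M N)"
  unfolding kernel_product_alt(1)[OF assms] using assms(2) by (intro sets_bind) simp_all

lemma emeasure_kernel_product:
  assumes \<kappa>: "\<kappa> \<in> prob_kernels M N" and M: "space M \<noteq> {}" and A: "A \<in> sets (M \<Otimes>\<^sub>M N)"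
  shows "emeasure (kernel_product M \<kappa>) A = (\<integral>\<^sup>+x. emeasure (\<kappa> x) (Pair x -` A) \<partial>M)"
proof -
  have sets_\<kappa>: "sets (\<kappa> x) = sets N" if "x \<in> space M" for x
    using measurable_space[OF \<kappa>[unfolded prob_kernels_def] that]
    by (simp add: space_prob_algebra)
  have "emeasure (distr (\<kappa> x) (M \<Otimes>\<^sub>M N) (Pair x)) A = emeasure (\<kappa> x) (Pair x -` A)"
    if x: "x \<in> space M" for x
  proof -
    have "Pair x \<in> \<kappa> x \<rightarrow>\<^sub>M M \<Otimes>\<^sub>M N"
      using measurable_Pair1'[OF x] sets_\<kappa>[OF x] by (simp cong: measurable_cong_sets)
    moreover have "Pair x -` A \<inter> space (\<kappa> x) = Pair x -` A"
      using sets.sets_into_space[OF A] sets_eq_imp_space_eq[OF sets_\<kappa>[OF x]]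
      by (auto simp: space_pair_measure)
    ultimately show ?thesis
      using A by (simp add: emeasure_distr)
  qed
  then show ?thesis
    unfolding kernel_product_alt(1)[OF \<kappa> M]
    by (subst emeasure_bind[OF M kernel_product_alt(2)[OF \<kappa> M] A]) (rule nn_integral_cong)
qed

definition couplings :: "'a measure \<Rightarrow> 'b measure \<Rightarrow> ('a \<times> 'b) measure set" where
  "couplings \<mu> \<nu> = {\<pi>. prob_space \<pi> \<and> sets \<pi> = sets (\<mu> \<Otimes>\<^sub>M \<nu>)
    \<and> distr \<pi> \<mu> fst = \<mu> \<and> distr \<pi> \<nu> snd = \<nu>}"

definition couplings3 ::
    "'a measure \<Rightarrow> 'b measure \<Rightarrow> 'c measure \<Rightarrow> ('a \<times> 'b \<times> 'c) measure set" where
  "couplings3 \<mu> \<nu> \<rho> = {\<pi>. prob_space \<pi> \<and> sets \<pi> = sets (\<mu> \<Otimes>\<^sub>M \<nu> \<Otimes>\<^sub>M \<rho>)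
    \<and> distr \<pi> \<mu> (\<lambda>(x, y, z). x) = \<mu>
    \<and> distr \<pi> \<nu> (\<lambda>(x, y, z). y) = \<nu>
    \<and> distr \<pi> \<rho> (\<lambda>(x, y, z). z) = \<rho>}"

definition bary_couplings ::
    "(real \<Rightarrow> real) \<Rightarrow> real measure \<Rightarrow> real measure \<Rightarrow> (real \<times> real) measure set" where
  "bary_couplings F \<sigma>X \<sigma>Z = {\<pi> \<in> couplings \<sigma>X \<sigma>Z. \<exists>\<kappa> \<in> prob_kernels \<sigma>X \<sigma>Z.
    \<pi> = kernel_product \<sigma>X \<kappa> \<and> (AE x in \<sigma>X. (\<integral>z. z \<partial>\<kappa> x) = F x)}"

definition mart_couplings :: "real measure \<Rightarrow> real measure \<Rightarrow> (real \<times> real) measure set" where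
  "mart_couplings \<mu> \<nu> = {\<pi> \<in> couplings \<mu> \<nu>. \<exists>\<kappa> \<in> prob_kernels \<mu> \<nu>.
    \<pi> = kernel_product \<mu> \<kappa> \<and> (AE x in \<mu>. (\<integral>y. y \<partial>\<kappa> x) = x)}"

text \<open>The conditional means given \<open>x\<close> and given \<open>(x, y)\<close> are conditional expectations with
  respect to the sub-\<open>\<sigma>\<close>-algebras generated by the respective coordinate maps.\<close>

definition mart_couplings3 ::
    "real measure \<Rightarrow> real measure \<Rightarrow> real measure \<Rightarrow> (real \<times> real \<times> real) measure set" where
  "mart_couplings3 \<mu> \<nu> \<rho> = {\<pi> \<in> couplings3 \<mu> \<nu> \<rho>.
    (AE (x, y, z) in \<pi>.
      real_cond_exp \<pi> (vimage_algebra (space \<pi>) (\<lambda>(x, y, z). x) \<mu>)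
        (\<lambda>(x, y, z). y) (x, y, z) = x) \<and>
    (AE (x, y, z) in \<pi>.
      real_cond_exp \<pi> (vimage_algebra (space \<pi>) (\<lambda>(x, y, z). (x, y)) (\<mu> \<Otimes>\<^sub>M \<nu>))
        (\<lambda>(x, y, z). z) (x, y, z) = y)}"

definition is_optimal :: "('a \<Rightarrow> real) \<Rightarrow> 'a measure set \<Rightarrow> 'a measure \<Rightarrow> bool" where
  "is_optimal c C = is_arg_min (\<lambda>\<pi>. \<integral>w. c w \<partial>\<pi>) (\<lambda>\<pi>. \<pi> \<in> C)"

definition weakly_converges ::
    "(nat \<Rightarrow> 'a::topological_space measure) \<Rightarrow> 'a measure \<Rightarrow> bool" where
  "weakly_converges \<pi>s \<pi> \<longleftrightarrow>
    (\<forall>f :: 'a \<Rightarrow> real. continuous_on (space \<pi>) f \<longrightarrow> bounded (f ` space \<pi>) \<longrightarrow>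
      (\<lambda>n. \<integral>w. f w \<partial>\<pi>s n) \<longlonglongrightarrow> (\<integral>w. f w \<partial>\<pi>))"

text \<open>Limit points as \<open>\<epsilon> \<rightarrow> 0+\<close> are taken along sequences; the weak topology on the probability
  measures over a compact subset of a Euclidean space is metrizable.\<close>

definition weak_limit_point_at_0 ::
    "(real \<Rightarrow> 'a::topological_space measure) \<Rightarrow> 'a measure \<Rightarrow> bool" where
  "weak_limit_point_at_0 \<pi>\<epsilon> \<pi>0 \<longleftrightarrow>
    (\<exists>e :: nat \<Rightarrow> real. filterlim e (at_right 0) sequentially
      \<and> weakly_converges (\<lambda>n. \<pi>\<epsilon> (e n)) \<pi>0)"

end

theory Submission
  imports Defs
begin

text \<open>
  Testing the minimality of \<open>\<pi>\<^sub>\<epsilon>\<close> against a fixed martingale coupling and letting \<open>\<epsilon> \<rightarrow> 0\<close> shows that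
  \<open>\<pi>\<^sub>0\<close> minimizes \<open>c\<^sub>1 + c\<^sub>2\<close>, and that among all minimizers of \<open>c\<^sub>1 + c\<^sub>2\<close> it minimizes \<open>c\<^sub>3\<close>. Given
  \<open>y\<close>, the \<open>x\<close>- and \<open>z\<close>-marginals can be recombined at will as long as \<open>z\<close> keeps mean \<open>y\<close> given
  \<open>(x, y)\<close>: making them conditionally independent yields the optimality of the two marginals of
  \<open>\<pi>\<^sub>0\<close>, and replacing the conditional law of \<open>(x, z)\<close> on a measurable set of \<open>y\<close> by a cheaper one
  would contradict the minimality of \<open>c\<^sub>3\<close>.

  A measurable choice of the cheaper law is obtained without a selection theorem. Any element of
  \<open>\<Pi>\<^sup>B\<^sup>a\<^sup>r(y, \<sigma>\<^sub>X, \<sigma>\<^sub>Z)\<close> is approximated, in cost, by a law with density \<open>w\<close> with respect to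
  \<open>\<sigma>\<^sub>X \<otimes> \<sigma>\<^sub>Z\<close>, where \<open>w\<close> is an explicit function of \<open>y, \<sigma>\<^sub>X, \<sigma>\<^sub>Z\<close> and of one of countably many
  rational step functions. Each of these countably many candidates can beat the conditional law of
  \<open>\<pi>\<^sub>0\<close> only on a null set of \<open>y\<close>.
\<close>

section \<open>Kernels\<close>

text \<open>Conditioning on the middle variable separates the constraints. The first martingale
  condition depends on the \<open>(x, y)\<close>-marginal alone, while the second is a barycentre
  condition inside each fibre. Fibre laws that keep both fibre marginals and the barycentre
  \<open>y\<close> therefore glue to an admissible coupling with the same \<open>c1\<close>- and
  \<open>c2\<close>-costs. A competitor in a fibre has to meet these constraints exactly, which a
  discretized law does not; hence the linear correction of approximate densities, followed by a
  mixture that restores the sign. The martingale property occurs in three guises: conditional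
  expectations, kernels and fibre laws. All are translated into the vanishing of integrals of an
  indicator times a defect such as \<open>z - y\<close>. These conditions are linear in the measure,
  survive weak limits through continuous test functions, and can be checked on countably many sets,
  so that one null set of \<open>y\<close> serves all test sets.\<close>

lemma integral_indicator_zero_dynkin:
  fixes h :: "'a \<Rightarrow> real"
  assumes h: "integrable M h" and T: "T \<in> measurable M N"
    and N: "sets N = sigma_sets \<Omega> G" and G: "Int_stable G" "G \<subseteq> Pow \<Omega>"
    and total: "(\<integral>w. h w \<partial>M) = 0"
    and basic: "\<And>C. C \<in> G \<Longrightarrow> (\<integral>w. indicator C (T w) * h w \<partial>M) = 0"
    and C: "C \<in> sets N"
  shows "(\<integral>w. indicator C (T w) * h w \<partial>M) = 0"
proof -
  have sp: "space N = \<Omega>"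
    using N G(2) by (metis sets.top sets.space_closed sigma_sets_into_sp sigma_sets_top subset_antisym PowD in_mono)
  have int: "integrable M (\<lambda>w. indicator A (T w) * h w)" if "A \<in> sets N" for A
  proof -
    have "integrable M (\<lambda>w. indicator (T -` A \<inter> space M) w *\<^sub>R h w)"
      using measurable_sets[OF T that] h by (rule integrable_mult_indicator)
    then show ?thesis
      by (rule Bochner_Integration.integrable_cong[THEN iffD1, rotated -1]) (auto split: split_indicator)
  qed
  \<comment> \<open>The sets with vanishing integral form a Dynkin system: \<open>total\<close>
    handles complements, and dominated summation handles disjoint unions.\<close>
  show ?thesis
    using G C[unfolded N]
  proof (induction rule: sigma_sets_induct_disjoint)
    case (basic A) then show ?case by fact
  next
    case empty then show ?case by simp
  next
    case (compl A)
    then have A: "A \<in> sets N" using N by simp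
    have "(\<integral>w. indicator (\<Omega> - A) (T w) * h w \<partial>M) = (\<integral>w. h w - indicator A (T w) * h w \<partial>M)"
      using measurable_space[OF T] sp
      by (intro Bochner_Integration.integral_cong) (auto split: split_indicator)
    also have "\<dots> = 0"
      using total compl.IH int[OF A] h by (simp add: Bochner_Integration.integral_diff)
    finally show ?case .
  next
    case (union A)
    then have A: "A i \<in> sets N" for i using N by auto
    have U: "(\<Union>i. A i) \<in> sets N" using A by auto
    have s: "(\<lambda>i. indicator (A i) x :: real) sums indicator (\<Union>i. A i) x" for x
      by (rule indicator_sums) (use union in \<open>auto simp: disjoint_family_on_def\<close>)
    have "(\<lambda>i. \<integral>w. indicator (A i) (T w) * h w \<partial>M) sums
        (\<integral>w. (\<Sum>i. indicator (A i) (T w) * h w) \<partial>M)"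
    proof (rule sums_integral)
      show "integrable M (\<lambda>w. indicator (A i) (T w) * h w)" for i using int[OF A] .

      show "AE w in M. summable (\<lambda>i. norm (indicator (A i) (T w) * h w))"
        using s[THEN sums_summable] by (auto simp: abs_mult intro!: summable_mult2)
      \<comment> \<open>Disjoint indicators sum to at most 1, so the partial sums are bounded by the
        integral of the absolute value of \<open>h\<close>, independently of
        \<open>n\<close>.\<close>
      have "(\<Sum>i<n. \<integral>w. norm (indicator (A i) (T w) * h w) \<partial>M) \<le> (\<integral>w. norm (h w) \<partial>M)" for n
      proof -
        have "(\<Sum>i<n. \<integral>w. norm (indicator (A i) (T w) * h w) \<partial>M) =
            (\<integral>w. (\<Sum>i<n. norm (indicator (A i) (T w) * h w)) \<partial>M)"
          using int[OF A] by (intro Bochner_Integration.integral_sum[symmetric]) auto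
        also have "\<dots> \<le> (\<integral>w. norm (h w) \<partial>M)"
        proof (rule integral_mono)
          fix w
          have "(\<Sum>i<n. indicator (A i) (T w)) \<le> (\<Sum>i. indicator (A i) (T w) :: real)"
            using s[THEN sums_summable] by (intro sum_le_suminf) auto
          also have "\<dots> = indicator (\<Union>i. A i) (T w)" using s sums_unique by metis
          also have "\<dots> \<le> (1::real)" by (rule indicator_le_1)
          finally show "(\<Sum>i<n. norm (indicator (A i) (T w) * h w)) \<le> norm (h w)"
            by (simp add: abs_mult flip: sum_distrib_right) (simp add: mult_left_le_one_le sum_nonneg)
        qed (use int[OF A] h in auto)
        finally show ?thesis .
      qed
      \<comment> \<open>The shift turns sums over \<open>{..<n}\<close> into sums over
        \<open>{..n}\<close>, the form that \<open>bounded_imp_summable\<close> expects.\<close>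
      from this[of "Suc n" for n] show "summable (\<lambda>i. \<integral>w. norm (indicator (A i) (T w) * h w) \<partial>M)"
        by (intro bounded_imp_summable[where B="\<integral>w. norm (h w) \<partial>M"]) (simp_all only: lessThan_Suc_atMost, simp)
    qed
    moreover have "(\<Sum>i. indicator (A i) (T w) * h w) = indicator (\<Union>i. A i) (T w) * h w" for w
      by (rule sums_mult2[OF s, THEN sums_unique, symmetric])
    ultimately show ?case using union.IH by (simp add: sums_unique2)
  qed
qed

text \<open>The integrand varies with \<open>x\<close>. Pushing \<open>k x\<close> forward to the
  slice over \<open>x\<close> moves this dependence into the measure, so that one fixed function on
  the product is integrated against a measurable family of measures.\<close>

lemma measurable_prob_kernel_integral:
  fixes f :: "'a \<times> 'b \<Rightarrow> real"
  assumes f[measurable]: "f \<in> borel_measurable (M \<Otimes>\<^sub>M N)" and k: "k \<in> measurable M (prob_algebra N)"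
  shows "(\<lambda>x. \<integral>z. f (x, z) \<partial>k x) \<in> borel_measurable M"
proof -
  note [measurable] = measurable_prob_algebraD[OF k] measurable_distr2
  have "(\<lambda>x. integral\<^sup>L (distr (k x) (M \<Otimes>\<^sub>M N) (\<lambda>y. (x, y))) f) \<in> borel_measurable M"
    by measurable
  moreover have "integral\<^sup>L (distr (k x) (M \<Otimes>\<^sub>M N) (\<lambda>y. (x, y))) f = (\<integral>z. f (x, z) \<partial>k x)"
    if "x \<in> space M" for x
  proof (rule integral_distr)
    have "sets (k x) = sets N"
      using measurable_space[OF k that] by (simp add: space_prob_algebra)
    then show "Pair x \<in> k x \<rightarrow>\<^sub>M M \<Otimes>\<^sub>M N"
      using measurable_Pair1'[OF that] by (simp cong: measurable_cong_sets)
  qed fact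
  ultimately show ?thesis by (simp cong: measurable_cong)
qed

lemma prob_kernelsD:
  assumes "k \<in> prob_kernels M N" "x \<in> space M"
  shows "prob_space (k x)" "sets (k x) = sets N" "space (k x) = space N"
  using measurable_space[OF assms(1)[unfolded prob_kernels_def] assms(2)]
  by (auto simp: space_prob_algebra dest: sets_eq_imp_space_eq)

lemma prob_kernels_cong_sets:
  assumes "sets M = sets M'" "sets N = sets N'"
  shows "prob_kernels M N = prob_kernels M' N'"
  using assms subprob_algebra_cong[of N N'] unfolding prob_kernels_def prob_algebra_def
  by (simp cong: measurable_cong_sets)

lemma prob_space_integrable_bounded:
  fixes f :: "'a \<Rightarrow> real"
  assumes "prob_space M" "f \<in> borel_measurable M" "\<And>x. x \<in> space M \<Longrightarrow> \<bar>f x\<bar> \<le> C"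
  shows "integrable M f"
proof -
  interpret prob_space M by fact
  show ?thesis
    by (rule integrable_const_bound[where B=C]) (use assms in auto)
qed

lemma prob_space_integral_abs_le:
  fixes f :: "'a \<Rightarrow> real"
  assumes "prob_space M" "f \<in> borel_measurable M" "\<And>x. x \<in> space M \<Longrightarrow> \<bar>f x\<bar> \<le> C"
  shows "\<bar>\<integral>x. f x \<partial>M\<bar> \<le> C"
proof -
  interpret prob_space M by fact
  have i: "integrable M f" by (rule prob_space_integrable_bounded[OF assms])
  have "\<bar>\<integral>x. f x \<partial>M\<bar> \<le> (\<integral>x. \<bar>f x\<bar> \<partial>M)" by (rule integral_abs_bound)
  also have "\<dots> \<le> (\<integral>x. C \<partial>M)" by (rule integral_mono) (use i assms in auto)
  finally show ?thesis by (simp add: prob_space)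
qed

lemma prob_space_kernel_product:
  assumes "prob_space M" "k \<in> prob_kernels M N"
  shows "prob_space (kernel_product M k)"
proof -
  interpret M: prob_space M by fact
  have "emeasure (kernel_product M k) (space (M \<Otimes>\<^sub>M N)) = (\<integral>\<^sup>+x. 1 \<partial>M)"
    unfolding emeasure_kernel_product[OF assms(2) M.not_empty sets.top]
  proof (intro nn_integral_cong)
    fix x assume x: "x \<in> space M"
    interpret k: prob_space "k x" by (rule prob_kernelsD[OF assms(2) x])
    show "emeasure (k x) (Pair x -` space (M \<Otimes>\<^sub>M N)) = 1"
      using x prob_kernelsD(3)[OF assms(2) x] k.emeasure_space_1 by (simp add: space_pair_measure vimage_def)
  qed
  then show ?thesis
    unfolding sets_eq_imp_space_eq[OF sets_kernel_product[OF assms(2) M.not_empty], symmetric]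
    by (intro prob_spaceI) (simp add: M.emeasure_space_1)
qed

lemma kernel_product_eqI:
  assumes "k \<in> prob_kernels M N" "space M \<noteq> {}" "sets \<pi> = sets (M \<Otimes>\<^sub>M N)"
    and "\<And>A. A \<in> sets (M \<Otimes>\<^sub>M N) \<Longrightarrow> emeasure \<pi> A = (\<integral>\<^sup>+x. emeasure (k x) (Pair x -` A) \<partial>M)"
  shows "\<pi> = kernel_product M k"
  using assms sets_kernel_product[OF assms(1,2)]
  by (intro measure_eqI) (auto simp: emeasure_kernel_product)

text \<open>Fubini for kernels. \<open>bind\<close> is a \<open>join\<close> of the pushed-forward
  slices, for which bounded functions have an integral formula. The boundedness assumption suits
  continuous costs and coordinates on compact sets.\<close>

lemma integral_kernel_product:
  fixes f :: "'a \<times> 'b \<Rightarrow> real"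
  assumes M: "prob_space M" and k: "k \<in> prob_kernels M N"
    and f: "f \<in> borel_measurable (M \<Otimes>\<^sub>M N)"
    and C: "\<And>x z. x \<in> space M \<Longrightarrow> z \<in> space N \<Longrightarrow> \<bar>f (x, z)\<bar> \<le> C"
  shows "(\<integral>w. f w \<partial>kernel_product M k) = (\<integral>x. \<integral>z. f (x, z) \<partial>k x \<partial>M)"
proof -
  interpret M: prob_space M by fact
  let ?K = "\<lambda>x. distr (k x) (M \<Otimes>\<^sub>M N) (Pair x)"
  let ?D = "distr M (subprob_algebra (M \<Otimes>\<^sub>M N)) ?K"
  note K = kernel_product_alt(2)[OF k M.not_empty]
  interpret D: prob_space ?D by (rule M.prob_space_distr[OF K])
  have pair: "Pair x \<in> k x \<rightarrow>\<^sub>M M \<Otimes>\<^sub>M N" if "x \<in> space M" for x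
    using measurable_Pair1'[OF that] prob_kernelsD(2)[OF k that] by (simp cong: measurable_cong_sets)
  have "(\<integral>w. f w \<partial>kernel_product M k) = (\<integral>w. f w \<partial>join ?D)"
    unfolding kernel_product_alt(1)[OF k M.not_empty] bind_nonempty''[OF K M.not_empty] ..
  also have "\<dots> = (\<integral>L. integral\<^sup>L L f \<partial>?D)"
  proof (rule integral_join[where B=C and B'=1])
    show "AE M' in ?D. emeasure M' (space M') \<le> ennreal 1"
    proof (subst AE_distr_iff)
      show "{x \<in> space (subprob_algebra (M \<Otimes>\<^sub>M N)). emeasure x (space x) \<le> ennreal 1} \<in> sets (subprob_algebra (M \<Otimes>\<^sub>M N))"
        by measurable
      show "AE x in M. emeasure (?K x) (space (?K x)) \<le> ennreal 1"
        using K by (intro AE_I2) (auto dest!: measurable_space simp: space_subprob_algebra subprob_space.subprob_emeasure_le_1)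
    qed fact
  qed (use f C D.finite_measure in \<open>auto simp: space_pair_measure\<close>)
  also have "\<dots> = (\<integral>x. integral\<^sup>L (?K x) f \<partial>M)"
    by (rule integral_distr[OF K]) (use f in measurable)
  also have "\<dots> = (\<integral>x. \<integral>z. f (x, z) \<partial>k x \<partial>M)"
    by (intro Bochner_Integration.integral_cong refl integral_distr pair f)
  finally show ?thesis .
qed

section \<open>Disintegration\<close>

text \<open>
  With \<open>g q x\<close> a version of the conditional probability of \<open>z > q\<close> given \<open>x\<close>, for rational \<open>q\<close>, the
  kernel is the law of \<open>Q x u = sup {q. u \<le> g q x}\<close> for uniform \<open>u\<close>. Since \<open>Q\<close> is truncated to
  \<open>[-R, R]\<close> it is defined for every \<open>x\<close>, so no exceptional null set has to be removed.
\<close>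

lemma exists_kernel_borel:
  fixes \<pi> :: "('a \<times> real) measure"
  assumes \<pi>: "prob_space \<pi>" "sets \<pi> = sets (M \<Otimes>\<^sub>M borel)" and M: "distr \<pi> M fst = M"
    and R: "AE w in \<pi>. \<bar>snd w\<bar> \<le> R"
  shows "\<exists>k\<in>prob_kernels M borel. \<pi> = kernel_product M k"
proof -
  interpret \<pi>: prob_space \<pi> by fact
  note [measurable_cong] = \<pi>(2)
  have fst[measurable]: "fst \<in> measurable \<pi> M" by measurable
  interpret M: prob_space M using \<pi>.prob_space_distr[OF fst] M by simp
  have R0: "R \<ge> 0"
  proof -
    have "AE w in \<pi>. R \<ge> 0" using R by eventually_elim linarith
    then show ?thesis by simp
  qed
  \<comment> \<open>\<open>\<nu> q\<close> assigns to \<open>A\<close> the mass of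
    \<open>A \<times> {q<..}\<close>. It is dominated by \<open>M\<close>, and its density is the
    conditional tail probability at \<open>q\<close>.\<close>
  define \<nu> where "\<nu> q = distr (density \<pi> (\<lambda>w. indicator {q<..} (snd w))) M fst" for q :: real
  have sets_\<nu>[measurable_cong, simp]: "sets (\<nu> q) = sets M" for q by (simp add: \<nu>_def)
  have \<nu>: "emeasure (\<nu> q) A = emeasure \<pi> (A \<times> {q<..})" if A[measurable]: "A \<in> sets M" for q A
  proof -
    have "A \<times> {q<..} \<in> sets \<pi>" by measurable
    moreover have "emeasure (\<nu> q) A = (\<integral>\<^sup>+w. indicator {q<..} (snd w) * indicator (fst -` A \<inter> space \<pi>) w \<partial>\<pi>)"
      unfolding \<nu>_def by (subst emeasure_distr, simp, simp, subst emeasure_density) auto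
    moreover have "\<dots> = (\<integral>\<^sup>+w. indicator (A \<times> {q<..}) w \<partial>\<pi>)"
      by (intro nn_integral_cong) (auto split: split_indicator)
    ultimately show ?thesis by simp
  qed
  have \<pi>M: "emeasure \<pi> (A \<times> UNIV) = emeasure M A" if "A \<in> sets M" for A
  proof -
    have "emeasure M A = emeasure (distr \<pi> M fst) A" using M by simp
    also have "\<dots> = emeasure \<pi> (fst -` A \<inter> space \<pi>)" by (rule emeasure_distr) (use that in auto)
    also have "fst -` A \<inter> space \<pi> = A \<times> UNIV"
      using sets.sets_into_space[OF that] by (auto simp: sets_eq_imp_space_eq[OF \<pi>(2)] space_pair_measure)
    finally show ?thesis ..
  qed
  have \<nu>_le: "emeasure (\<nu> q) A \<le> emeasure M A" if [measurable]: "A \<in> sets M" for q A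
    unfolding \<nu>[OF that] \<pi>M[OF that, symmetric] by (intro emeasure_mono) auto
  define g where "g q = RN_deriv M (\<nu> q)" for q
  have g_meas[measurable]: "g q \<in> borel_measurable M" for q unfolding g_def by simp
  have "absolutely_continuous M (\<nu> q)" for q
    unfolding absolutely_continuous_def
  proof
    fix A assume "A \<in> null_sets M"
    then show "A \<in> null_sets (\<nu> q)"
      using \<nu>_le[of A q] by (auto simp: null_sets_def)
  qed
  then have dens: "density M (g q) = \<nu> q" for q
    unfolding g_def by (intro M.density_RN_deriv) auto
  have g_int: "(\<integral>\<^sup>+x\<in>A. g q x \<partial>M) = emeasure \<pi> (A \<times> {q<..})" if "A \<in> sets M" for q A
    using emeasure_density[OF g_meas that, of q] \<nu>[OF that, of q] by (simp add: dens)
  \<comment> \<open>Comparing integrals over all sets is enough: on the set where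
    \<open>h < f\<close> the difference has integral 0. Finiteness of the integral of
    \<open>h\<close> makes the subtraction of extended values legitimate.\<close>
  have AE_le: "AE x in M. f x \<le> h x"
    if [measurable]: "f \<in> borel_measurable M" "h \<in> borel_measurable M"
      and le: "\<And>A. A \<in> sets M \<Longrightarrow> (\<integral>\<^sup>+x\<in>A. f x \<partial>M) \<le> (\<integral>\<^sup>+x\<in>A. h x \<partial>M)"
      and fin: "(\<integral>\<^sup>+x. h x \<partial>M) < \<infinity>" for f h :: "'a \<Rightarrow> ennreal"
  proof -
    let ?A = "{x \<in> space M. h x < f x}"
    have A: "?A \<in> sets M" by measurable
    have "(\<integral>\<^sup>+x\<in>?A. h x \<partial>M) \<le> (\<integral>\<^sup>+x. h x \<partial>M)"
      by (intro nn_integral_mono) (auto split: split_indicator)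
    then have hfin: "(\<integral>\<^sup>+x\<in>?A. h x \<partial>M) < top" using fin by (auto intro: le_less_trans)
    have "(\<integral>\<^sup>+x. (f x - h x) * indicator ?A x \<partial>M) =
        (\<integral>\<^sup>+x. f x * indicator ?A x - h x * indicator ?A x \<partial>M)"
      by (intro nn_integral_cong) (auto split: split_indicator)
    also have "\<dots> = (\<integral>\<^sup>+x\<in>?A. f x \<partial>M) - (\<integral>\<^sup>+x\<in>?A. h x \<partial>M)"
    proof (rule nn_integral_diff)
      show "(\<integral>\<^sup>+x\<in>?A. h x \<partial>M) \<noteq> \<infinity>" using hfin by simp
    qed (auto split: split_indicator)
    also have "\<dots> = 0" using le[OF A] hfin by (intro diff_eq_0_ennreal) (auto intro: le_less_trans)
    finally have "AE x in M. (f x - h x) * indicator ?A x = 0"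
      by (subst (asm) nn_integral_0_iff_AE) auto
    with AE_space show ?thesis
    proof eventually_elim
      case (elim x)
      then show ?case
        by (cases "h x < f x") (auto simp: diff_eq_0_iff_ennreal not_less)
    qed
  qed
  have g_fin: "(\<integral>\<^sup>+x. g q x \<partial>M) < \<infinity>" for q
    using g_int[of "space M" q] less_top[THEN iffD1, OF \<pi>.emeasure_finite[of "space M \<times> {q<..}"]]
    by (simp cong: nn_integral_cong)
  have anti: "AE x in M. g q' x \<le> g q x" if "q \<le> q'" for q q'
  proof (rule AE_le)
    show "(\<integral>\<^sup>+x\<in>A. g q' x \<partial>M) \<le> (\<integral>\<^sup>+x\<in>A. g q x \<partial>M)" if [measurable]: "A \<in> sets M" for A
      unfolding g_int[OF that] using \<open>q \<le> q'\<close> by (intro emeasure_mono) auto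
  qed (use g_fin in auto)
  have le1: "AE x in M. g q x \<le> 1" for q
  proof (rule AE_le)
    show "(\<integral>\<^sup>+x\<in>A. g q x \<partial>M) \<le> (\<integral>\<^sup>+x\<in>A. 1 \<partial>M)" if [measurable]: "A \<in> sets M" for A
      unfolding g_int[OF that] using \<nu>_le[OF that, of q] \<nu>[OF that, of q] by simp
  qed (auto simp: M.emeasure_space_1)

  define U where "U = uniform_measure lborel {0..1::real}"
  interpret U: prob_space U unfolding U_def by (rule prob_space_uniform_measure) auto
  have sets_U[measurable_cong, simp]: "sets U = sets borel" by (simp add: U_def)
  \<comment> \<open>Truncation keeps the supremum in \<open>Q\<close> bounded for every
    \<open>x\<close> and \<open>u\<close>. Together with the fallback value \<open>-R\<close> it
    makes the quantile function total.\<close>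
  define clip where "clip q = max (-R) (min R q)" for q
  define Q where "Q x u = (SUP q\<in>\<rat>. if ennreal u \<le> g q x then clip q else -R)" for x u
  have clip: "-R \<le> clip q" "clip q \<le> R" for q using R0 by (auto simp: clip_def)
  have bdd: "bdd_above ((\<lambda>q. if ennreal u \<le> g q x then clip q else -R) ` \<rat>)" for x u
    using clip R0 by (intro bdd_aboveI2[where M=R]) auto
  have Q_meas: "(\<lambda>(x, u). Q x u) \<in> borel_measurable (M \<Otimes>\<^sub>M U)"
    unfolding Q_def split_beta
    by (rule borel_measurable_cSUP[OF countable_rat]) (use bdd in \<open>auto\<close>)
  define k where "k x = distr U borel (Q x)" for x
  have Qx[measurable]: "Q x \<in> borel_measurable U" if "x \<in> space M" for x
    using measurable_Pair2[OF Q_meas that] by simp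
  have k: "k \<in> prob_kernels M borel"
    unfolding prob_kernels_def k_def
    by (rule measurable_distr_prob_space2[where M=U]) (use Q_meas U.prob_space_axioms in \<open>auto simp: space_prob_algebra\<close>)
  \<comment> \<open>For \<open>t\<close> in \<open>[-R, R)\<close> neither truncation nor fallback
    interferes: \<open>t < clip q\<close> holds exactly if \<open>t < q\<close>, and the fallback
    \<open>-R\<close> never exceeds \<open>t\<close>.\<close>
  have Q_gt: "t < Q x u \<longleftrightarrow> (\<exists>q\<in>\<rat>. t < q \<and> ennreal u \<le> g q x)" if "-R \<le> t" "t < R" for t x u
  proof -
    have "t < Q x u \<longleftrightarrow> (\<exists>q\<in>\<rat>. t < (if ennreal u \<le> g q x then clip q else -R))"
      unfolding Q_def by (subst less_cSUP_iff[OF _ bdd]) auto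
    also have "\<dots> \<longleftrightarrow> (\<exists>q\<in>\<rat>. t < q \<and> ennreal u \<le> g q x)"
      using that by (intro bex_cong refl) (auto simp: clip_def)
    finally show ?thesis .
  qed
  have Q_bd: "-R \<le> Q x u" "Q x u \<le> R" for x u
  proof -
    show "Q x u \<le> R" unfolding Q_def using clip R0 by (intro cSUP_least) auto
    show "-R \<le> Q x u" unfolding Q_def using clip by (intro cSUP_upper2[OF bdd Rats_0]) auto
  qed
  \<comment> \<open>Half-line masses over each \<open>A\<close> identify the kernel. For
    \<open>t\<close> outside \<open>[-R, R)\<close> both sides are the mass of \<open>A\<close> or
    0, by the support assumption; the work lies in the remaining range.\<close>
  have main: "(\<integral>\<^sup>+x\<in>A. emeasure (k x) {t<..} \<partial>M) = emeasure \<pi> (A \<times> {t<..})"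
    if A[measurable]: "A \<in> sets M" for A t
  proof -
    consider "t < -R" | "t \<ge> R" | "-R \<le> t" "t < R" by linarith
    then show ?thesis
    proof cases
      case 1
      have "(\<integral>\<^sup>+x\<in>A. emeasure (k x) {t<..} \<partial>M) = (\<integral>\<^sup>+x\<in>A. 1 \<partial>M)"
      proof (intro nn_integral_cong)
        fix x assume x: "x \<in> space M"
        have "Q x -` {t<..} \<inter> space U = space U" using Q_bd[of x] 1 by (auto intro: less_le_trans)
        then have "emeasure (k x) {t<..} = 1"
          unfolding k_def using x by (subst emeasure_distr) (auto simp: U.emeasure_space_1)
        then show "emeasure (k x) {t<..} * indicator A x = 1 * indicator A x" by simp
      qed
      also have "\<dots> = emeasure \<pi> (A \<times> UNIV)" using \<pi>M[OF A] by simp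
      also have "\<dots> = emeasure \<pi> (A \<times> {t<..})"
        by (rule emeasure_eq_AE) (use R 1 in \<open>auto elim!: AE_mp[rotated]\<close>)
      finally show ?thesis .
    next
      case 2
      have "(\<integral>\<^sup>+x\<in>A. emeasure (k x) {t<..} \<partial>M) = (\<integral>\<^sup>+x. 0 \<partial>(M :: 'a measure))"
      proof (intro nn_integral_cong)
        fix x assume x: "x \<in> space M"
        have "\<not> t < Q x u" for u using Q_bd(2)[of x u] 2 by simp
        then have "Q x -` {t<..} \<inter> space U = {}" by auto
        then have "emeasure (k x) {t<..} = 0"
          unfolding k_def using x by (subst emeasure_distr) auto
        then show "emeasure (k x) {t<..} * indicator A x = 0" by simp
      qed
      also have "\<dots> = emeasure \<pi> {}" by simp
      also have "\<dots> = emeasure \<pi> (A \<times> {t<..})"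
        by (rule emeasure_eq_AE) (use R 2 in \<open>auto elim!: AE_mp[rotated]\<close>)
      finally show ?thesis .
    next
      case 3
      \<comment> \<open>The level \<open>t\<close> is real, while \<open>Q\<close> only uses
        rational levels. The sequence \<open>r\<close> decreases strictly to \<open>t\<close>, so
        the tails beyond \<open>r n\<close> increase to the tail beyond \<open>t\<close>.\<close>
      define r where "r n = t + inverse (real (Suc n))" for n
      have r: "decseq r" "\<And>n. t < r n"
        by (auto simp: r_def decseq_def field_simps intro!: add_mono le_imp_inverse_le)
      have rlim: "\<exists>n. r n \<le> q" if "t < q" for q
        using reals_Archimedean[of "q - t"] that by (auto simp: r_def algebra_simps intro: less_imp_le)
      \<comment> \<open>Monotonicity of \<open>g\<close> in the level holds only up to a null set
        for each pair. A countable set containing the rationals and all \<open>r n\<close> needs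
        just one null set, and suffices to compare rational levels with the
        \<open>r n\<close>.\<close>
      define J where "J = \<rat> \<union> range r"
      have J: "countable J" by (auto simp: J_def countable_rat)
      have "AE x in M. \<forall>q\<in>J. g q x \<le> 1 \<and> (\<forall>q'\<in>J. q \<le> q' \<longrightarrow> g q' x \<le> g q x)"
        using J le1 anti by (intro AE_ball_countable[THEN iffD2] AE_conjI ballI AE_impI) auto
      then have "AE x in M. emeasure (k x) {t<..} * indicator A x = (SUP n. g (r n) x * indicator A x)"
      proof (rule AE_mp, intro AE_I2 impI)
        fix x assume x: "x \<in> space M"
          and *: "\<forall>q\<in>J. g q x \<le> 1 \<and> (\<forall>q'\<in>J. q \<le> q' \<longrightarrow> g q' x \<le> g q x)"
        let ?s = "SUP n. g (r n) x"
        have s1: "?s \<le> 1" using * by (auto simp: J_def intro!: SUP_least)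
        then obtain c where c: "?s = ennreal c" "0 \<le> c" "c \<le> 1"
          by (cases ?s) (auto simp: top_unique)
        let ?S = "{0..1} \<inter> {u. t < Q x u}"
        have S_meas: "{u. t < Q x u} \<in> sets borel"
          using measurable_sets[OF Qx[OF x], of "{t<..}"] by (auto simp: U_def vimage_def)
        \<comment> \<open>The set of \<open>u\<close> in \<open>[0, 1]\<close> with
          \<open>t < Q x u\<close> lies between the open and the closed interval from 0 to
          \<open>c\<close>. Its length is therefore \<open>c\<close>, whether or not the supremum is
          attained.\<close>
        have 1: "{0<..<c} \<subseteq> ?S"
        proof safe
          fix u assume u: "u \<in> {0<..<c}"
          then have "ennreal u < ?s" unfolding c(1) by (simp add: ennreal_lessI)
          then obtain n where n: "ennreal u < g (r n) x" by (auto simp: less_SUP_iff)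
          obtain q where q: "q \<in> \<rat>" "t < q" "q < r n" using Rats_dense_in_real[OF r(2)] by auto
          then have "g (r n) x \<le> g q x" using * by (auto simp: J_def)
          then show "t < Q x u" using n q Q_gt[OF 3] by (auto intro!: bexI[of _ q] dest: less_le_trans)
        qed (use c in auto)
        have 2: "?S \<subseteq> {0..c}"
        proof safe
          fix u assume u: "u \<in> {0..1}" "t < Q x u"
          then obtain q where q: "q \<in> \<rat>" "t < q" "ennreal u \<le> g q x" using Q_gt[OF 3] by auto
          then obtain n where "r n \<le> q" using rlim by auto
          then have "g q x \<le> g (r n) x" using * q by (auto simp: J_def)
          also have "\<dots> \<le> ?s" by (rule SUP_upper) simp
          also have "?s = ennreal c" by fact
          finally have "ennreal u \<le> ennreal c" using q(3) by (rule order_trans[rotated])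
          then show "u \<in> {0..c}" using u c by (simp add: ennreal_le_iff)
        qed
        have "emeasure lborel ?S \<le> ennreal c"
          using emeasure_mono[OF 2, of lborel] c by simp
        moreover have "ennreal c \<le> emeasure lborel ?S"
          using emeasure_mono[OF 1, of lborel] c S_meas by simp
        ultimately have "emeasure lborel ?S = ?s" using c by simp
        moreover have "emeasure (k x) {t<..} = emeasure U {u. t < Q x u}"
          unfolding k_def using x by (subst emeasure_distr) (auto simp: vimage_def U_def)
        moreover have "emeasure U {u. t < Q x u} = emeasure lborel ?S"
          unfolding U_def using S_meas by (subst emeasure_uniform_measure) (auto simp: divide_ennreal_def)
        ultimately show "emeasure (k x) {t<..} * indicator A x = (SUP n. g (r n) x * indicator A x)"
          by (auto split: split_indicator)
      qed
      then have "(\<integral>\<^sup>+x\<in>A. emeasure (k x) {t<..} \<partial>M) = (\<integral>\<^sup>+x. (SUP n. g (r n) x * indicator A x) \<partial>M)"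
        by (rule nn_integral_cong_AE)
      also have "\<dots> = (SUP n. \<integral>\<^sup>+x\<in>A. g (r n) x \<partial>M)"
      proof (rule nn_integral_monotone_convergence_SUP_AE)
        show "AE x in M. g (r n) x * indicator A x \<le> g (r (Suc n)) x * indicator A x" for n
          using anti[of "r (Suc n)" "r n"] r(1) by (auto simp: decseq_Suc_iff split: split_indicator elim!: AE_mp[rotated])
      qed simp
      also have "\<dots> = (SUP n. emeasure \<pi> (A \<times> {r n<..}))" using g_int by simp
      also have "\<dots> = emeasure \<pi> (\<Union>n. A \<times> {r n<..})"
        using r(1) by (intro SUP_emeasure_incseq) (auto simp: incseq_def decseq_def intro: le_less_trans)
      also have "(\<Union>n. A \<times> {r n<..}) = A \<times> {t<..}"
      proof -
        have "\<exists>n. r n < z" if z: "t < z" for z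
        proof -
          obtain n where "r n \<le> (t + z) / 2" using rlim[of "(t + z) / 2"] z by auto
          moreover have "(t + z) / 2 < z" using z by simp
          ultimately show ?thesis by (intro exI[of _ n]) linarith
        qed
        then show ?thesis using r(2) by (auto intro: less_trans)
      qed
      finally show ?thesis .
    qed
  qed
  interpret k: prob_space "kernel_product M k"
    by (rule prob_space_kernel_product[OF _ k]) unfold_locales
  have k_rect: "emeasure (kernel_product M k) (A \<times> B) = (\<integral>\<^sup>+x\<in>A. emeasure (k x) B \<partial>M)"
    if [measurable]: "A \<in> sets M" "B \<in> sets borel" for A B
    unfolding emeasure_kernel_product[OF k M.not_empty pair_measureI[OF that]]
    by (intro nn_integral_cong) (auto split: split_indicator)
  have rect: "emeasure \<pi> (A \<times> B) = emeasure (kernel_product M k) (A \<times> B)"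
    if A[measurable]: "A \<in> sets M" and B: "B \<in> sets borel" for A B
  proof -
    \<comment> \<open>For fixed \<open>A\<close> both sides become finite measures in
      \<open>B\<close>; these are determined by their values on half-lines.\<close>
    let ?D = "\<lambda>m. distr (density m (indicator (A \<times> UNIV))) borel snd"
    have D: "emeasure (?D m) C = emeasure m (A \<times> C)"
      if m[measurable_cong]: "sets m = sets (M \<Otimes>\<^sub>M borel)" and C[measurable]: "C \<in> sets borel" for m and C :: "real set"
    proof -
      have "emeasure (?D m) C = (\<integral>\<^sup>+w. indicator (A \<times> UNIV) w * indicator (snd -` C \<inter> space m) w \<partial>m)"
        by (subst emeasure_distr, simp, simp, subst emeasure_density) auto
      also have "\<dots> = (\<integral>\<^sup>+w. indicator (A \<times> C) w \<partial>m)"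
        by (intro nn_integral_cong) (auto split: split_indicator)
      also have "\<dots> = emeasure m (A \<times> C)" by (subst nn_integral_indicator) auto
      finally show ?thesis .
    qed
    note sk = sets_kernel_product[OF k M.not_empty]
    have "?D \<pi> = ?D (kernel_product M k)"
    proof (rule measure_eqI_lessThan)
      show "emeasure (?D \<pi>) {x<..} < \<infinity>" for x
        using D[OF \<pi>(2), of "{x<..}"] by (simp add: less_top[symmetric])
      show "emeasure (?D \<pi>) {x<..} = emeasure (?D (kernel_product M k)) {x<..}" for x
        using D[OF \<pi>(2), of "{x<..}"] D[OF sk, of "{x<..}"] main[OF A] k_rect[OF A] by simp
    qed auto
    then show ?thesis using D[OF \<pi>(2) B] D[OF sk B] by simp
  qed
  have "\<pi> = kernel_product M k"
  proof (rule measure_eqI_generator_eq[OF Int_stable_pair_measure_generator[of M "borel::real measure"], where A="\<lambda>_. space M \<times> UNIV" and \<Omega>="space M \<times> UNIV"])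
    show "{a \<times> b |a b. a \<in> sets M \<and> b \<in> sets (borel::real measure)} \<subseteq> Pow (space M \<times> UNIV)"
      by (auto dest: sets.sets_into_space)
    show "sets \<pi> = sigma_sets (space M \<times> UNIV) {a \<times> b |a b. a \<in> sets M \<and> b \<in> sets (borel::real measure)}"
      by (simp add: \<pi>(2) sets_pair_measure)
    show "sets (kernel_product M k) = sigma_sets (space M \<times> UNIV) {a \<times> b |a b. a \<in> sets M \<and> b \<in> sets (borel::real measure)}"
      by (simp add: sets_kernel_product[OF k M.not_empty] sets_pair_measure)
    show "range (\<lambda>_::nat. space M \<times> (UNIV :: real set)) \<subseteq> {a \<times> b |a b. a \<in> sets M \<and> b \<in> sets borel}"
      by (intro image_subsetI CollectI exI[of _ "space M"] exI[of _ UNIV] conjI refl) auto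
  qed (use rect in auto)
  then show ?thesis using k by auto
qed

text \<open>Disintegrate on the whole line, then push the kernel into \<open>Z\<close> by a map that
  fixes \<open>Z\<close> and sends everything else to a point \<open>z0\<close> of \<open>Z\<close>.
  This does not alter \<open>\<pi>\<close>, whose second coordinate already lies in
  \<open>Z\<close>, and the new kernel lives on \<open>Z\<close> for every \<open>x\<close>, not
  just almost every one.\<close>

lemma exists_kernel_borel_on:
  fixes \<pi> :: "('a \<times> real) measure"
  assumes \<pi>: "prob_space \<pi>" "sets \<pi> = sets (M \<Otimes>\<^sub>M borel_on Z)" and M: "distr \<pi> M fst = M"
    and Z: "compact Z"
  shows "\<exists>k\<in>prob_kernels M (borel_on Z). \<pi> = kernel_product M k"
proof -
  interpret \<pi>: prob_space \<pi> by fact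
  note [measurable_cong] = \<pi>(2)
  have fst[measurable]: "fst \<in> measurable \<pi> M" by measurable
  interpret M: prob_space M using \<pi>.prob_space_distr[OF fst] M by simp
  have sp: "space \<pi> = space M \<times> Z"
    using sets_eq_imp_space_eq[OF \<pi>(2)] by (simp add: space_pair_measure space_restrict_space)
  obtain R where R: "\<And>z. z \<in> Z \<Longrightarrow> \<bar>z\<bar> \<le> R"
    using compact_imp_bounded[OF Z] by (auto simp: bounded_iff)
  obtain z0 where z0: "z0 \<in> Z" using \<pi>.not_empty sp by auto
  have [measurable]: "Z \<in> sets borel" using Z by (simp add: borel_closed compact_imp_closed)
  have id[measurable]: "(\<lambda>w. w) \<in> measurable \<pi> (M \<Otimes>\<^sub>M borel)"
  proof -
    have "(\<lambda>w. (fst w, snd w)) \<in> measurable \<pi> (M \<Otimes>\<^sub>M borel)"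
      by (intro measurable_Pair measurable_compose[OF measurable_snd measurable_restrict_space1[OF measurable_ident]] fst)
         (use measurable_snd in \<open>auto simp: measurable_cong_sets[OF \<pi>(2) refl] 
            intro!: measurable_compose[OF measurable_snd] measurable_restrict_space1\<close>)
    then show ?thesis by simp
  qed
  define \<pi>' where "\<pi>' = distr \<pi> (M \<Otimes>\<^sub>M borel) (\<lambda>w. w)"
  have "\<exists>k\<in>prob_kernels M borel. \<pi>' = kernel_product M k"
  proof (rule exists_kernel_borel)
    show "prob_space \<pi>'" unfolding \<pi>'_def by (rule \<pi>.prob_space_distr[OF id])
    show "distr \<pi>' M fst = M" unfolding \<pi>'_def using M by (subst distr_distr) (auto simp: comp_def)
    show "AE w in \<pi>'. \<bar>snd w\<bar> \<le> R" unfolding \<pi>'_def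
      using R sp by (subst AE_distr_iff) (auto intro!: AE_I2)
  qed (simp add: \<pi>'_def)
  then obtain k where k: "k \<in> prob_kernels M borel" "\<pi>' = kernel_product M k" by auto
  define c where "c z = (if z \<in> Z then z else z0)" for z
  have c[measurable]: "c \<in> measurable borel (borel_on Z)"
    unfolding c_def by (intro measurable_restrict_space2) (use z0 in auto)
  define k' where "k' x = distr (k x) (borel_on Z) c" for x
  have k': "k' \<in> prob_kernels M (borel_on Z)"
    unfolding prob_kernels_def k'_def
    by (rule measurable_distr_prob_space2[where M=borel]) (use k in \<open>auto simp: prob_kernels_def\<close>)
  have "\<pi> = kernel_product M k'"
  proof (rule kernel_product_eqI[OF k' M.not_empty \<pi>(2)])
    fix A assume A[measurable]: "A \<in> sets (M \<Otimes>\<^sub>M borel_on Z)"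
    define A' where "A' = {w \<in> space (M \<Otimes>\<^sub>M borel). (fst w, c (snd w)) \<in> A}"
    have A'[measurable]: "A' \<in> sets (M \<Otimes>\<^sub>M borel)" unfolding A'_def by measurable
    have "A' \<inter> space \<pi> = A"
      using sets.sets_into_space[OF A] by (auto simp: A'_def sp c_def space_pair_measure space_restrict_space)
    then have "emeasure \<pi> A = emeasure \<pi>' A'"
      unfolding \<pi>'_def by (subst emeasure_distr) (auto simp: vimage_def)
    also have "\<dots> = (\<integral>\<^sup>+x. emeasure (k x) (Pair x -` A') \<partial>M)"
      unfolding k(2) by (rule emeasure_kernel_product[OF k(1) M.not_empty A'])
    also have "\<dots> = (\<integral>\<^sup>+x. emeasure (k' x) (Pair x -` A) \<partial>M)"
    proof (intro nn_integral_cong)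
      fix x assume x: "x \<in> space M"
      have [measurable_cong]: "sets (k x) = sets borel" using prob_kernelsD[OF k(1) x] by simp
      have "emeasure (k' x) (Pair x -` A) = emeasure (k x) (c -` (Pair x -` A) \<inter> space (k x))"
        unfolding k'_def using sets_Pair1[OF A] by (intro emeasure_distr) measurable
      also have "c -` (Pair x -` A) \<inter> space (k x) = Pair x -` A'"
        using x prob_kernelsD(3)[OF k(1) x] by (auto simp: A'_def space_pair_measure)
      finally show "emeasure (k x) (Pair x -` A') = emeasure (k' x) (Pair x -` A)" ..
    qed
    finally show "emeasure \<pi> A = (\<integral>\<^sup>+x. emeasure (k' x) (Pair x -` A) \<partial>M)" .
  qed
  then show ?thesis using k' by auto
qed

section \<open>Barycentric couplings and conditional expectations\<close>

lemma borel_on_sets_borel: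
  assumes "closed S" "A \<in> sets (borel_on S)" shows "A \<in> sets borel" "A \<subseteq> S"
  using assms sets_restrict_space_iff[of S borel A] by (auto simp: borel_closed)

lemma borel_measurable_borel_on_ident:
  assumes "sets M = sets (borel_on S)" shows "(\<lambda>x. x) \<in> borel_measurable M"
  using measurable_restrict_space1[OF measurable_ident_sets[OF refl], of borel S]
  by (simp add: measurable_cong_sets[OF assms refl])

lemma space_sets_borel_on:
  assumes "sets M = sets (borel_on S)" shows "space M = S"
  using sets_eq_imp_space_eq[OF assms] by (simp add: space_restrict_space)

lemma integral_zero_imp_AE_zero:
  fixes b :: "'a \<Rightarrow> real"
  assumes "prob_space M" "integrable M b"
    and "\<And>A. A \<in> sets M \<Longrightarrow> (\<integral>x. indicator A x * b x \<partial>M) = 0"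
  shows "AE x in M. b x = 0"
proof -
  interpret prob_space M by fact
  show ?thesis
  proof (rule density_unique_real[where f=b and f'="\<lambda>_. 0"])
    show "set_lebesgue_integral M A b = set_lebesgue_integral M A (\<lambda>_. 0)" if "A \<in> sets M" for A
      using assms(3)[OF that] by (simp add: set_lebesgue_integral_def)
  qed (use assms in auto)
qed

lemma couplings_cong_sets:
  assumes "\<pi> \<in> couplings \<sigma>X \<sigma>Z" "sets \<sigma>X = sets X" "sets \<sigma>Z = sets Z"
  shows "prob_space \<pi>" "sets \<pi> = sets (X \<Otimes>\<^sub>M Z)" "distr \<pi> \<sigma>X fst = \<sigma>X" "distr \<pi> \<sigma>Z snd = \<sigma>Z"
    "fst \<in> measurable \<pi> \<sigma>X" "snd \<in> measurable \<pi> \<sigma>Z" "space \<pi> = space X \<times> space Z"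
proof -
  have s: "sets \<pi> = sets (\<sigma>X \<Otimes>\<^sub>M \<sigma>Z)" using assms by (simp add: couplings_def)
  then show s2: "sets \<pi> = sets (X \<Otimes>\<^sub>M Z)" using sets_pair_measure_cong[OF assms(2,3)] by simp
  show "fst \<in> measurable \<pi> \<sigma>X" "snd \<in> measurable \<pi> \<sigma>Z"
    by (auto simp: measurable_cong_sets[OF s refl])
  show "space \<pi> = space X \<times> space Z" using sets_eq_imp_space_eq[OF s2] by (simp add: space_pair_measure)
qed (use assms in \<open>auto simp: couplings_def\<close>)

text \<open>Eliminates the kernel from the constraint. Integrating the conditional barycentre defect
  over \<open>A\<close> gives exactly the displayed integral, and a function with zero integral over
  every set vanishes almost everywhere. In the converse direction the kernel comes from
  disintegration. The resulting conditions can be checked without naming a kernel.\<close>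

lemma bary_couplings_iff:
  assumes sX: "prob_space \<sigma>X" and sZ: "sets \<sigma>Z = sets (borel_on Z)" and Z: "compact Z"
    and F[measurable]: "F \<in> borel_measurable \<sigma>X" and C: "\<And>x. x \<in> space \<sigma>X \<Longrightarrow> \<bar>F x\<bar> \<le> C"
  shows "\<pi> \<in> bary_couplings F \<sigma>X \<sigma>Z \<longleftrightarrow> \<pi> \<in> couplings \<sigma>X \<sigma>Z \<and>
    (\<forall>A\<in>sets \<sigma>X. (\<integral>w. indicator A (fst w) * (snd w - F (fst w)) \<partial>\<pi>) = 0)"
proof -
  interpret sX: prob_space \<sigma>X by fact
  obtain R where R: "\<And>z. z \<in> Z \<Longrightarrow> \<bar>z\<bar> \<le> R"
    using compact_imp_bounded[OF Z] by (auto simp: bounded_iff)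
  note spZ = space_sets_borel_on[OF sZ]
  have idZ[measurable]: "(\<lambda>x. x) \<in> borel_measurable \<sigma>Z" by (rule borel_measurable_borel_on_ident[OF sZ])
  have snd[measurable]: "snd \<in> borel_measurable (\<sigma>X \<Otimes>\<^sub>M \<sigma>Z)"
    using measurable_compose[OF measurable_snd idZ] by simp
  have key: "(\<integral>w. indicator A (fst w) * (snd w - F (fst w)) \<partial>kernel_product \<sigma>X k) =
      (\<integral>x. indicator A x * ((\<integral>z. z \<partial>k x) - F x) \<partial>\<sigma>X)" (is "?L = ?R")
    and meas: "(\<lambda>x. (\<integral>z. z \<partial>k x) - F x) \<in> borel_measurable \<sigma>X"
    and int: "integrable \<sigma>X (\<lambda>x. (\<integral>z. z \<partial>k x) - F x)"
    if k: "k \<in> prob_kernels \<sigma>X \<sigma>Z" and A[measurable]: "A \<in> sets \<sigma>X" for k A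
  proof -
    have kx: "integrable (k x) (\<lambda>z. z)" "\<bar>\<integral>z. z \<partial>k x\<bar> \<le> R" if x: "x \<in> space \<sigma>X" for x
    proof -
      note kx = prob_kernelsD[OF k x]
      have m: "(\<lambda>z. z) \<in> borel_measurable (k x)" using idZ by (simp add: measurable_cong_sets[OF kx(2) refl])
      show "integrable (k x) (\<lambda>z. z)"
        by (rule prob_space_integrable_bounded[OF kx(1) m, where C=R]) (use kx(3) spZ R in auto)
      show "\<bar>\<integral>z. z \<partial>k x\<bar> \<le> R"
        by (rule prob_space_integral_abs_le[OF kx(1) m]) (use kx(3) spZ R in auto)
    qed
    have "?L = (\<integral>x. \<integral>z. indicator A x * (z - F x) \<partial>k x \<partial>\<sigma>X)"
    proof (subst integral_kernel_product[OF sX k, where C="R + C"])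
      show "(\<lambda>w. indicator A (fst w) * (snd w - F (fst w))) \<in> borel_measurable (\<sigma>X \<Otimes>\<^sub>M \<sigma>Z)"
        by measurable
      show "\<bar>indicator A (fst (x, z)) * (snd (x, z) - F (fst (x, z)))\<bar> \<le> R + C"
        if "x \<in> space \<sigma>X" "z \<in> space \<sigma>Z" for x z
        using R[of z] C[of x] that spZ by (auto split: split_indicator)
    qed simp
    also have "\<dots> = ?R"
    proof (intro Bochner_Integration.integral_cong refl)
      fix x assume x: "x \<in> space \<sigma>X"
      interpret kx: prob_space "k x" by (rule prob_kernelsD[OF k x])
      show "(\<integral>z. indicator A x * (z - F x) \<partial>k x) = indicator A x * ((\<integral>z. z \<partial>k x) - F x)"
        using kx(1)[OF x] by (simp add: kx.prob_space)
    qed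
    finally show "?L = ?R" .
    have "(\<lambda>x. \<integral>z. snd (x, z) \<partial>k x) \<in> borel_measurable \<sigma>X"
      by (rule measurable_prob_kernel_integral[OF snd]) (use k in \<open>simp add: prob_kernels_def\<close>)
    then show m: "(\<lambda>x. (\<integral>z. z \<partial>k x) - F x) \<in> borel_measurable \<sigma>X" by simp
    show "integrable \<sigma>X (\<lambda>x. (\<integral>z. z \<partial>k x) - F x)"
    proof (rule prob_space_integrable_bounded[OF sX m, where C="R + C"])
      show "\<bar>(\<integral>z. z \<partial>k x) - F x\<bar> \<le> R + C" if "x \<in> space \<sigma>X" for x
        using kx(2)[OF that] C[OF that] by linarith
    qed
  qed
  show ?thesis
  proof
    assume "\<pi> \<in> bary_couplings F \<sigma>X \<sigma>Z"
    then obtain k where k: "k \<in> prob_kernels \<sigma>X \<sigma>Z" "\<pi> = kernel_product \<sigma>X k"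
      "AE x in \<sigma>X. (\<integral>z. z \<partial>k x) = F x" and c: "\<pi> \<in> couplings \<sigma>X \<sigma>Z"
      by (auto simp: bary_couplings_def)
    have "(\<integral>w. indicator A (fst w) * (snd w - F (fst w)) \<partial>\<pi>) = 0" if [measurable]: "A \<in> sets \<sigma>X" for A
    proof -
      have "(\<integral>x. indicator A x * ((\<integral>z. z \<partial>k x) - F x) \<partial>\<sigma>X) = (\<integral>x. 0 \<partial>\<sigma>X)"
        using meas[OF k(1) that] k(3) by (intro integral_cong_AE) auto
      then show ?thesis using key[OF k(1) that] k(2) by simp
    qed
    with c show "\<pi> \<in> couplings \<sigma>X \<sigma>Z \<and> (\<forall>A\<in>sets \<sigma>X. (\<integral>w. indicator A (fst w) * (snd w - F (fst w)) \<partial>\<pi>) = 0)"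
      by auto
  next
    assume *: "\<pi> \<in> couplings \<sigma>X \<sigma>Z \<and> (\<forall>A\<in>sets \<sigma>X. (\<integral>w. indicator A (fst w) * (snd w - F (fst w)) \<partial>\<pi>) = 0)"
    note c = couplings_cong_sets[OF conjunct1[OF *] refl sZ]
    obtain k where "k \<in> prob_kernels \<sigma>X (borel_on Z)" and k2: "\<pi> = kernel_product \<sigma>X k"
      using exists_kernel_borel_on[OF c(1-3) Z] by auto
    then have k: "k \<in> prob_kernels \<sigma>X \<sigma>Z" using prob_kernels_cong_sets[OF refl[of "sets \<sigma>X"] sZ] by auto
    have "AE x in \<sigma>X. (\<integral>z. z \<partial>k x) - F x = 0"
      using key[OF k] k2 * by (intro integral_zero_imp_AE_zero[OF sX int[OF k sets.top]]) auto
    then have "AE x in \<sigma>X. (\<integral>z. z \<partial>k x) = F x" by simp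
    then show "\<pi> \<in> bary_couplings F \<sigma>X \<sigma>Z"
      using * k k2 by (auto simp: bary_couplings_def)
  qed
qed

lemma mart_couplings_eq_bary_couplings: "mart_couplings \<mu> \<nu> = bary_couplings (\<lambda>x. x) \<mu> \<nu>"
  by (simp add: mart_couplings_def bary_couplings_def)

section \<open>Conditioning on a map, expressed by test functions\<close>

lemma subalgebra_vimage_algebra:
  assumes T: "T \<in> measurable M N" shows "subalgebra M (vimage_algebra (space M) T N)"
  using measurable_sets[OF T] measurable_space[OF T]
  by (auto simp: subalgebra_def sets_vimage_algebra2)

text \<open>\<open>f (T w)\<close> is measurable for the sub-algebra generated by \<open>T\<close>,
  so it may be moved across the conditional expectation; the bound on \<open>f\<close> supplies
  integrability.\<close>

lemma real_cond_exp_vimage_test: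
  fixes u V f :: "_ \<Rightarrow> real"
  assumes M: "prob_space M" and T: "T \<in> measurable M N" and u: "integrable M u"
    and V: "integrable M (\<lambda>w. V (T w))"
    and ce: "AE w in M. real_cond_exp M (vimage_algebra (space M) T N) u w = V (T w)"
    and f: "f \<in> borel_measurable N" "\<And>x. x \<in> space N \<Longrightarrow> \<bar>f x\<bar> \<le> C"
  shows "(\<integral>w. f (T w) * (u w - V (T w)) \<partial>M) = 0"
proof -
  interpret prob_space M by fact
  interpret finite_measure_subalgebra M "vimage_algebra (space M) T N"
    using subalgebra_vimage_algebra[OF T] by unfold_locales
  have fT[measurable]: "(\<lambda>w. f (T w)) \<in> borel_measurable M" by (rule measurable_compose[OF T f(1)])
  have i: "integrable M (\<lambda>w. f (T w) * v w)" if v: "integrable M v" for v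
  proof (rule Bochner_Integration.integrable_bound[where f="\<lambda>w. C * v w"])
    show "AE w in M. norm (f (T w) * v w) \<le> norm (C * v w)"
    proof (rule AE_I2)
      fix w assume "w \<in> space M"
      then have "\<bar>f (T w)\<bar> \<le> \<bar>C\<bar>" using f(2) measurable_space[OF T] by fastforce
      then show "norm (f (T w) * v w) \<le> norm (C * v w)" by (simp add: abs_mult mult_right_mono)
    qed
  qed (use v in auto)
  have "(\<integral>w. f (T w) * u w \<partial>M) = (\<integral>w. f (T w) * real_cond_exp M (vimage_algebra (space M) T N) u w \<partial>M)"
  proof (rule real_cond_exp_intg(2)[symmetric])
    show "(\<lambda>w. f (T w)) \<in> borel_measurable (vimage_algebra (space M) T N)"
      using measurable_space[OF T] by (intro measurable_compose[OF measurable_vimage_algebra1 f(1)]) auto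
  qed (use i u in auto)
  also have "\<dots> = (\<integral>w. f (T w) * V (T w) \<partial>M)"
    using ce V by (intro integral_cong_AE) auto
  finally show ?thesis using i[OF u] i[OF V] by (simp add: right_diff_distrib)
qed

text \<open>The converse direction. Every set of the generated sub-algebra is a preimage under
  \<open>T\<close>, so indicators composed with \<open>T\<close> exhaust the tests that characterize
  a conditional expectation.\<close>

lemma real_cond_exp_vimage_eqI:
  fixes u V :: "_ \<Rightarrow> real"
  assumes M: "prob_space M" and T: "T \<in> measurable M N" and u: "integrable M u"
    and V: "integrable M (\<lambda>w. V (T w))" "V \<in> borel_measurable N"
    and test: "\<And>A. A \<in> sets N \<Longrightarrow> (\<integral>w. indicator A (T w) * (u w - V (T w)) \<partial>M) = 0"
  shows "AE w in M. real_cond_exp M (vimage_algebra (space M) T N) u w = V (T w)"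
proof -
  interpret prob_space M by fact
  interpret finite_measure_subalgebra M "vimage_algebra (space M) T N"
    using subalgebra_vimage_algebra[OF T] by unfold_locales
  show ?thesis
  proof (rule real_cond_exp_charact)
    fix B assume "B \<in> sets (vimage_algebra (space M) T N)"
    then obtain A where A: "A \<in> sets N" and B: "B = T -` A \<inter> space M"
      using measurable_space[OF T] by (auto simp: sets_vimage_algebra2)
    have Bm: "B \<in> sets M" unfolding B by (rule measurable_sets[OF T A])
    have "(\<integral>w. indicator B w * (u w - V (T w)) \<partial>M) = 0"
      unfolding test[OF A, symmetric]
      by (intro Bochner_Integration.integral_cong) (auto simp: B split: split_indicator)
    then show "set_lebesgue_integral M B u = set_lebesgue_integral M B (\<lambda>w. V (T w))"
      using integrable_mult_indicator[OF Bm u] integrable_mult_indicator[OF Bm V(1)]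
      by (simp add: set_lebesgue_integral_def right_diff_distrib)
  next
    show "(\<lambda>w. V (T w)) \<in> borel_measurable (vimage_algebra (space M) T N)"
      using measurable_space[OF T] by (intro measurable_compose[OF measurable_vimage_algebra1 V(2)]) auto
  qed (use u V in auto)
qed

section \<open>From continuous test functions to Borel sets\<close>

lemma tendsto_integral_closed_indicator:
  fixes T :: "'w \<Rightarrow> 'a::metric_space" and h :: "'w \<Rightarrow> real"
  assumes h: "integrable M h" and T[measurable]: "T \<in> borel_measurable M" and C: "closed C" "C \<noteq> {}"
  shows "(\<lambda>n. \<integral>w. max 0 (1 - real n * infdist (T w) C) * h w \<partial>M) \<longlonglongrightarrow> (\<integral>w. indicator C (T w) * h w \<partial>M)"
proof (rule integral_dominated_convergence[where w="\<lambda>w. \<bar>h w\<bar>"])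
  have [measurable]: "C \<in> sets borel" using C by auto
  have [measurable]: "(\<lambda>x. infdist x C) \<in> borel_measurable borel"
    by (intro borel_measurable_continuous_onI continuous_on_infdist continuous_on_id)
  show "(\<lambda>w. indicator C (T w) * h w) \<in> borel_measurable M" using h by measurable
  show "(\<lambda>w. max 0 (1 - real n * infdist (T w) C) * h w) \<in> borel_measurable M" for n
    using h by measurable
  show "AE w in M. (\<lambda>n. max 0 (1 - real n * infdist (T w) C) * h w) \<longlonglongrightarrow> indicator C (T w) * h w"
  proof (intro AE_I2 tendsto_mult tendsto_const)
    fix w
    show "(\<lambda>n. max 0 (1 - real n * infdist (T w) C)) \<longlonglongrightarrow> indicator C (T w)"
    \<comment> \<open>Off the closed set the distance is positive, so the cutoff is eventually 0.
      Nonemptiness matters here: \<open>infdist\<close> to the empty set is 0 by convention, and the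
      cutoff would then be constantly 1.\<close>
    proof (cases "T w \<in> C")
      case True then show ?thesis by simp
    next
      case False
      then have d: "infdist (T w) C > 0" using C in_closed_iff_infdist_zero[OF C] infdist_nonneg[of "T w" C] by (metis less_eq_real_def)
      obtain N :: nat where N: "1 < real N * infdist (T w) C" using reals_Archimedean3[OF d] by auto
      have "eventually (\<lambda>n. max 0 (1 - real n * infdist (T w) C) = indicator C (T w)) sequentially"
        using eventually_ge_at_top[of N]
      proof eventually_elim
        case (elim n)
        then have "real N * infdist (T w) C \<le> real n * infdist (T w) C" using d by (intro mult_right_mono) auto
        then show ?case using N False by (simp add: max_def)
      qed
      then show ?thesis by (rule tendsto_eventually)
    qed
  qed
  show "AE w in M. norm (max 0 (1 - real n * infdist (T w) C) * h w) \<le> \<bar>h w\<bar>" for n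
    by (intro AE_I2) (simp add: abs_mult mult_left_le_one_le infdist_nonneg)
qed (use h in auto)

lemma continuous_on_cutoff: "continuous_on S (\<lambda>x. max 0 (1 - real n * infdist x C))"
  by (intro continuous_intros)

lemma cutoff_bounds: "0 \<le> max 0 (1 - real n * infdist x C)" "max 0 (1 - real n * infdist x C) \<le> 1"
  using infdist_nonneg[of x C] by auto

text \<open>Weak limits only control continuous tests. Cutoffs reach the indicators of closed sets
  by dominated convergence, and closed sets form an intersection-stable generator of the Borel
  sets.\<close>

lemma integral_indicator_zero_if_continuous:
  fixes T :: "'w \<Rightarrow> 'a::metric_space" and h :: "'w \<Rightarrow> real"
  assumes h: "integrable M h" and T: "T \<in> borel_measurable M"
    and test: "\<And>f :: 'a \<Rightarrow> real. continuous_on UNIV f \<Longrightarrow> (\<And>x. 0 \<le> f x \<and> f x \<le> 1) \<Longrightarrow> (\<integral>w. f (T w) * h w \<partial>M) = 0"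
    and C: "C \<in> sets borel"
  shows "(\<integral>w. indicator C (T w) * h w \<partial>M) = 0"
proof (rule integral_indicator_zero_dynkin[OF h T _ _ _ _ _ C, where \<Omega>=UNIV and G="Collect closed"])
  show "sets borel = sigma_sets UNIV (Collect closed)" by (simp add: borel_eq_closed)
  show "Int_stable (Collect closed)" by (auto simp: Int_stable_def)
  show "(\<integral>w. h w \<partial>M) = 0" using test[of "\<lambda>_. 1"] by simp
  fix A :: "'a set" assume "A \<in> Collect closed"
  then show "(\<integral>w. indicator A (T w) * h w \<partial>M) = 0"
  proof (cases "A = {}")
    case False
    have "(\<integral>w. max 0 (1 - real n * infdist (T w) A) * h w \<partial>M) = 0" for n
      using cutoff_bounds by (intro test continuous_on_cutoff) auto
    with tendsto_integral_closed_indicator[OF h T _ False] \<open>A \<in> Collect closed\<close> show ?thesis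
      by (simp add: LIMSEQ_const_iff)
  qed simp
qed simp

lemma prob_space_eqI_continuous:
  fixes M N :: "'a::metric_space measure"
  assumes M: "prob_space M" "sets M = sets borel" and N: "prob_space N" "sets N = sets borel"
    and test: "\<And>f :: 'a \<Rightarrow> real. continuous_on UNIV f \<Longrightarrow> (\<And>x. 0 \<le> f x \<and> f x \<le> 1) \<Longrightarrow> (\<integral>x. f x \<partial>M) = (\<integral>x. f x \<partial>N)"
  shows "M = N"
proof (rule measure_eqI_generator_eq[where E="Collect closed" and \<Omega>=UNIV and A="\<lambda>_. UNIV"])
  interpret M: prob_space M by fact
  interpret N: prob_space N by fact
  note [measurable_cong] = M(2) N(2)
  show "emeasure M A = emeasure N A" if "A \<in> Collect closed" for A
  proof (cases "A = {}")
    case False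
    have A: "closed A" "A \<in> sets M" "A \<in> sets N" using that M N by auto
    have "(\<lambda>n. \<integral>w. max 0 (1 - real n * infdist w A) * 1 \<partial>M) \<longlonglongrightarrow> (\<integral>w. indicator A w * 1 \<partial>M)"
      by (rule tendsto_integral_closed_indicator) (use False A in auto)
    moreover have "(\<lambda>n. \<integral>w. max 0 (1 - real n * infdist w A) * 1 \<partial>N) \<longlonglongrightarrow> (\<integral>w. indicator A w * 1 \<partial>N)"
      by (rule tendsto_integral_closed_indicator) (use False A in auto)
    moreover have "(\<integral>w. max 0 (1 - real n * infdist w A) * 1 \<partial>M) = (\<integral>w. max 0 (1 - real n * infdist w A) * 1 \<partial>N)" for n
      using cutoff_bounds by (simp, intro test continuous_on_cutoff) auto
    ultimately have "measure M A = measure N A" using A LIMSEQ_unique by auto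
    then show ?thesis by (simp add: M.emeasure_eq_measure N.emeasure_eq_measure)
  qed simp
  show "Int_stable (Collect closed)" by (auto simp: Int_stable_def)
  show "emeasure M UNIV \<noteq> \<infinity>" using M.emeasure_finite by simp
  show "sets M = sigma_sets UNIV (Collect closed)" "sets N = sigma_sets UNIV (Collect closed)"
    using M N by (simp_all add: borel_eq_closed)
qed auto

section \<open>Three-period martingale couplings\<close>

text \<open>Continuity on \<open>S \<times> T\<close> gives measurability for the Borel sets
  restricted to the rectangle, whereas kernels and couplings use the product of two restricted
  spaces. The identity is measurable from the latter to the former.\<close>

lemma borel_measurable_continuous_on_Times:
  fixes c :: "real \<times> real \<Rightarrow> real"
  assumes "continuous_on (S \<times> T) c"
  shows "c \<in> borel_measurable (borel_on S \<Otimes>\<^sub>M borel_on T)"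
proof -
  have id: "(\<lambda>w. w) \<in> measurable (borel_on S \<Otimes>\<^sub>M borel_on T) (restrict_space borel (S \<times> T))"
  proof (rule measurable_restrict_space2)
    have "(\<lambda>w. (fst w, snd w)) \<in> measurable (borel_on S \<Otimes>\<^sub>M borel_on T) (borel \<Otimes>\<^sub>M borel)"
      by (intro measurable_Pair measurable_compose[OF measurable_fst measurable_restrict_space1[OF measurable_ident]]
          measurable_compose[OF measurable_snd measurable_restrict_space1[OF measurable_ident]] measurable_ident[unfolded id_def]
          measurable_compose[OF measurable_fst borel_measurable_borel_on_ident] measurable_compose[OF measurable_snd borel_measurable_borel_on_ident]) (rule refl)+
    then show "(\<lambda>w. w) \<in> measurable (borel_on S \<Otimes>\<^sub>M borel_on T) (borel :: (real \<times> real) measure)"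
      by (simp add: borel_prod)
  qed (auto simp: space_pair_measure space_restrict_space)
  show ?thesis
    using measurable_compose[OF id borel_measurable_continuous_on_restrict[OF assms]] by simp
qed

lemma compact_continuous_abs_bounded:
  fixes c :: "'a::topological_space \<Rightarrow> real"
  assumes "compact S" "continuous_on S c"
  obtains C where "\<And>w. w \<in> S \<Longrightarrow> \<bar>c w\<bar> \<le> C" "C \<ge> 0"
proof -
  have "bounded (c ` S)" using assms compact_continuous_image compact_imp_bounded by blast
  then obtain C where "\<forall>w\<in>S. \<bar>c w\<bar> \<le> C" by (auto simp: bounded_iff)
  then show ?thesis by (intro that[of "max C 0"]) (auto simp: le_max_iff_disj)
qed

lemma kernel_product_distr:
  assumes M: "prob_space M" and k: "k \<in> prob_kernels M N" and g: "g \<in> measurable N N'"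
  shows "(\<lambda>x. distr (k x) N' g) \<in> prob_kernels M N'"
    and "kernel_product M (\<lambda>x. distr (k x) N' g) = distr (kernel_product M k) (M \<Otimes>\<^sub>M N') (\<lambda>(x, z). (x, g z))"
proof -
  interpret M: prob_space M by fact
  show k': "(\<lambda>x. distr (k x) N' g) \<in> prob_kernels M N'"
    unfolding prob_kernels_def
    by (rule measurable_compose[OF k[unfolded prob_kernels_def] measurable_distr_prob_space[OF g]])
  note sk = sets_kernel_product[OF k M.not_empty]
  have m: "(\<lambda>(x, z). (x, g z)) \<in> measurable (kernel_product M k) (M \<Otimes>\<^sub>M N')"
    unfolding measurable_cong_sets[OF sk refl] using g by measurable
  show "kernel_product M (\<lambda>x. distr (k x) N' g) = distr (kernel_product M k) (M \<Otimes>\<^sub>M N') (\<lambda>(x, z). (x, g z))"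
  proof (rule kernel_product_eqI[OF k' M.not_empty, symmetric])
    fix A assume A: "A \<in> sets (M \<Otimes>\<^sub>M N')"
    let ?B = "(\<lambda>(x, z). (x, g z)) -` A \<inter> space (kernel_product M k)"
    have B: "?B \<in> sets (M \<Otimes>\<^sub>M N)" using measurable_sets[OF m A] sk by simp
    have "emeasure (distr (kernel_product M k) (M \<Otimes>\<^sub>M N') (\<lambda>(x, z). (x, g z))) A = emeasure (kernel_product M k) ?B"
      by (rule emeasure_distr[OF m A])
    also have "\<dots> = (\<integral>\<^sup>+x. emeasure (k x) (Pair x -` ?B) \<partial>M)"
      by (rule emeasure_kernel_product[OF k M.not_empty B])
    also have "\<dots> = (\<integral>\<^sup>+x. emeasure (distr (k x) N' g) (Pair x -` A) \<partial>M)"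
    proof (intro nn_integral_cong)
      fix x assume x: "x \<in> space M"
      note kx = prob_kernelsD[OF k x]
      have "g \<in> measurable (k x) N'" using g by (simp add: measurable_cong_sets[OF kx(2) refl])
      then have "emeasure (distr (k x) N' g) (Pair x -` A) = emeasure (k x) (g -` (Pair x -` A) \<inter> space (k x))"
        using sets_Pair1[OF A] by (intro emeasure_distr)
      also have "g -` (Pair x -` A) \<inter> space (k x) = Pair x -` ?B"
        using x by (auto simp: kx sets_eq_imp_space_eq[OF sk] space_pair_measure)
      finally show "emeasure (k x) (Pair x -` ?B) = emeasure (distr (k x) N' g) (Pair x -` A)" ..
    qed
    finally show "emeasure (distr (kernel_product M k) (M \<Otimes>\<^sub>M N') (\<lambda>(x, z). (x, g z))) A =
      (\<integral>\<^sup>+x. emeasure (distr (k x) N' g) (Pair x -` A) \<partial>M)" .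
  qed simp
qed

section \<open>Couplings with three compactly supported marginals\<close>

locale three_marginals =
  fixes X Y Z :: "real set" and \<mu>X \<mu>Y \<mu>Z :: "real measure"
  assumes compact: "compact X" "compact Y" "compact Z"
    and borel_probs: "\<mu>X \<in> borel_probs X" "\<mu>Y \<in> borel_probs Y" "\<mu>Z \<in> borel_probs Z"
begin

abbreviation "P \<equiv> borel_on X \<Otimes>\<^sub>M borel_on Y \<Otimes>\<^sub>M borel_on Z"

lemma sets_marginals[measurable_cong]:
  "sets \<mu>X = sets (borel_on X)" "sets \<mu>Y = sets (borel_on Y)" "sets \<mu>Z = sets (borel_on Z)"
  using borel_probs by (auto simp: borel_probs_def)

lemma prob_marginals: "prob_space \<mu>X" "prob_space \<mu>Y" "prob_space \<mu>Z"
  using borel_probs by (auto simp: borel_probs_def)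

sublocale X: prob_space \<mu>X by (rule prob_marginals)
sublocale Y: prob_space \<mu>Y by (rule prob_marginals)
sublocale Z: prob_space \<mu>Z by (rule prob_marginals)

lemma space_marginals: "space \<mu>X = X" "space \<mu>Y = Y" "space \<mu>Z = Z"
  by (intro space_sets_borel_on sets_marginals)+

lemma space_borel_on_real: "space (borel_on S) = (S :: real set)"
  by (simp add: space_restrict_space)

lemma space_P: "sets \<pi> = sets P \<Longrightarrow> space \<pi> = X \<times> Y \<times> Z"
  by (drule sets_eq_imp_space_eq) (simp add: space_pair_measure space_restrict_space)

lemma ident_measurable[measurable]: "(\<lambda>x. x) \<in> borel_measurable (borel_on (S :: real set))"
  by (rule borel_measurable_borel_on_ident[OF refl])

lemma P_projections:
  assumes \<pi>: "sets \<pi> = sets P"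
  shows "fst \<in> borel_measurable \<pi>" "(\<lambda>w. fst (snd w)) \<in> borel_measurable \<pi>" "(\<lambda>w. snd (snd w)) \<in> borel_measurable \<pi>"
    "fst \<in> measurable \<pi> \<mu>X" "(\<lambda>w. fst (snd w)) \<in> measurable \<pi> \<mu>Y" "(\<lambda>w. snd (snd w)) \<in> measurable \<pi> \<mu>Z"
    "(\<lambda>w. (fst w, fst (snd w))) \<in> measurable \<pi> (\<mu>X \<Otimes>\<^sub>M \<mu>Y)"
    "(\<lambda>w. (fst w, fst (snd w))) \<in> borel_measurable \<pi>"
proof -
  note [measurable_cong] = \<pi>
  show a: "fst \<in> measurable \<pi> \<mu>X" "(\<lambda>w. fst (snd w)) \<in> measurable \<pi> \<mu>Y" "(\<lambda>w. snd (snd w)) \<in> measurable \<pi> \<mu>Z"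
    "(\<lambda>w. (fst w, fst (snd w))) \<in> measurable \<pi> (\<mu>X \<Otimes>\<^sub>M \<mu>Y)"
    by measurable
  note i = borel_measurable_borel_on_ident[OF sets_marginals(1)] borel_measurable_borel_on_ident[OF sets_marginals(2)]
    borel_measurable_borel_on_ident[OF sets_marginals(3)]
  show b: "fst \<in> borel_measurable \<pi>" "(\<lambda>w. fst (snd w)) \<in> borel_measurable \<pi>" "(\<lambda>w. snd (snd w)) \<in> borel_measurable \<pi>"
    using measurable_compose[OF a(1) i(1)] measurable_compose[OF a(2) i(2)] measurable_compose[OF a(3) i(3)]
    by auto
  show "(\<lambda>w. (fst w, fst (snd w))) \<in> borel_measurable \<pi>"
    unfolding borel_prod[symmetric] using b by measurable
qed

definition R where "R = (SOME r. r \<ge> 0 \<and> (\<forall>x\<in>X \<union> Y \<union> Z. \<bar>x\<bar> \<le> r))"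

lemma R: "R \<ge> 0" "x \<in> X \<Longrightarrow> \<bar>x\<bar> \<le> R" "x \<in> Y \<Longrightarrow> \<bar>x\<bar> \<le> R" "x \<in> Z \<Longrightarrow> \<bar>x\<bar> \<le> R"
proof -
  have "bounded (X \<union> Y \<union> Z)" using compact by (intro bounded_Un[THEN iffD2] conjI compact_imp_bounded)
  then obtain r where "\<forall>x\<in>X \<union> Y \<union> Z. \<bar>x\<bar> \<le> r" by (auto simp: bounded_iff)
  then have "\<exists>r. r \<ge> 0 \<and> (\<forall>x\<in>X \<union> Y \<union> Z. \<bar>x\<bar> \<le> r)"
    by (intro exI[of _ "max r 0"]) (auto simp: le_max_iff_disj)
  from someI_ex[OF this] show "R \<ge> 0" "x \<in> X \<Longrightarrow> \<bar>x\<bar> \<le> R" "x \<in> Y \<Longrightarrow> \<bar>x\<bar> \<le> R" "x \<in> Z \<Longrightarrow> \<bar>x\<bar> \<le> R"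
    by (auto simp: R_def[symmetric])
qed

lemma P_integrable:
  assumes \<pi>: "prob_space \<pi>" "sets \<pi> = sets P"
  shows "integrable \<pi> fst" "integrable \<pi> (\<lambda>w. fst (snd w))" "integrable \<pi> (\<lambda>w. snd (snd w))"
  using space_P[OF \<pi>(2)] R P_projections[OF \<pi>(2)]
  by (auto intro!: prob_space_integrable_bounded[OF \<pi>(1), where C=R])

lemma couplings3_alt:
  "\<pi> \<in> couplings3 \<mu>X \<mu>Y \<mu>Z \<longleftrightarrow> prob_space \<pi> \<and> sets \<pi> = sets P \<and>
    distr \<pi> \<mu>X fst = \<mu>X \<and> distr \<pi> \<mu>Y (\<lambda>w. fst (snd w)) = \<mu>Y \<and> distr \<pi> \<mu>Z (\<lambda>w. snd (snd w)) = \<mu>Z"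
proof -
  have "sets (\<mu>X \<Otimes>\<^sub>M \<mu>Y \<Otimes>\<^sub>M \<mu>Z) = sets P"
    by (intro sets_pair_measure_cong sets_marginals)
  then show ?thesis by (simp add: couplings3_def case_prod_beta')
qed

text \<open>Together with \<open>mart_couplings3I\<close> this replaces the two conditional
  expectations by tests in \<open>x\<close> and in \<open>(x, y)\<close>. Bounded measurable tests
  are available here, so that continuous ones can be used in the limit; indicators are sufficient
  for the converse.\<close>

lemma mart_couplings3_test:
  assumes "\<pi> \<in> mart_couplings3 \<mu>X \<mu>Y \<mu>Z"
  shows "f \<in> borel_measurable \<mu>X \<Longrightarrow> (\<And>x. x \<in> X \<Longrightarrow> \<bar>f x\<bar> \<le> C) \<Longrightarrow>
      (\<integral>w. f (fst w) * (fst (snd w) - fst w) \<partial>\<pi>) = 0"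
    and "g \<in> borel_measurable (\<mu>X \<Otimes>\<^sub>M \<mu>Y) \<Longrightarrow> (\<And>w. w \<in> X \<times> Y \<Longrightarrow> \<bar>g w\<bar> \<le> C) \<Longrightarrow>
      (\<integral>w. g (fst w, fst (snd w)) * (snd (snd w) - fst (snd w)) \<partial>\<pi>) = 0"
proof -
  have \<pi>: "prob_space \<pi>" "sets \<pi> = sets P"
    using assms by (auto simp: mart_couplings3_def couplings3_alt)
  note i = P_integrable[OF \<pi>] and m = P_projections[OF \<pi>(2)]
  have ce: "AE w in \<pi>. real_cond_exp \<pi> (vimage_algebra (space \<pi>) fst \<mu>X) (\<lambda>w. fst (snd w)) w = fst w"
    "AE w in \<pi>. real_cond_exp \<pi> (vimage_algebra (space \<pi>) (\<lambda>w. (fst w, fst (snd w))) (\<mu>X \<Otimes>\<^sub>M \<mu>Y)) (\<lambda>w. snd (snd w)) w = snd (fst w, fst (snd w))"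
    using assms by (auto simp: mart_couplings3_def case_prod_beta')
  show "(\<integral>w. f (fst w) * (fst (snd w) - fst w) \<partial>\<pi>) = 0"
    if "f \<in> borel_measurable \<mu>X" "\<And>x. x \<in> X \<Longrightarrow> \<bar>f x\<bar> \<le> C"
    by (rule real_cond_exp_vimage_test[OF \<pi>(1) m(4) i(2) i(1) ce(1) that(1)])
       (use that(2) space_marginals in auto)
  show "(\<integral>w. g (fst w, fst (snd w)) * (snd (snd w) - fst (snd w)) \<partial>\<pi>) = 0"
    if "g \<in> borel_measurable (\<mu>X \<Otimes>\<^sub>M \<mu>Y)" "\<And>w. w \<in> X \<times> Y \<Longrightarrow> \<bar>g w\<bar> \<le> C"
    using real_cond_exp_vimage_test[OF \<pi>(1) m(7) i(3) _ ce(2) that(1), of C] i(2) that(2)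
    by (simp add: space_pair_measure space_marginals)
qed

lemma mart_couplings3I:
  assumes \<pi>: "\<pi> \<in> couplings3 \<mu>X \<mu>Y \<mu>Z"
    and t1: "\<And>A. A \<in> sets \<mu>X \<Longrightarrow> (\<integral>w. indicator A (fst w) * (fst (snd w) - fst w) \<partial>\<pi>) = 0"
    and t2: "\<And>A. A \<in> sets (\<mu>X \<Otimes>\<^sub>M \<mu>Y) \<Longrightarrow>
      (\<integral>w. indicator A (fst w, fst (snd w)) * (snd (snd w) - fst (snd w)) \<partial>\<pi>) = 0"
  shows "\<pi> \<in> mart_couplings3 \<mu>X \<mu>Y \<mu>Z"
proof -
  have p: "prob_space \<pi>" "sets \<pi> = sets P" using \<pi> by (auto simp: couplings3_alt)
  note i = P_integrable[OF p] and m = P_projections[OF p(2)]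
  have "AE w in \<pi>. real_cond_exp \<pi> (vimage_algebra (space \<pi>) fst \<mu>X) (\<lambda>w. fst (snd w)) w = fst w"
    by (rule real_cond_exp_vimage_eqI[OF p(1) m(4) i(2) i(1)])
       (use t1 borel_measurable_borel_on_ident[OF sets_marginals(1)] in auto)
  moreover have "snd \<in> borel_measurable (\<mu>X \<Otimes>\<^sub>M \<mu>Y)"
    using measurable_compose[OF measurable_snd borel_measurable_borel_on_ident[OF sets_marginals(2)]] by simp
  then have "AE w in \<pi>. real_cond_exp \<pi> (vimage_algebra (space \<pi>) (\<lambda>w. (fst w, fst (snd w))) (\<mu>X \<Otimes>\<^sub>M \<mu>Y)) (\<lambda>w. snd (snd w)) w
      = snd (fst w, fst (snd w))"
    by (intro real_cond_exp_vimage_eqI[OF p(1) m(7) i(3)]) (use t2 i(2) in auto)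
  ultimately show ?thesis using \<pi> by (simp add: mart_couplings3_def case_prod_beta')
qed

text \<open>Both laws are transported to the whole line, where continuous tests determine them, and
  then compared on sets of \<open>\<mu>\<close>. These are Borel on the line because
  \<open>S\<close> is closed.\<close>

lemma distr_eq_marginalI:
  assumes \<pi>: "prob_space \<pi>" and T: "T \<in> measurable \<pi> \<mu>" and S: "closed S"
    and \<mu>: "prob_space \<mu>" "sets \<mu> = sets (borel_on (S :: real set))"
    and test: "\<And>f :: real \<Rightarrow> real. continuous_on UNIV f \<Longrightarrow> (\<And>x. 0 \<le> f x \<and> f x \<le> 1) \<Longrightarrow> (\<integral>w. f (T w) \<partial>\<pi>) = (\<integral>x. f x \<partial>\<mu>)"
  shows "distr \<pi> \<mu> T = \<mu>"
proof (rule measure_eqI)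
  interpret \<pi>: prob_space \<pi> by fact
  interpret \<mu>: prob_space \<mu> by fact
  have id: "(\<lambda>x. x) \<in> borel_measurable \<mu>" by (rule borel_measurable_borel_on_ident[OF \<mu>(2)])
  have Tb: "T \<in> borel_measurable \<pi>" using measurable_compose[OF T id] by simp
  have eq: "distr \<pi> borel T = distr \<mu> borel (\<lambda>x. x)"
  proof (rule prob_space_eqI_continuous)
    fix f :: "real \<Rightarrow> real" assume f: "continuous_on UNIV f" "\<And>x. 0 \<le> f x \<and> f x \<le> 1"
    then have "f \<in> borel_measurable borel" by (intro borel_measurable_continuous_onI)
    then show "(\<integral>x. f x \<partial>distr \<pi> borel T) = (\<integral>x. f x \<partial>distr \<mu> borel (\<lambda>x. x))"
      using test[OF f] by (simp add: integral_distr[OF Tb] integral_distr[OF id])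
  qed (use \<pi>.prob_space_distr[OF Tb] \<mu>.prob_space_distr[OF id] in auto)
  fix A assume "A \<in> sets (distr \<pi> \<mu> T)"
  then have A: "A \<in> sets \<mu>" by simp
  then have Ab: "A \<in> sets borel" using borel_on_sets_borel(1)[OF S] \<mu>(2) by simp
  have "emeasure (distr \<pi> \<mu> T) A = emeasure (distr \<pi> borel T) A"
    using A Ab by (simp add: emeasure_distr[OF T] emeasure_distr[OF Tb])
  also have "\<dots> = emeasure \<mu> A"
    unfolding eq using A Ab sets.sets_into_space[OF A] by (simp add: emeasure_distr[OF id] Int_absorb2)
  finally show "emeasure (distr \<pi> \<mu> T) A = emeasure \<mu> A" .
qed simp

text \<open>On a compact space the coordinates are bounded continuous functions. Marginal and
  martingale conditions tested with continuous functions are therefore closed under weak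
  convergence, and are upgraded to all measurable sets afterwards.\<close>

lemma weak_limit_in_mart_couplings3:
  assumes M3: "\<And>n. \<pi>s n \<in> mart_couplings3 \<mu>X \<mu>Y \<mu>Z"
    and conv: "weakly_converges \<pi>s \<pi>"
    and \<pi>: "prob_space \<pi>" "sets \<pi> = sets P"
  shows "\<pi> \<in> mart_couplings3 \<mu>X \<mu>Y \<mu>Z"
proof (rule mart_couplings3I)
  have sp: "space \<pi> = X \<times> Y \<times> Z" by (rule space_P[OF \<pi>(2)])
  have s: "prob_space (\<pi>s n)" "sets (\<pi>s n) = sets P" "distr (\<pi>s n) \<mu>X fst = \<mu>X"
     "distr (\<pi>s n) \<mu>Y (\<lambda>w. fst (snd w)) = \<mu>Y" "distr (\<pi>s n) \<mu>Z (\<lambda>w. snd (snd w)) = \<mu>Z" for n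
    using M3[of n] by (auto simp: mart_couplings3_def couplings3_alt)
  note m = P_projections[OF \<pi>(2)] and i = P_integrable[OF \<pi>]
  have lim: "(\<lambda>n. \<integral>w. f w \<partial>\<pi>s n) \<longlonglongrightarrow> (\<integral>w. f w \<partial>\<pi>)" if "continuous_on (X \<times> Y \<times> Z) f" for f :: "_ \<Rightarrow> real"
  proof -
    have "compact (f ` (X \<times> Y \<times> Z))" using that compact by (intro compact_continuous_image compact_Times)
    then show ?thesis using conv that sp by (auto simp: weakly_converges_def intro: compact_imp_bounded)
  qed
  \<comment> \<open>Each constraint fixes the value of a continuous integral along the sequence; the
    limit inherits this value.\<close>
  have limc: "(\<integral>w. f w \<partial>\<pi>) = c" if "continuous_on (X \<times> Y \<times> Z) f" "\<And>n. (\<integral>w. f w \<partial>\<pi>s n) = c" for f :: "_ \<Rightarrow> real" and c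
    using lim[OF that(1)] that(2) by (simp add: LIMSEQ_const_iff)
  have cont: "continuous_on (X \<times> Y \<times> Z) (\<lambda>w. f (T w))"
    if "continuous_on UNIV f" "continuous_on (X \<times> Y \<times> Z) T" for f :: "'b::topological_space \<Rightarrow> real" and T
    using that by (rule continuous_on_compose2) auto
  have meas: "f \<in> borel_measurable \<mu>" if "continuous_on UNIV f" "sets \<mu> = sets (borel_on S)" for f :: "real \<Rightarrow> real" and \<mu> S
    using measurable_compose[OF borel_measurable_borel_on_ident[OF that(2)] borel_measurable_continuous_onI[OF that(1)]] .
  have "(\<integral>w. f (fst w) \<partial>\<pi>) = (\<integral>x. f x \<partial>\<mu>X)" "(\<integral>w. f (fst (snd w)) \<partial>\<pi>) = (\<integral>x. f x \<partial>\<mu>Y)"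
    "(\<integral>w. f (snd (snd w)) \<partial>\<pi>) = (\<integral>x. f x \<partial>\<mu>Z)"
    if f: "continuous_on UNIV f" for f :: "real \<Rightarrow> real"
  proof -
    show "(\<integral>w. f (fst w) \<partial>\<pi>) = (\<integral>x. f x \<partial>\<mu>X)"
      by (rule limc[OF cont[OF f]])
         (use integral_distr[OF P_projections(4)[OF s(2)] meas[OF f sets_marginals(1)]] s(3) in \<open>auto intro: continuous_intros\<close>)
    show "(\<integral>w. f (fst (snd w)) \<partial>\<pi>) = (\<integral>x. f x \<partial>\<mu>Y)"
      by (rule limc[OF cont[OF f]])
         (use integral_distr[OF P_projections(5)[OF s(2)] meas[OF f sets_marginals(2)]] s(4) in \<open>auto intro!: continuous_intros\<close>)
    show "(\<integral>w. f (snd (snd w)) \<partial>\<pi>) = (\<integral>x. f x \<partial>\<mu>Z)"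
      by (rule limc[OF cont[OF f]])
         (use integral_distr[OF P_projections(6)[OF s(2)] meas[OF f sets_marginals(3)]] s(5) in \<open>auto intro!: continuous_intros\<close>)
  qed
  then show "\<pi> \<in> couplings3 \<mu>X \<mu>Y \<mu>Z"
    using distr_eq_marginalI[OF \<pi>(1) m(4) compact_imp_closed[OF compact(1)] prob_marginals(1) sets_marginals(1)]
      distr_eq_marginalI[OF \<pi>(1) m(5) compact_imp_closed[OF compact(2)] prob_marginals(2) sets_marginals(2)]
      distr_eq_marginalI[OF \<pi>(1) m(6) compact_imp_closed[OF compact(3)] prob_marginals(3) sets_marginals(3)]
    unfolding couplings3_alt by (simp add: \<pi>)
  show "(\<integral>w. indicator A (fst w) * (fst (snd w) - fst w) \<partial>\<pi>) = 0" if "A \<in> sets \<mu>X" for A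
  proof (rule integral_indicator_zero_if_continuous[OF _ m(1)])
    fix f :: "real \<Rightarrow> real" assume f: "continuous_on UNIV f" "\<And>x. 0 \<le> f x \<and> f x \<le> 1"
    show "(\<integral>w. f (fst w) * (fst (snd w) - fst w) \<partial>\<pi>) = 0"
    proof (rule limc)
      show "continuous_on (X \<times> Y \<times> Z) (\<lambda>w. f (fst w) * (fst (snd w) - fst w))"
        by (intro continuous_on_mult cont[OF f(1)] continuous_intros)
      show "(\<integral>w. f (fst w) * (fst (snd w) - fst w) \<partial>\<pi>s n) = 0" for n
        by (rule mart_couplings3_test(1)[OF M3 meas[OF f(1) sets_marginals(1)], where C=1]) (use f(2) in auto)
    qed
  qed (use i that sets_marginals borel_on_sets_borel(1)[OF compact_imp_closed[OF compact(1)]] in auto)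
  show "(\<integral>w. indicator A (fst w, fst (snd w)) * (snd (snd w) - fst (snd w)) \<partial>\<pi>) = 0"
    if A: "A \<in> sets (\<mu>X \<Otimes>\<^sub>M \<mu>Y)" for A
  proof (rule integral_indicator_zero_if_continuous[OF _ m(8)])
    fix f :: "real \<times> real \<Rightarrow> real" assume f: "continuous_on UNIV f" "\<And>x. 0 \<le> f x \<and> f x \<le> 1"
    have "f \<in> borel_measurable (borel_on X \<Otimes>\<^sub>M borel_on Y)"
      by (rule borel_measurable_continuous_on_Times[OF continuous_on_subset[OF f(1)]]) simp
    then have "f \<in> borel_measurable (\<mu>X \<Otimes>\<^sub>M \<mu>Y)"
      using sets_pair_measure_cong[OF sets_marginals(1,2)] by (simp cong: measurable_cong_sets)
    then have fm: "f \<in> borel_measurable (\<mu>X \<Otimes>\<^sub>M \<mu>Y)" .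
    show "(\<integral>w. f (fst w, fst (snd w)) * (snd (snd w) - fst (snd w)) \<partial>\<pi>) = 0"
    proof (rule limc)
      show "continuous_on (X \<times> Y \<times> Z) (\<lambda>w. f (fst w, fst (snd w)) * (snd (snd w) - fst (snd w)))"
        by (intro continuous_on_mult cont[OF f(1)] continuous_intros)
      show "(\<integral>w. f (fst w, fst (snd w)) * (snd (snd w) - fst (snd w)) \<partial>\<pi>s n) = 0" for n
        by (rule mart_couplings3_test(2)[OF M3 fm, where C=1]) (use f(2) in auto)
    qed
  next
    have b: "B \<in> sets \<mu>X \<Longrightarrow> B \<in> sets borel" "B \<in> sets \<mu>Y \<Longrightarrow> B \<in> sets borel" for B
      using borel_on_sets_borel(1)[OF compact_imp_closed[OF compact(1)]]
        borel_on_sets_borel(1)[OF compact_imp_closed[OF compact(2)]] by (auto simp: sets_marginals)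
    have "sets (\<mu>X \<Otimes>\<^sub>M \<mu>Y) \<subseteq> sets ((borel :: real measure) \<Otimes>\<^sub>M (borel :: real measure))"
      unfolding sets_pair_measure[of \<mu>X \<mu>Y]
      by (rule sets.sigma_sets_subset') (auto intro!: pair_measureI intro: b)
    then show "A \<in> sets borel" using A unfolding borel_prod by blast
  qed (use i in auto)
qed

end

section \<open>Gluing conditional laws\<close>

text \<open>A countable intersection-stable generator. It allows a fibre condition to be checked for
  all Borel sets outside a single null set of \<open>y\<close>.\<close>

lemma sets_borel_eq_rat_atMost: "sets (borel :: real measure) = sigma_sets UNIV (atMost ` \<rat>)"
proof
  let ?S = "sigma UNIV (atMost ` \<rat>) :: real measure"
  have "{..a} \<in> sets ?S" for a :: real
  proof -
    have "{..a} = (\<Inter>i::rat. if real_of_rat i > a then {..real_of_rat i} else UNIV)"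
    proof (intro antisym subsetI)
      fix x :: real assume x: "x \<in> (\<Inter>i::rat. if real_of_rat i > a then {..real_of_rat i} else UNIV)"
      show "x \<in> {..a}"
      proof (rule ccontr)
        assume "x \<notin> {..a}"
        then have "a < x" by simp
        then obtain q where q: "q \<in> \<rat>" "a < q" "q < x" using Rats_dense_in_real by blast
        then obtain i where "q = real_of_rat i" by (auto elim: Rats_cases)
        then show False using q INT_D[OF x UNIV_I, of i] by simp
      qed
    qed auto
    also have "\<dots> \<in> sets ?S"
    proof (rule sets.countable_INT'')
      show "UNIV \<in> sets ?S" using sets.top[of ?S] by simp
      show "(if real_of_rat i > a then {..real_of_rat i} else UNIV) \<in> sets ?S" for i
        using sets.top[of ?S] by (auto intro!: sigma_sets.Basic)
    qed auto
    finally show ?thesis .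
  qed
  then have "sigma_sets UNIV (range atMost) \<subseteq> sets ?S"
    by (intro sets.sigma_sets_subset') (use sets.top[of ?S] in auto)
  then show "sets (borel :: real measure) \<subseteq> sigma_sets UNIV (atMost ` \<rat>)"
    by (simp add: borel_eq_atMost)
  show "sigma_sets UNIV (atMost ` \<rat>) \<subseteq> sets (borel :: real measure)"
    by (rule sets.sigma_sets_subset') auto
qed

lemma measure_eq_integral_indicator:
  assumes "T \<in> measurable M N" "A \<in> sets N"
  shows "measure (distr M N T) A = (\<integral>w. indicat_real A (T w) \<partial>M)"
proof -
  have "(\<integral>w. indicat_real A (T w) \<partial>M) = (\<integral>x. indicat_real A x \<partial>distr M N T)"
    by (rule integral_distr[symmetric]) (use assms in auto)
  then show ?thesis using sets.sets_into_space[OF assms(2)] by (simp add: Int_absorb2)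
qed

lemma mart_couplings_iff:
  assumes "prob_space \<mu>" "sets \<mu> = sets (borel_on S)" "compact S" "sets \<nu> = sets (borel_on T)" "compact T"
  shows "\<pi> \<in> mart_couplings \<mu> \<nu> \<longleftrightarrow> \<pi> \<in> couplings \<mu> \<nu> \<and>
    (\<forall>A\<in>sets \<mu>. (\<integral>w. indicator A (fst w) * (snd w - fst w) \<partial>\<pi>) = 0)"
proof -
  obtain C where "\<And>x. x \<in> S \<Longrightarrow> \<bar>x\<bar> \<le> C"
    using compact_imp_bounded[OF assms(3)] by (auto simp: bounded_iff)
  then show ?thesis
    unfolding mart_couplings_eq_bary_couplings
    using space_sets_borel_on[OF assms(2)]
    by (intro bary_couplings_iff[OF assms(1,4,5) borel_measurable_borel_on_ident[OF assms(2)], where C=C]) auto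
qed

lemma distr_eqI_integral_indicator:
  assumes M: "prob_space M" and T: "T \<in> measurable M N" and N: "prob_space N"
    and eq: "\<And>A. A \<in> sets N \<Longrightarrow> (\<integral>w. indicat_real A (T w) \<partial>M) = measure N A"
  shows "distr M N T = N"
proof (rule measure_eqI)
  fix A assume "A \<in> sets (distr M N T)"
  then have A: "A \<in> sets N" by simp
  interpret d: prob_space "distr M N T" by (rule prob_space.prob_space_distr[OF M T])
  interpret N: prob_space N by fact
  show "emeasure (distr M N T) A = emeasure N A"
    using measure_eq_integral_indicator[OF T A] eq[OF A]
    by (simp add: d.emeasure_eq_measure N.emeasure_eq_measure)
qed simp

context three_marginals
begin

abbreviation "Q \<equiv> borel_on X \<Otimes>\<^sub>M borel_on Z"

text \<open>The kernel is indexed by the middle variable, so \<open>y\<close> comes first in the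
  kernel product and has to be moved back between \<open>x\<close> and \<open>z\<close>.\<close>

definition glue :: "(real \<Rightarrow> (real \<times> real) measure) \<Rightarrow> (real \<times> real \<times> real) measure" where
  "glue K = distr (kernel_product \<mu>Y K) P (\<lambda>(y, x, z). (x, y, z))"

lemma kernelD:
  assumes "K \<in> prob_kernels \<mu>Y Q" "y \<in> Y"
  shows "prob_space (K y)" "sets (K y) = sets Q" "space (K y) = X \<times> Z"
    "fst \<in> borel_measurable (K y)" "snd \<in> borel_measurable (K y)"
    "integrable (K y) fst" "integrable (K y) snd"
proof -
  show 1: "prob_space (K y)" "sets (K y) = sets Q" "space (K y) = X \<times> Z"
    using prob_kernelsD[OF assms(1)] assms(2) by (auto simp: space_marginals space_pair_measure space_borel_on_real)
  show 2: "fst \<in> borel_measurable (K y)" "snd \<in> borel_measurable (K y)"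
    unfolding measurable_cong_sets[OF 1(2) refl]
    using measurable_compose[OF measurable_fst ident_measurable] measurable_compose[OF measurable_snd ident_measurable]
    by auto
  show "integrable (K y) fst" "integrable (K y) snd"
    using R 1(3) by (auto intro!: prob_space_integrable_bounded[OF 1(1), where C=R] 2)
qed

lemma sets_kernel:
  "K \<in> prob_kernels \<mu>Y Q \<Longrightarrow> sets (kernel_product \<mu>Y K) = sets (borel_on Y \<Otimes>\<^sub>M Q)"
  using sets_kernel_product[OF _ Y.not_empty, of K Q] sets_pair_measure_cong[OF sets_marginals(2) refl, of Q] by simp

lemma swap_measurable:
  assumes "K \<in> prob_kernels \<mu>Y Q"
  shows "(\<lambda>(y, x, z). (x, y, z)) \<in> measurable (kernel_product \<mu>Y K) P"
  unfolding measurable_cong_sets[OF sets_kernel[OF assms] refl] by measurable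

lemma glue_prob:
  assumes "K \<in> prob_kernels \<mu>Y Q"
  shows "prob_space (glue K)" "sets (glue K) = sets P" "space (glue K) = X \<times> Y \<times> Z"
proof -
  interpret prob_space "kernel_product \<mu>Y K"
    by (rule prob_space_kernel_product[OF prob_marginals(2) assms])
  show "prob_space (glue K)" "sets (glue K) = sets P"
    using prob_space_distr[OF swap_measurable[OF assms]] by (auto simp: glue_def)
  then show "space (glue K) = X \<times> Y \<times> Z" by (intro space_P)
qed

lemma integral_glue:
  fixes f :: "real \<times> real \<times> real \<Rightarrow> real"
  assumes K: "K \<in> prob_kernels \<mu>Y Q" and f: "f \<in> borel_measurable P"
    and C: "\<And>w. w \<in> X \<times> Y \<times> Z \<Longrightarrow> \<bar>f w\<bar> \<le> C"
  shows "(\<integral>w. f w \<partial>glue K) = (\<integral>y. \<integral>v. f (fst v, y, snd v) \<partial>K y \<partial>\<mu>Y)"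
proof -
  have m: "(\<lambda>(y, x, z). (x, y, z)) \<in> measurable (\<mu>Y \<Otimes>\<^sub>M Q) P" by measurable
  have "(\<integral>w. f w \<partial>glue K) = (\<integral>u. f (case u of (y, x, z) \<Rightarrow> (x, y, z)) \<partial>kernel_product \<mu>Y K)"
    unfolding glue_def by (rule integral_distr[OF swap_measurable[OF K] f])
  also have "\<dots> = (\<integral>y. \<integral>v. f (case (y, v) of (y, x, z) \<Rightarrow> (x, y, z)) \<partial>K y \<partial>\<mu>Y)"
    by (rule integral_kernel_product[OF prob_marginals(2) K measurable_compose[OF m f], where C=C])
       (use C space_marginals in \<open>auto simp: space_pair_measure space_restrict_space\<close>)
  finally show ?thesis by (simp add: case_prod_beta')
qed

lemma P_proj_measurable:
  "fst \<in> measurable P \<mu>X" "(\<lambda>w. fst (snd w)) \<in> measurable P \<mu>Y" "(\<lambda>w. snd (snd w)) \<in> measurable P \<mu>Z"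
  "(\<lambda>w. (fst w, fst (snd w))) \<in> measurable P (borel_on X \<Otimes>\<^sub>M borel_on Y)"
  "snd \<in> measurable P (borel_on Y \<Otimes>\<^sub>M borel_on Z)"
  "(\<lambda>w. (fst w, snd (snd w))) \<in> measurable P Q"
  "fst \<in> borel_measurable P" "(\<lambda>w. fst (snd w)) \<in> borel_measurable P" "(\<lambda>w. snd (snd w)) \<in> borel_measurable P"
  using P_projections[OF refl] by measurable

text \<open>Testing with rectangles \<open>A \<times> B\<close> localizes the second martingale
  condition in \<open>y\<close>, so for each fixed \<open>A\<close> it holds in almost every fibre.
  The null set depends on \<open>A\<close>; this is overcome with countably many \<open>A\<close>
  and a Dynkin argument inside the fibre.\<close>

lemma glue_mart_couplings3_fibres:
  assumes K: "K \<in> prob_kernels \<mu>Y Q" and M3: "glue K \<in> mart_couplings3 \<mu>X \<mu>Y \<mu>Z"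
  shows "AE y in \<mu>Y. \<forall>A\<in>sets (borel_on X). (\<integral>v. indicator A (fst v) * (snd v - y) \<partial>K y) = 0"
proof -
  have zero: "AE y in \<mu>Y. (\<integral>v. indicator A (fst v) * (snd v - y) \<partial>K y) = 0"
    if A: "A \<in> sets borel" for A
  proof (rule integral_zero_imp_AE_zero[OF prob_marginals(2)])
    have [measurable]: "A \<inter> X \<in> sets \<mu>X"
      using A by (auto simp: sets_marginals sets_restrict_space)
    have bd: "\<bar>indicator A (fst v) * (snd v - y)\<bar> \<le> 2 * R" if "y \<in> Y" "v \<in> X \<times> Z" for y v
      using R(1) R(3)[of y] R(4)[of "snd v"] that by (auto split: split_indicator)
    have "(\<lambda>u. fst (snd u)) \<in> measurable (\<mu>Y \<Otimes>\<^sub>M Q) borel" "(\<lambda>u. snd (snd u)) \<in> measurable (\<mu>Y \<Otimes>\<^sub>M Q) borel"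
       "fst \<in> measurable (\<mu>Y \<Otimes>\<^sub>M Q) borel"
      using measurable_compose[OF measurable_snd measurable_compose[OF measurable_fst ident_measurable]]
        measurable_compose[OF measurable_snd measurable_compose[OF measurable_snd ident_measurable]]
        measurable_compose[OF measurable_fst borel_measurable_borel_on_ident[OF sets_marginals(2)]]
      by simp_all
    then have "(\<lambda>u. indicator A (fst (snd u)) * (snd (snd u) - fst u) :: real) \<in> borel_measurable (\<mu>Y \<Otimes>\<^sub>M Q)"
      using A by measurable
    from measurable_prob_kernel_integral[OF this K[unfolded prob_kernels_def]]
    have bm: "(\<lambda>y. \<integral>v. indicator A (fst v) * (snd v - y) \<partial>K y) \<in> borel_measurable \<mu>Y" by simp
    have Km: "(\<lambda>v. indicator A (fst v) * (snd v - y)) \<in> borel_measurable (K y)" if "y \<in> Y" for y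
      using kernelD(4,5)[OF K that] A by measurable
    show "integrable \<mu>Y (\<lambda>y. \<integral>v. indicator A (fst v) * (snd v - y) \<partial>K y)"
    proof (rule prob_space_integrable_bounded[OF prob_marginals(2) bm, where C="2 * R"])
      show "\<bar>\<integral>v. indicator A (fst v) * (snd v - y) \<partial>K y\<bar> \<le> 2 * R" if "y \<in> space \<mu>Y" for y
        by (rule prob_space_integral_abs_le[OF kernelD(1)[OF K] Km])
           (use that kernelD(3)[OF K, of y] bd[of y] space_marginals in auto)
    qed
    fix B assume B[measurable]: "B \<in> sets \<mu>Y"
    \<comment> \<open>\<open>B\<close> is an arbitrary set of \<open>y\<close>: letting it vary
      shows that the fibre integral vanishes almost everywhere. Intersecting with \<open>X\<close>
      only makes the rectangle measurable for the marginals.\<close>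
    let ?f = "\<lambda>w. indicator ((A \<inter> X) \<times> B) (fst w, fst (snd w)) * (snd (snd w) - fst (snd w)) :: real"
    have "(\<integral>w. ?f w \<partial>glue K) = 0"
      by (rule mart_couplings3_test(2)[OF M3, where C=1]) (auto split: split_indicator)
    moreover have "(\<integral>w. ?f w \<partial>glue K) = (\<integral>y. \<integral>v. ?f (fst v, y, snd v) \<partial>K y \<partial>\<mu>Y)"
    proof (rule integral_glue[OF K, where C="2 * R"])
      have "(\<lambda>w. (fst w, fst (snd w))) \<in> measurable P (\<mu>X \<Otimes>\<^sub>M \<mu>Y)"
        using P_proj_measurable(1,2) by measurable
      then show "?f \<in> borel_measurable P" using P_proj_measurable(8,9) by measurable
      show "\<bar>?f w\<bar> \<le> 2 * R" if "w \<in> X \<times> Y \<times> Z" for w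
        using R(1) R(3)[of "fst (snd w)"] R(4)[of "snd (snd w)"] that by (auto split: split_indicator)
    qed
    moreover have "\<dots> = (\<integral>y. indicator B y * (\<integral>v. indicator A (fst v) * (snd v - y) \<partial>K y) \<partial>\<mu>Y)"
    proof (intro Bochner_Integration.integral_cong refl)
      fix y assume "y \<in> space \<mu>Y"
      then have sp: "space (K y) = X \<times> Z" using kernelD(3)[OF K] space_marginals by auto
      have "(\<integral>v. ?f (fst v, y, snd v) \<partial>K y) = (\<integral>v. indicator B y * (indicator A (fst v) * (snd v - y)) \<partial>K y)"
        by (intro Bochner_Integration.integral_cong refl) (auto simp: sp split: split_indicator)
      then show "(\<integral>v. ?f (fst v, y, snd v) \<partial>K y) = indicator B y * (\<integral>v. indicator A (fst v) * (snd v - y) \<partial>K y)"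
        by simp
    qed
    ultimately show "(\<integral>y. indicator B y * (\<integral>v. indicator A (fst v) * (snd v - y) \<partial>K y) \<partial>\<mu>Y) = 0" by simp
  qed
  \<comment> \<open>Rational half-lines together with the whole line, which serves as the total
    integral, are what the Dynkin argument requires.\<close>
  have "AE y in \<mu>Y. \<forall>q\<in>\<rat>. (\<integral>v. indicator {..q} (fst v) * (snd v - y) \<partial>K y) = 0"
    by (intro AE_ball_countable[THEN iffD2] countable_rat ballI zero) auto
  moreover have "AE y in \<mu>Y. (\<integral>v. indicator UNIV (fst v) * (snd v - y) \<partial>K y) = 0"
    by (rule zero) auto
  moreover note AE_space
  ultimately show ?thesis
  proof eventually_elim
    case (elim y)
    have y: "y \<in> Y" using elim(3) by (simp add: space_marginals)
    interpret Ky: prob_space "K y" by (rule kernelD(1)[OF K y])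
    show ?case
    proof
      fix A assume "A \<in> sets (borel_on X)"
      then have A: "A \<in> sets borel" by (rule borel_on_sets_borel(1)[OF compact_imp_closed[OF compact(1)]])
      show "(\<integral>v. indicator A (fst v) * (snd v - y) \<partial>K y) = 0"
      proof (rule integral_indicator_zero_dynkin[OF _ kernelD(4)[OF K y] sets_borel_eq_rat_atMost _ _ _ _ A])
        show "Int_stable (atMost ` (\<rat> :: real set))"
        proof (rule Int_stableI_image)
          fix i j :: real assume "i \<in> \<rat>" "j \<in> \<rat>"
          then show "\<exists>k\<in>\<rat>. {..i} \<inter> {..j} = {..k}" by (intro bexI[of _ "min i j"]) (auto simp: min_def)
        qed
        show "(\<integral>v. snd v - y \<partial>K y) = 0" using elim(2) by simp
        show "(\<integral>v. indicator C (fst v) * (snd v - y) \<partial>K y) = 0" if "C \<in> atMost ` \<rat>" for C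
          using that elim(1) by auto
      qed (use kernelD(7)[OF K y] in auto)
    qed
  qed
qed

text \<open>Collects what admissibility of a glued coupling consists of: \<open>\<pi>XY\<close>
  supplies the first two marginals and the first martingale condition, \<open>\<pi>YZ\<close> the
  third marginal, and the fibre condition is the second martingale condition. The marginal
  hypotheses are integral identities so that they fit both product fibres and locally modified
  ones.\<close>

lemma glue_in_mart_couplings3:
  assumes K: "K \<in> prob_kernels \<mu>Y Q" and XY: "\<pi>XY \<in> mart_couplings \<mu>X \<mu>Y" and YZ: "\<pi>YZ \<in> couplings \<mu>Y \<mu>Z"
    and eqXY: "\<And>f :: real \<times> real \<Rightarrow> real. f \<in> borel_measurable (borel_on X \<Otimes>\<^sub>M borel_on Y) \<Longrightarrow> (\<exists>C. \<forall>w\<in>X \<times> Y. \<bar>f w\<bar> \<le> C) \<Longrightarrow>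
        (\<integral>y. \<integral>v. f (fst v, y) \<partial>K y \<partial>\<mu>Y) = (\<integral>w. f w \<partial>\<pi>XY)"
    and eqYZ: "\<And>f :: real \<times> real \<Rightarrow> real. f \<in> borel_measurable (borel_on Y \<Otimes>\<^sub>M borel_on Z) \<Longrightarrow> (\<exists>C. \<forall>w\<in>Y \<times> Z. \<bar>f w\<bar> \<le> C) \<Longrightarrow>
        (\<integral>y. \<integral>v. f (y, snd v) \<partial>K y \<partial>\<mu>Y) = (\<integral>w. f w \<partial>\<pi>YZ)"
    and fib: "AE y in \<mu>Y. \<forall>A\<in>sets (borel_on X). (\<integral>v. indicator A (fst v) * (snd v - y) \<partial>K y) = 0"
  shows "glue K \<in> mart_couplings3 \<mu>X \<mu>Y \<mu>Z"
proof (rule mart_couplings3I)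
  interpret g: prob_space "glue K" by (rule glue_prob[OF K])
  have XYc: "\<pi>XY \<in> couplings \<mu>X \<mu>Y" using XY by (simp add: mart_couplings_def)
  note cXY = couplings_cong_sets[OF XYc sets_marginals(1,2)] and cYZ = couplings_cong_sets[OF YZ sets_marginals(2,3)]
  note g = glue_prob[OF K]
  have ex1: "\<exists>C. \<forall>w\<in>S. \<bar>indicator A (T w) :: real\<bar> \<le> C" for S A T by (intro exI[of _ 1]) (auto split: split_indicator)
  note m = P_projections[OF g(2)]
  note marg = distr_eqI_integral_indicator[OF g(1)]
  have "distr (glue K) \<mu>X fst = \<mu>X"
  proof (rule marg[OF m(4) prob_marginals(1)])
    fix A assume A[measurable]: "A \<in> sets \<mu>X"
    have "(\<integral>w. indicat_real A (fst w) \<partial>glue K) = (\<integral>y. \<integral>v. indicat_real A (fst (fst v, y)) \<partial>K y \<partial>\<mu>Y)"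
      by (subst integral_glue[OF K, where C=1]) (use measurable_compose[OF P_proj_measurable(1) borel_measurable_indicator[OF A]] in \<open>auto split: split_indicator\<close>)
    also have "\<dots> = (\<integral>w. indicat_real A (fst w) \<partial>\<pi>XY)"
      by (rule eqXY[OF _ ex1]) measurable
    also have "\<dots> = measure \<mu>X A" using measure_eq_integral_indicator[OF cXY(5) A] cXY(3) by simp
    finally show "(\<integral>w. indicat_real A (fst w) \<partial>glue K) = measure \<mu>X A" .
  qed
  moreover have "distr (glue K) \<mu>Y (\<lambda>w. fst (snd w)) = \<mu>Y"
  proof (rule marg[OF m(5) prob_marginals(2)])
    fix A assume A[measurable]: "A \<in> sets \<mu>Y"
    have "(\<integral>w. indicat_real A (fst (snd w)) \<partial>glue K) = (\<integral>y. \<integral>v. indicat_real A (snd (fst v, y)) \<partial>K y \<partial>\<mu>Y)"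
      by (subst integral_glue[OF K, where C=1]) (use measurable_compose[OF P_proj_measurable(2) borel_measurable_indicator[OF A]] in \<open>auto split: split_indicator\<close>)
    also have "\<dots> = (\<integral>w. indicat_real A (snd w) \<partial>\<pi>XY)"
      by (rule eqXY[OF _ ex1]) measurable
    also have "\<dots> = measure \<mu>Y A" using measure_eq_integral_indicator[OF cXY(6) A] cXY(4) by simp
    finally show "(\<integral>w. indicat_real A (fst (snd w)) \<partial>glue K) = measure \<mu>Y A" .
  qed
  moreover have "distr (glue K) \<mu>Z (\<lambda>w. snd (snd w)) = \<mu>Z"
  proof (rule marg[OF m(6) prob_marginals(3)])
    fix A assume A[measurable]: "A \<in> sets \<mu>Z"
    have "(\<integral>w. indicat_real A (snd (snd w)) \<partial>glue K) = (\<integral>y. \<integral>v. indicat_real A (snd (y, snd v)) \<partial>K y \<partial>\<mu>Y)"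
      by (subst integral_glue[OF K, where C=1]) (use measurable_compose[OF P_proj_measurable(3) borel_measurable_indicator[OF A]] in \<open>auto split: split_indicator\<close>)
    also have "\<dots> = (\<integral>w. indicat_real A (snd w) \<partial>\<pi>YZ)"
      by (rule eqYZ[OF _ ex1]) measurable
    also have "\<dots> = measure \<mu>Z A" using measure_eq_integral_indicator[OF cYZ(6) A] cYZ(4) by simp
    finally show "(\<integral>w. indicat_real A (snd (snd w)) \<partial>glue K) = measure \<mu>Z A" .
  qed
  ultimately show "glue K \<in> couplings3 \<mu>X \<mu>Y \<mu>Z" using g by (simp add: couplings3_alt)
  show "(\<integral>w. indicator A (fst w) * (fst (snd w) - fst w) \<partial>glue K) = 0" if A[measurable]: "A \<in> sets \<mu>X" for A
  proof -
    have "(\<integral>w. indicator A (fst w) * (fst (snd w) - fst w) \<partial>glue K) =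
        (\<integral>y. \<integral>v. indicator A (fst (fst v, y)) * (snd (fst v, y) - fst (fst v, y)) \<partial>K y \<partial>\<mu>Y)"
    proof (subst integral_glue[OF K, where C="2 * R"])
      show "(\<lambda>w. indicator A (fst w) * (fst (snd w) - fst w)) \<in> borel_measurable P"
        using P_proj_measurable(1,7,8) by measurable
      show "\<bar>indicator A (fst w) * (fst (snd w) - fst w)\<bar> \<le> 2 * R" if "w \<in> X \<times> Y \<times> Z" for w
        using R(1) R(2)[of "fst w"] R(3)[of "fst (snd w)"] that by (auto split: split_indicator)
    qed simp
    also have "\<dots> = (\<integral>w. indicator A (fst w) * (snd w - fst w) \<partial>\<pi>XY)"
    proof (rule eqXY)
      have "fst \<in> borel_measurable (borel_on X \<Otimes>\<^sub>M borel_on Y)" "snd \<in> borel_measurable (borel_on X \<Otimes>\<^sub>M borel_on Y)"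
        using measurable_compose[OF measurable_fst ident_measurable] measurable_compose[OF measurable_snd ident_measurable] by auto
      then show "(\<lambda>w. indicator A (fst w) * (snd w - fst w)) \<in> borel_measurable (borel_on X \<Otimes>\<^sub>M borel_on Y)"
        by measurable
      show "\<exists>C. \<forall>w\<in>X \<times> Y. \<bar>indicator A (fst w) * (snd w - fst w)\<bar> \<le> C"
        using R by (intro exI[of _ "2 * R"]) (fastforce split: split_indicator)
    qed
    also have "\<dots> = 0"
      using XY A mart_couplings_iff[OF prob_marginals(1) sets_marginals(1) compact(1) sets_marginals(2) compact(2)]
      by blast
    finally show ?thesis .
  qed
  show "(\<integral>w. indicator C (fst w, fst (snd w)) * (snd (snd w) - fst (snd w)) \<partial>glue K) = 0"
    if C[measurable]: "C \<in> sets (\<mu>X \<Otimes>\<^sub>M \<mu>Y)" for C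
  proof -
    have "(\<integral>w. indicator C (fst w, fst (snd w)) * (snd (snd w) - fst (snd w)) \<partial>glue K) =
        (\<integral>y. \<integral>v. indicator C (fst v, y) * (snd v - y) \<partial>K y \<partial>\<mu>Y)"
    proof (subst integral_glue[OF K, where C="2 * R"])
      have "(\<lambda>w. (fst w, fst (snd w))) \<in> measurable P (\<mu>X \<Otimes>\<^sub>M \<mu>Y)"
        using P_proj_measurable(1,2) by measurable
      then show "(\<lambda>w. indicator C (fst w, fst (snd w)) * (snd (snd w) - fst (snd w))) \<in> borel_measurable P"
        using P_proj_measurable(8,9) by measurable
      show "\<bar>indicator C (fst w, fst (snd w)) * (snd (snd w) - fst (snd w))\<bar> \<le> 2 * R" if "w \<in> X \<times> Y \<times> Z" for w
        using R(1) R(4)[of "snd (snd w)"] R(3)[of "fst (snd w)"] that by (auto split: split_indicator)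
    qed simp
    also have "\<dots> = 0"
    proof (rule integral_eq_zero_AE)
      show "AE y in \<mu>Y. (\<integral>v. indicator C (fst v, y) * (snd v - y) \<partial>K y) = 0"
        using fib
      proof eventually_elim
        case (elim y)
        \<comment> \<open>For fixed \<open>y\<close> the indicator of \<open>C\<close> is the
          indicator of its section in \<open>x\<close>, a legitimate test set for the fibre.\<close>
        have "(\<lambda>x. (x, y)) -` C \<in> sets (borel_on X)"
          using sets_Pair2[OF C, of y] by (simp add: sets_marginals)
        with elim have "(\<integral>v. indicator ((\<lambda>x. (x, y)) -` C) (fst v) * (snd v - y) \<partial>K y) = 0" by blast
        then show ?case by (simp add: indicator_def)
      qed
    qed
    finally show ?thesis .
  qed
qed

end

section \<open>Repairing approximate densities\<close>

text \<open>
  The correction terms are the row and column defects of \<open>q\<close> and, as a multiple of \<open>z - y\<close>, its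
  barycentre defect; the result has row and column masses 1 and barycentre \<open>y\<close>, but may be negative.
  For \<open>\<sigma>\<^sub>Z = \<delta>\<^sub>y\<close> the last denominator is 0 and the quotient is 0, which is harmless because
  \<open>z = y\<close> almost surely.
\<close>

definition repair :: "real measure \<Rightarrow> real measure \<Rightarrow> real \<Rightarrow> (real \<times> real \<Rightarrow> real) \<Rightarrow> real \<times> real \<Rightarrow> real" where
  "repair \<sigma>X \<sigma>Z y q w = q w - (\<integral>z. q (fst w, z) \<partial>\<sigma>Z) - (\<integral>x. q (x, snd w) \<partial>\<sigma>X) + (\<integral>x. \<integral>z. q (x, z) \<partial>\<sigma>Z \<partial>\<sigma>X) + 1
    - ((\<integral>z. q (fst w, z) * (z - y) \<partial>\<sigma>Z) - (\<integral>x. \<integral>z. q (x, z) * (z - y) \<partial>\<sigma>Z \<partial>\<sigma>X)) * (snd w - y)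
      / (\<integral>z. (z - y)\<^sup>2 \<partial>\<sigma>Z)"

text \<open>Mixing with the product law, whose density is 1, makes a repaired density nonnegative.\<close>

definition weight :: "real measure \<Rightarrow> real measure \<Rightarrow> real \<Rightarrow> (real \<times> real \<Rightarrow> real) \<Rightarrow> real \<Rightarrow> real \<times> real \<Rightarrow> real" where
  "weight \<sigma>X \<sigma>Z y q \<eta> w = (repair \<sigma>X \<sigma>Z y q w + \<eta>) / (1 + \<eta>)"

text \<open>The situation over one fixed \<open>y\<close>. Since \<open>\<sigma>Z\<close> has mean
  \<open>y\<close>, the product law is itself a barycentric coupling, which makes mixing with it
  harmless.\<close>

locale fibre =
  fixes X Z :: "real set" and \<sigma>X \<sigma>Z :: "real measure" and y R :: real
  assumes compact: "compact X" "compact Z"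
    and prob: "prob_space \<sigma>X" "prob_space \<sigma>Z"
    and sets_\<sigma>: "sets \<sigma>X = sets (borel_on X)" "sets \<sigma>Z = sets (borel_on Z)"
    and R: "\<And>x. x \<in> X \<Longrightarrow> \<bar>x\<bar> \<le> R" "\<And>z. z \<in> Z \<Longrightarrow> \<bar>z\<bar> \<le> R" "\<bar>y\<bar> \<le> R"
    and mean: "(\<integral>z. z \<partial>\<sigma>Z) = y"
begin

sublocale X: prob_space \<sigma>X by (rule prob)
sublocale Z: prob_space \<sigma>Z by (rule prob)
sublocale pair_prob_space \<sigma>X \<sigma>Z ..

abbreviation "\<rho> \<equiv> \<sigma>X \<Otimes>\<^sub>M \<sigma>Z"

lemma spaces: "space \<sigma>X = X" "space \<sigma>Z = Z" "space \<rho> = X \<times> Z"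
  using space_sets_borel_on[OF sets_\<sigma>(1)] space_sets_borel_on[OF sets_\<sigma>(2)] by (auto simp: space_pair_measure)

lemma coord_measurable:
  shows fst_measurable[measurable]: "fst \<in> borel_measurable \<rho>" and snd_measurable[measurable]: "snd \<in> borel_measurable \<rho>"
    and ident_measurable: "(\<lambda>x. x) \<in> borel_measurable \<sigma>X" "(\<lambda>x. x) \<in> borel_measurable \<sigma>Z"
proof -
  show 1: "(\<lambda>x. x) \<in> borel_measurable \<sigma>X" "(\<lambda>x. x) \<in> borel_measurable \<sigma>Z"
    using borel_measurable_borel_on_ident sets_\<sigma> by auto
  show "fst \<in> borel_measurable \<rho>" "snd \<in> borel_measurable \<rho>"
    using measurable_compose[OF measurable_fst 1(1)] measurable_compose[OF measurable_snd 1(2)] by auto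
qed

lemma shift_measurable[measurable]: "(\<lambda>z. z - c) \<in> borel_measurable \<sigma>Z"
  by (intro borel_measurable_diff ident_measurable borel_measurable_const)

lemma R_nonneg: "R \<ge> 0" using R(3) by linarith

lemma dist_y: "z \<in> Z \<Longrightarrow> \<bar>z - y\<bar> \<le> 2 * R"
  using R(2)[of z] R(3) by linarith

lemma integrable_bounded_Z:
  fixes f :: "real \<Rightarrow> real"
  shows "f \<in> borel_measurable \<sigma>Z \<Longrightarrow> (\<And>z. z \<in> Z \<Longrightarrow> \<bar>f z\<bar> \<le> C) \<Longrightarrow> integrable \<sigma>Z f"
  using prob_space_integrable_bounded[OF prob(2)] spaces by metis

lemma integrable_bounded_X:
  fixes f :: "real \<Rightarrow> real"
  shows "f \<in> borel_measurable \<sigma>X \<Longrightarrow> (\<And>z. z \<in> X \<Longrightarrow> \<bar>f z\<bar> \<le> C) \<Longrightarrow> integrable \<sigma>X f"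
  using prob_space_integrable_bounded[OF prob(1)] spaces by metis

lemma integrable_bounded_\<rho>:
  fixes f :: "real \<times> real \<Rightarrow> real"
  shows "f \<in> borel_measurable \<rho> \<Longrightarrow> (\<And>w. w \<in> X \<times> Z \<Longrightarrow> \<bar>f w\<bar> \<le> C) \<Longrightarrow> integrable \<rho> f"
  using prob_space_integrable_bounded[OF P.prob_space_axioms] spaces by metis

lemma integral_abs_le_Z:
  fixes f :: "real \<Rightarrow> real"
  shows "f \<in> borel_measurable \<sigma>Z \<Longrightarrow> (\<And>z. z \<in> Z \<Longrightarrow> \<bar>f z\<bar> \<le> C) \<Longrightarrow> \<bar>\<integral>z. f z \<partial>\<sigma>Z\<bar> \<le> C"
  using prob_space_integral_abs_le[OF prob(2)] spaces by metis

lemma integral_abs_le_X: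
  fixes f :: "real \<Rightarrow> real"
  shows "f \<in> borel_measurable \<sigma>X \<Longrightarrow> (\<And>z. z \<in> X \<Longrightarrow> \<bar>f z\<bar> \<le> C) \<Longrightarrow> \<bar>\<integral>z. f z \<partial>\<sigma>X\<bar> \<le> C"
  using prob_space_integral_abs_le[OF prob(1)] spaces by metis

lemma integral_centered: "integrable \<sigma>Z (\<lambda>z. z - y)" "(\<integral>z. z - y \<partial>\<sigma>Z) = 0"
proof -
  have "integrable \<sigma>Z (\<lambda>z. z)" by (rule integrable_bounded_Z[OF ident_measurable(2) R(2)])
  then show "integrable \<sigma>Z (\<lambda>z. z - y)" "(\<integral>z. z - y \<partial>\<sigma>Z) = 0"
    using mean by (auto simp: Z.prob_space)
qed

lemma integrable_centered_sq: "integrable \<sigma>Z (\<lambda>z. (z - y) * (z - y))"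
proof (rule integrable_bounded_Z[where C="(2 * R) * (2 * R)"])
  show "\<bar>(z - y) * (z - y)\<bar> \<le> (2 * R) * (2 * R)" if "z \<in> Z" for z
    unfolding abs_mult using dist_y[OF that] R_nonneg by (intro mult_mono) auto
qed measurable

context
  fixes q :: "real \<times> real \<Rightarrow> real" and C :: real
  assumes q: "q \<in> borel_measurable \<rho>" and C: "\<forall>w\<in>X \<times> Z. \<bar>q w\<bar> \<le> C"
begin

lemma abs_q_le: "w \<in> X \<times> Z \<Longrightarrow> \<bar>q w\<bar> \<le> C"
  using C by blast

definition "row_mass x = (\<integral>z. q (x, z) \<partial>\<sigma>Z)"
definition "col_mass z = (\<integral>x. q (x, z) \<partial>\<sigma>X)"
definition "mass = (\<integral>x. row_mass x \<partial>\<sigma>X)"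
definition "row_bary x = (\<integral>z. q (x, z) * (z - y) \<partial>\<sigma>Z)"
definition "total_bary = (\<integral>x. row_bary x \<partial>\<sigma>X)"
definition "var_y = (\<integral>z. (z - y)\<^sup>2 \<partial>\<sigma>Z)"

lemma repair_eq: "repair \<sigma>X \<sigma>Z y q w = q w - row_mass (fst w) - col_mass (snd w) + mass + 1 - (row_bary (fst w) - total_bary) * (snd w - y) / var_y"
  by (simp add: repair_def row_mass_def col_mass_def mass_def row_bary_def total_bary_def var_y_def)

lemma repair_meas:
  "row_mass \<in> borel_measurable \<sigma>X" "col_mass \<in> borel_measurable \<sigma>Z" "row_bary \<in> borel_measurable \<sigma>X"
proof -
  note [measurable] = q
  show "row_mass \<in> borel_measurable \<sigma>X" "row_bary \<in> borel_measurable \<sigma>X" unfolding row_mass_def row_bary_def by measurable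
  have "(\<lambda>w. q (snd w, fst w)) \<in> borel_measurable (\<sigma>Z \<Otimes>\<^sub>M \<sigma>X)"
    using measurable_compose[OF measurable_Pair[OF measurable_snd measurable_fst] q] by simp
  then show "col_mass \<in> borel_measurable \<sigma>Z"
    unfolding col_mass_def[abs_def] using X.borel_measurable_lebesgue_integral[of "\<lambda>z x. q (x, z)" \<sigma>Z] by (simp add: split_beta')
qed

lemma repair_section:
  "x \<in> X \<Longrightarrow> (\<lambda>z. q (x, z)) \<in> borel_measurable \<sigma>Z" "z \<in> Z \<Longrightarrow> (\<lambda>x. q (x, z)) \<in> borel_measurable \<sigma>X"
  using measurable_Pair2[OF q] measurable_Pair1[OF q] spaces by auto

lemma C_nonneg: "C \<ge> 0"
proof -
  obtain x z where "x \<in> X" "z \<in> Z" using X.not_empty Z.not_empty spaces by blast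
  then show ?thesis using abs_q_le[of "(x, z)"] by (intro order_trans[OF abs_ge_zero[of "q (x, z)"]]) auto
qed

lemma q_centered_le: "w \<in> X \<times> Z \<Longrightarrow> \<bar>q w * (snd w - y)\<bar> \<le> C * (2 * R)"
  using abs_q_le[of w] dist_y[of "snd w"] C_nonneg by (auto simp: abs_mult intro!: mult_mono)

lemma repair_bounds:
  "x \<in> X \<Longrightarrow> \<bar>row_mass x\<bar> \<le> C" "z \<in> Z \<Longrightarrow> \<bar>col_mass z\<bar> \<le> C" "x \<in> X \<Longrightarrow> \<bar>row_bary x\<bar> \<le> C * (2 * R)"
proof -
  show "x \<in> X \<Longrightarrow> \<bar>row_mass x\<bar> \<le> C" unfolding row_mass_def by (rule integral_abs_le_Z[OF repair_section(1)]) (use abs_q_le in auto)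
  show "z \<in> Z \<Longrightarrow> \<bar>col_mass z\<bar> \<le> C" unfolding col_mass_def by (rule integral_abs_le_X[OF repair_section(2)]) (use abs_q_le in auto)
  show "\<bar>row_bary x\<bar> \<le> C * (2 * R)" if "x \<in> X"
  proof -
    note [measurable] = repair_section(1)[OF that]
    show ?thesis unfolding row_bary_def
      by (rule integral_abs_le_Z) (measurable, use q_centered_le[of "(x, z)" for z] that in auto)
  qed
qed

lemma integral_col_mass: "(\<integral>z. col_mass z \<partial>\<sigma>Z) = mass" "(\<integral>z. col_mass z * (z - y) \<partial>\<sigma>Z) = total_bary"
proof -
  have "integrable \<rho> q" by (rule integrable_bounded_\<rho>[OF q abs_q_le])
  then show "(\<integral>z. col_mass z \<partial>\<sigma>Z) = mass"
    unfolding col_mass_def mass_def row_mass_def by (intro Fubini_integral) (simp add: split_beta')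
  have "integrable \<rho> (\<lambda>w. q w * (snd w - y))" by (rule integrable_bounded_\<rho>[OF _ q_centered_le]) (use q in measurable)
  then have "(\<integral>z. \<integral>x. q (x, z) * (z - y) \<partial>\<sigma>X \<partial>\<sigma>Z) = total_bary"
    unfolding total_bary_def row_bary_def by (intro Fubini_integral) (simp add: split_beta')
  then show "(\<integral>z. col_mass z * (z - y) \<partial>\<sigma>Z) = total_bary" by (simp add: col_mass_def)
qed

text \<open>Zero second moment about \<open>y\<close> forces \<open>z = y\<close> almost surely, so
  all moments against \<open>z - y\<close> vanish.\<close>

lemma var_y_zero:
  assumes "var_y = 0" and [measurable]: "f \<in> borel_measurable \<sigma>Z" shows "(\<integral>z. f z * (z - y) \<partial>\<sigma>Z) = 0"
proof (rule integral_eq_zero_AE)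
  have "integrable \<sigma>Z (\<lambda>z. (z - y)\<^sup>2)"
    using integrable_centered_sq by (simp add: power2_eq_square)
  then have "AE z in \<sigma>Z. (z - y)\<^sup>2 = 0"
    using assms(1) unfolding var_y_def by (subst (asm) integral_nonneg_eq_0_iff_AE) auto
  then show "AE z in \<sigma>Z. f z * (z - y) = 0" by eventually_elim simp
qed

lemma repair_measurable: "repair \<sigma>X \<sigma>Z y q \<in> borel_measurable \<rho>"
  unfolding repair_eq[abs_def]
  by (intro borel_measurable_divide borel_measurable_times borel_measurable_add borel_measurable_diff borel_measurable_const
      q snd_measurable measurable_compose[OF measurable_fst repair_meas(1)] measurable_compose[OF measurable_snd repair_meas(2)]
      measurable_compose[OF measurable_fst repair_meas(3)])

lemma repair_bounded: "\<exists>D. \<forall>w\<in>X \<times> Z. \<bar>repair \<sigma>X \<sigma>Z y q w\<bar> \<le> D"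
proof (intro exI ballI)
  fix w assume w: "w \<in> X \<times> Z"
  have 1: "\<bar>(row_bary (fst w) - total_bary) * (snd w - y) / var_y\<bar> \<le> (C * (2 * R) + \<bar>total_bary\<bar>) * (2 * R) / \<bar>var_y\<bar>"
    using repair_bounds(3)[of "fst w"] dist_y[of "snd w"] w C_nonneg R_nonneg
    by (auto simp: abs_mult abs_divide intro!: divide_right_mono mult_mono)
  show "\<bar>repair \<sigma>X \<sigma>Z y q w\<bar> \<le> 3 * C + \<bar>mass\<bar> + 1 + (C * (2 * R) + \<bar>total_bary\<bar>) * (2 * R) / \<bar>var_y\<bar>"
  proof -
    have tri: "\<bar>a - e - f + g + 1 - h\<bar> \<le> 3 * c + \<bar>g\<bar> + 1 + t"
      if "\<bar>a\<bar> \<le> c" "\<bar>e\<bar> \<le> c" "\<bar>f\<bar> \<le> c" "\<bar>h\<bar> \<le> t" for a c e f g h t :: real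
      using that by linarith
    show ?thesis
      unfolding repair_eq by (rule tri[OF abs_q_le[OF w] repair_bounds(1,2) 1]) (use w in auto)
  qed
qed

text \<open>For the mass, \<open>col_mass\<close> integrates to \<open>mass\<close> and the last
  term to 0, as \<open>z - y\<close> is centred. For the barycentre, terms constant in
  \<open>z\<close> drop out; \<open>q\<close> and \<open>col_mass\<close> leave
  \<open>row_bary x - total_bary\<close>, and the last term removes exactly this because the second
  moment of \<open>z - y\<close> is its denominator.\<close>

lemma integral_repair_Z:
  assumes x: "x \<in> X"
  shows "(\<integral>z. repair \<sigma>X \<sigma>Z y q (x, z) \<partial>\<sigma>Z) = 1" "(\<integral>z. repair \<sigma>X \<sigma>Z y q (x, z) * (z - y) \<partial>\<sigma>Z) = 0"
proof -
  note [measurable] = repair_section(1)[OF x] repair_meas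
  have i: "integrable \<sigma>Z (\<lambda>z. q (x, z))" "integrable \<sigma>Z col_mass"
    using abs_q_le x repair_bounds(2) by (auto intro!: integrable_bounded_Z[where C=C])
  note ic = integral_centered
  note sq = integrable_centered_sq
  have j: "integrable \<sigma>Z (\<lambda>z. q (x, z) * (z - y))" "integrable \<sigma>Z (\<lambda>z. col_mass z * (z - y))"
    using abs_q_le x repair_bounds(2) dist_y R_nonneg C_nonneg
    by (auto intro!: integrable_bounded_Z[where C="C * (2 * R)"] mult_mono simp: abs_mult)
  have "(\<integral>z. repair \<sigma>X \<sigma>Z y q (x, z) \<partial>\<sigma>Z) =
     (\<integral>z. q (x, z) - row_mass x - col_mass z + mass + 1 - (row_bary x - total_bary) / var_y * (z - y) \<partial>\<sigma>Z)"
    by (simp add: repair_eq)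
  also have "\<dots> = row_mass x - row_mass x - mass + mass + 1 - (row_bary x - total_bary) / var_y * 0"
    using i ic integral_col_mass(1) by (simp add: Z.prob_space row_mass_def)
  finally show "(\<integral>z. repair \<sigma>X \<sigma>Z y q (x, z) \<partial>\<sigma>Z) = 1" by simp
  have "(\<integral>z. repair \<sigma>X \<sigma>Z y q (x, z) * (z - y) \<partial>\<sigma>Z) =
     (\<integral>z. q (x, z) * (z - y) - col_mass z * (z - y) + (mass + 1 - row_mass x) * (z - y) - (row_bary x - total_bary) / var_y * ((z - y) * (z - y)) \<partial>\<sigma>Z)"
    by (simp add: repair_eq algebra_simps)
  also have "\<dots> = row_bary x - total_bary - (row_bary x - total_bary) / var_y * var_y"
    using j ic integral_col_mass(2) sq by (simp add: row_bary_def var_y_def power2_eq_square)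
  also have "\<dots> = 0"
  \<comment> \<open>In the degenerate case the quotient does not cancel anything, but
    \<open>row_bary\<close> and \<open>total_bary\<close> already vanish.\<close>
  proof (cases "var_y = 0")
    case True
    have "row_bary x' = 0" if "x' \<in> X" for x'
      unfolding row_bary_def by (rule var_y_zero[OF True]) (rule repair_section(1)[OF that])
    then have "row_bary x = 0" "total_bary = 0"
      using x spaces unfolding total_bary_def by (auto intro!: integral_eq_zero_AE)
    then show ?thesis by simp
  qed simp
  finally show "(\<integral>z. repair \<sigma>X \<sigma>Z y q (x, z) * (z - y) \<partial>\<sigma>Z) = 0" .
qed

text \<open>Averaged over \<open>x\<close>, \<open>row_mass\<close> cancels against
  \<open>mass\<close>. The barycentre correction does not disturb the columns because
  \<open>total_bary\<close> is the mean of \<open>row_bary\<close> and has been subtracted.\<close>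

lemma integral_repair_X:
  assumes z: "z \<in> Z"
  shows "(\<integral>x. repair \<sigma>X \<sigma>Z y q (x, z) \<partial>\<sigma>X) = 1"
proof -
  note [measurable] = repair_section(2)[OF z] repair_meas
  have i: "integrable \<sigma>X (\<lambda>x. q (x, z))" "integrable \<sigma>X row_mass"
    using abs_q_le z repair_bounds(1) by (auto intro!: integrable_bounded_X[where C=C])
  have j: "integrable \<sigma>X row_bary"
    using repair_bounds(3) by (auto intro!: integrable_bounded_X)
  have "(\<integral>x. repair \<sigma>X \<sigma>Z y q (x, z) \<partial>\<sigma>X) =
     (\<integral>x. q (x, z) - row_mass x - col_mass z + mass + 1 - (row_bary x - total_bary) * ((z - y) / var_y) \<partial>\<sigma>X)"
    by (simp add: repair_eq)
  also have "\<dots> = col_mass z - mass - col_mass z + mass + 1 - (total_bary - total_bary) * ((z - y) / var_y)"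
    using i j by (simp add: X.prob_space col_mass_def mass_def total_bary_def)
  finally show ?thesis by simp
qed

end


text \<open>By Fubini, row masses give the first marginal, column masses the second, and row
  barycentres the test identity. Nonnegativity is only required almost everywhere: for the later
  candidates it is detected through the integral of the negative part, a quantity measurable in
  \<open>y\<close>.\<close>

lemma density_coupling:
  fixes w :: "real \<times> real \<Rightarrow> real"
  assumes w[measurable]: "w \<in> borel_measurable \<rho>" and D: "\<And>v. v \<in> X \<times> Z \<Longrightarrow> \<bar>w v\<bar> \<le> D"
    and nonneg: "AE v in \<rho>. 0 \<le> w v"
    and row: "\<And>x. x \<in> X \<Longrightarrow> (\<integral>z. w (x, z) \<partial>\<sigma>Z) = 1"
    and col: "\<And>z. z \<in> Z \<Longrightarrow> (\<integral>x. w (x, z) \<partial>\<sigma>X) = 1"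
    and bary: "\<And>x. x \<in> X \<Longrightarrow> (\<integral>z. w (x, z) * (z - y) \<partial>\<sigma>Z) = 0"
  shows "density \<rho> w \<in> couplings \<sigma>X \<sigma>Z"
    and "A \<in> sets \<sigma>X \<Longrightarrow> (\<integral>v. indicator A (fst v) * (snd v - y) \<partial>density \<rho> w) = 0"
proof -
  have D0: "D \<ge> 0"
  proof -
    obtain x z where "x \<in> X" "z \<in> Z" using X.not_empty Z.not_empty spaces by blast
    then show ?thesis using D[of "(x, z)"] by (intro order_trans[OF abs_ge_zero[of "w (x, z)"]]) auto
  qed
  have iw: "integrable \<rho> w" by (rule integrable_bounded_\<rho>[OF w D])
  have "(\<integral>v. w v \<partial>\<rho>) = (\<integral>x. \<integral>z. w (x, z) \<partial>\<sigma>Z \<partial>\<sigma>X)" by (rule integral_fst'[OF iw, symmetric])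
  also have "\<dots> = (\<integral>x. 1 \<partial>\<sigma>X)" using row spaces by (intro Bochner_Integration.integral_cong) auto
  finally have "(\<integral>v. w v \<partial>\<rho>) = 1" by (simp add: X.prob_space)
  then have one: "(\<integral>\<^sup>+v. ennreal (w v) \<partial>\<rho>) = 1"
    using nn_integral_eq_integral[OF iw nonneg] by simp
  have "emeasure (density \<rho> w) (space \<rho>) = (\<integral>\<^sup>+v. ennreal (w v) * indicator (space \<rho>) v \<partial>\<rho>)"
    by (rule emeasure_density[OF measurable_compose[OF w measurable_ennreal] sets.top])
  also have "\<dots> = (\<integral>\<^sup>+v. ennreal (w v) \<partial>\<rho>)"
    by (rule nn_integral_cong) simp
  finally interpret N: prob_space "density \<rho> w"
    unfolding one by (intro prob_spaceI) simp
  have fst: "fst \<in> measurable (density \<rho> w) \<sigma>X" and snd: "snd \<in> measurable (density \<rho> w) \<sigma>Z" by auto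
  interpret dX: prob_space "distr (density \<rho> w) \<sigma>X fst" by (rule N.prob_space_distr[OF fst])
  interpret dZ: prob_space "distr (density \<rho> w) \<sigma>Z snd" by (rule N.prob_space_distr[OF snd])
  have dens: "(\<integral>v. f v \<partial>density \<rho> w) = (\<integral>v. w v * f v \<partial>\<rho>)" if "f \<in> borel_measurable \<rho>" for f :: "real \<times> real \<Rightarrow> real"
    by (rule integral_real_density[OF w nonneg that])
  have "distr (density \<rho> w) \<sigma>X fst = \<sigma>X"
  proof (rule measure_eqI)
    fix A assume "A \<in> sets (distr (density \<rho> w) \<sigma>X fst)"
    then have A[measurable]: "A \<in> sets \<sigma>X" by simp
    have i: "integrable \<rho> (\<lambda>v. w v * indicator A (fst v))"
      by (rule integrable_bounded_\<rho>[where C=D]) (use D D0 in \<open>auto split: split_indicator\<close>)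
    have "measure (distr (density \<rho> w) \<sigma>X fst) A = (\<integral>v. w v * indicator A (fst v) \<partial>\<rho>)"
      unfolding measure_eq_integral_indicator[OF fst A] by (rule dens) measurable
    also have "\<dots> = (\<integral>x. \<integral>z. w (x, z) * indicator A (fst (x, z)) \<partial>\<sigma>Z \<partial>\<sigma>X)" by (rule integral_fst'[OF i, symmetric])
    also have "\<dots> = (\<integral>x. indicator A x \<partial>\<sigma>X)" using row spaces by (intro Bochner_Integration.integral_cong) auto
    also have "\<dots> = measure \<sigma>X A" using sets.sets_into_space[OF A] by (simp add: Int_absorb2)
    finally show "emeasure (distr (density \<rho> w) \<sigma>X fst) A = emeasure \<sigma>X A"
      by (simp add: dX.emeasure_eq_measure X.emeasure_eq_measure)
  qed simp
  moreover have "distr (density \<rho> w) \<sigma>Z snd = \<sigma>Z"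
  proof (rule measure_eqI)
    fix A assume "A \<in> sets (distr (density \<rho> w) \<sigma>Z snd)"
    then have A[measurable]: "A \<in> sets \<sigma>Z" by simp
    have i: "integrable \<rho> (\<lambda>v. w v * indicator A (snd v))"
      by (rule integrable_bounded_\<rho>[where C=D]) (use D D0 in \<open>auto split: split_indicator\<close>)
    have "measure (distr (density \<rho> w) \<sigma>Z snd) A = (\<integral>v. w v * indicator A (snd v) \<partial>\<rho>)"
      unfolding measure_eq_integral_indicator[OF snd A] by (rule dens) measurable
    also have "\<dots> = (\<integral>z. \<integral>x. w (x, z) * indicator A (snd (x, z)) \<partial>\<sigma>X \<partial>\<sigma>Z)"
      using integral_snd[of "\<lambda>x z. w (x, z) * indicator A z"] i by (simp add: split_beta')
    also have "\<dots> = (\<integral>z. indicator A z \<partial>\<sigma>Z)" using col spaces by (intro Bochner_Integration.integral_cong) auto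
    also have "\<dots> = measure \<sigma>Z A" using sets.sets_into_space[OF A] by (simp add: Int_absorb2)
    finally show "emeasure (distr (density \<rho> w) \<sigma>Z snd) A = emeasure \<sigma>Z A"
      by (simp add: dZ.emeasure_eq_measure Z.emeasure_eq_measure)
  qed simp
  ultimately show "density \<rho> w \<in> couplings \<sigma>X \<sigma>Z"
    using N.prob_space_axioms by (simp add: couplings_def)
  show "(\<integral>v. indicator A (fst v) * (snd v - y) \<partial>density \<rho> w) = 0" if A[measurable]: "A \<in> sets \<sigma>X"
  proof -
    have i: "integrable \<rho> (\<lambda>v. w v * (indicator A (fst v) * (snd v - y)))"
    proof (rule integrable_bounded_\<rho>[where C="D * (2 * R)"])
      show "\<bar>w v * (indicator A (fst v) * (snd v - y))\<bar> \<le> D * (2 * R)" if "v \<in> X \<times> Z" for v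
      proof -
        have "\<bar>indicator A (fst v) * (snd v - y)\<bar> \<le> 2 * R"
          using that dist_y[of "snd v"] R_nonneg by (auto split: split_indicator)
        then show ?thesis unfolding abs_mult[of "w v"] using D[OF that] D0 by (intro mult_mono) auto
      qed
    qed measurable
    have "(\<integral>v. indicator A (fst v) * (snd v - y) \<partial>density \<rho> w) = (\<integral>v. w v * (indicator A (fst v) * (snd v - y)) \<partial>\<rho>)"
      by (rule dens) measurable
    also have "\<dots> = (\<integral>x. \<integral>z. w (x, z) * (indicator A (fst (x, z)) * (snd (x, z) - y)) \<partial>\<sigma>Z \<partial>\<sigma>X)"
      by (rule integral_fst'[OF i, symmetric])
    also have "\<dots> = (\<integral>x. indicator A x * (\<integral>z. w (x, z) * (z - y) \<partial>\<sigma>Z) \<partial>\<sigma>X)"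
      by (simp only: fst_conv snd_conv mult.left_commute[of "w _"] integral_mult_right_zero)
    also have "\<dots> = (\<integral>x. 0 \<partial>\<sigma>X)" using bary spaces by (intro Bochner_Integration.integral_cong) auto
    finally show ?thesis by simp
  qed
qed

lemma weight_measurable:
  assumes q: "q \<in> borel_measurable \<rho>" and C: "\<forall>w\<in>X \<times> Z. \<bar>q w\<bar> \<le> C"
  shows "weight \<sigma>X \<sigma>Z y q \<eta> \<in> borel_measurable \<rho>"
proof -
  show ?thesis unfolding weight_def[abs_def]
    by (intro borel_measurable_divide borel_measurable_add borel_measurable_const repair_measurable[OF q C])
qed

lemma weight_bounded:
  assumes q: "q \<in> borel_measurable \<rho>" and C: "\<forall>w\<in>X \<times> Z. \<bar>q w\<bar> \<le> C"
  shows "\<exists>D. \<forall>v\<in>X \<times> Z. \<bar>weight \<sigma>X \<sigma>Z y q \<eta> v\<bar> \<le> D"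
proof -
  obtain D where D: "\<And>v. v \<in> X \<times> Z \<Longrightarrow> \<bar>repair \<sigma>X \<sigma>Z y q v\<bar> \<le> D" using repair_bounded[OF q C] by auto
  have "\<bar>weight \<sigma>X \<sigma>Z y q \<eta> v\<bar> \<le> (D + \<bar>\<eta>\<bar>) / \<bar>1 + \<eta>\<bar>" if "v \<in> X \<times> Z" for v
    unfolding weight_def abs_divide using D[OF that] by (intro divide_right_mono) auto
  then show ?thesis by blast
qed

text \<open>The repaired density and the constant 1 satisfy the same linear constraints, and
  \<open>weight\<close> is their affine combination with coefficients summing to 1. Only the sign is
  left as a hypothesis.\<close>

lemma weight_density_coupling:
  assumes q: "q \<in> borel_measurable \<rho>" and C: "\<forall>w\<in>X \<times> Z. \<bar>q w\<bar> \<le> C" and \<eta>: "\<eta> > 0"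
    and nonneg: "AE v in \<rho>. 0 \<le> weight \<sigma>X \<sigma>Z y q \<eta> v"
  shows "density \<rho> (weight \<sigma>X \<sigma>Z y q \<eta>) \<in> couplings \<sigma>X \<sigma>Z"
    and "A \<in> sets \<sigma>X \<Longrightarrow> (\<integral>v. indicator A (fst v) * (snd v - y) \<partial>density \<rho> (weight \<sigma>X \<sigma>Z y q \<eta>)) = 0"
proof -
  obtain D where D: "\<And>v. v \<in> X \<times> Z \<Longrightarrow> \<bar>weight \<sigma>X \<sigma>Z y q \<eta> v\<bar> \<le> D" using weight_bounded[OF q C] by blast
  obtain E where E: "\<And>v. v \<in> X \<times> Z \<Longrightarrow> \<bar>repair \<sigma>X \<sigma>Z y q v\<bar> \<le> E" using repair_bounded[OF q C] by auto
  have mZ: "(\<lambda>z. repair \<sigma>X \<sigma>Z y q (x, z)) \<in> borel_measurable \<sigma>Z" if "x \<in> X" for x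
    using measurable_Pair2[OF repair_measurable[OF q C]] that spaces by auto
  have mX: "(\<lambda>x. repair \<sigma>X \<sigma>Z y q (x, z)) \<in> borel_measurable \<sigma>X" if "z \<in> Z" for z
    using measurable_Pair1[OF repair_measurable[OF q C]] that spaces by auto
  have row: "(\<integral>z. weight \<sigma>X \<sigma>Z y q \<eta> (x, z) \<partial>\<sigma>Z) = 1" if x: "x \<in> X" for x
  proof -
    have i: "integrable \<sigma>Z (\<lambda>z. repair \<sigma>X \<sigma>Z y q (x, z))"
      by (rule integrable_bounded_Z[OF mZ[OF x], where C=E]) (use E x in auto)
    show ?thesis unfolding weight_def using i integral_repair_Z(1)[OF q C x] \<eta> by (simp add: Z.prob_space)
  qed
  have col: "(\<integral>x. weight \<sigma>X \<sigma>Z y q \<eta> (x, z) \<partial>\<sigma>X) = 1" if z: "z \<in> Z" for z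
  proof -
    have i: "integrable \<sigma>X (\<lambda>x. repair \<sigma>X \<sigma>Z y q (x, z))"
      by (rule integrable_bounded_X[OF mX[OF z], where C=E]) (use E z in auto)
    show ?thesis unfolding weight_def using i integral_repair_X[OF q C z] \<eta> by (simp add: X.prob_space)
  qed
  have bary: "(\<integral>z. weight \<sigma>X \<sigma>Z y q \<eta> (x, z) * (z - y) \<partial>\<sigma>Z) = 0" if x: "x \<in> X" for x
  proof -
    note [measurable] = mZ[OF x]
    have E0: "E \<ge> 0" using E[of "(x, z)" for z] x Z.not_empty spaces by (metis abs_ge_zero ex_in_conv mem_Sigma_iff order_trans)
    have i: "integrable \<sigma>Z (\<lambda>z. repair \<sigma>X \<sigma>Z y q (x, z) * (z - y))"
    proof (rule integrable_bounded_Z[where C="E * (2 * R)"])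
      show "\<bar>repair \<sigma>X \<sigma>Z y q (x, z) * (z - y)\<bar> \<le> E * (2 * R)" if "z \<in> Z" for z
        unfolding abs_mult using E[of "(x, z)"] x that dist_y[OF that] E0 by (intro mult_mono) auto
    qed measurable
    have "(\<integral>z. weight \<sigma>X \<sigma>Z y q \<eta> (x, z) * (z - y) \<partial>\<sigma>Z) =
        (\<integral>z. (repair \<sigma>X \<sigma>Z y q (x, z) * (z - y) + \<eta> * (z - y)) / (1 + \<eta>) \<partial>\<sigma>Z)"
      by (simp add: weight_def algebra_simps)
    also have "\<dots> = 0"
      using i integral_centered integral_repair_Z(2)[OF q C x] by simp
    finally show ?thesis .
  qed
  note * = weight_measurable[OF q C] D nonneg row col bary
  show "density \<rho> (weight \<sigma>X \<sigma>Z y q \<eta>) \<in> couplings \<sigma>X \<sigma>Z"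
    by (rule density_coupling(1)[OF *])
  show "A \<in> sets \<sigma>X \<Longrightarrow> (\<integral>v. indicator A (fst v) * (snd v - y) \<partial>density \<rho> (weight \<sigma>X \<sigma>Z y q \<eta>)) = 0"
    by (rule density_coupling(2)[OF *])
qed

end

section \<open>Grid cells of side \<open>1 / N\<close> and integrals of functions constant on
  them\<close>

definition cell :: "nat \<Rightarrow> real \<Rightarrow> int" where
  "cell N x = \<lfloor>real N * x\<rfloor>"

lemma cell_measurable[measurable]: "cell N \<in> measurable borel (count_space UNIV)"
  unfolding cell_def by measurable

lemma cell_approx: "N > 0 \<Longrightarrow> \<bar>x - of_int (cell N x) / real N\<bar> \<le> 1 / real N"
proof -
  assume N: "N > 0"
  have "of_int (cell N x) \<le> real N * x" "real N * x < of_int (cell N x) + 1" by (auto simp: cell_def)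
  then have "\<bar>real N * x - of_int (cell N x)\<bar> / real N \<le> 1 / real N" using N by (intro divide_right_mono) auto
  moreover have "\<bar>x - of_int (cell N x) / real N\<bar> = \<bar>real N * x - of_int (cell N x)\<bar> / real N"
  proof -
    have "x - of_int (cell N x) / real N = (real N * x - of_int (cell N x)) / real N" using N by (simp add: field_simps)
    then show ?thesis using N by (simp only: abs_divide abs_of_nat)
  qed
  ultimately show ?thesis by simp
qed

lemma finite_cells: "bounded S \<Longrightarrow> finite (cell N ` S)"
proof -
  assume "bounded S"
  then obtain r where r: "\<And>x. x \<in> S \<Longrightarrow> \<bar>x\<bar> \<le> r" by (auto simp: bounded_iff)
  have "cell N ` S \<subseteq> {\<lfloor>- (real N * r)\<rfloor>..\<lfloor>real N * r\<rfloor>}"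
  proof safe
    fix x assume x: "x \<in> S"
    have "\<bar>real N * x\<bar> \<le> real N * r" using r[OF x] by (simp add: abs_mult mult_left_mono)
    then show "cell N x \<in> {\<lfloor>- (real N * r)\<rfloor>..\<lfloor>real N * r\<rfloor>}"
      unfolding cell_def by (auto intro!: floor_mono)
  qed
  then show ?thesis by (rule finite_subset) simp
qed

lemma integral_finite_range:
  fixes \<Psi> :: "'b \<Rightarrow> real"
  assumes M: "prob_space M" and f: "f \<in> measurable M (count_space UNIV)" and S: "finite S" "\<And>w. w \<in> space M \<Longrightarrow> f w \<in> S"
  shows "(\<integral>w. \<Psi> (f w) \<partial>M) = (\<Sum>s\<in>S. \<Psi> s * measure M {w\<in>space M. f w = s})"
proof -
  interpret prob_space M by fact
  have A: "{w\<in>space M. f w = s} \<in> sets M" for s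
    using measurable_sets[OF f, of "{s}"] by (simp add: vimage_def Int_def conj_commute)
  have "(\<integral>w. \<Psi> (f w) \<partial>M) = (\<integral>w. (\<Sum>s\<in>S. \<Psi> s * indicator {w\<in>space M. f w = s} w) \<partial>M)"
  proof (intro Bochner_Integration.integral_cong refl)
    fix w assume w: "w \<in> space M"
    have "(\<Sum>s\<in>S. \<Psi> s * indicator {w\<in>space M. f w = s} w) = (\<Sum>s\<in>S. if s = f w then \<Psi> s else 0)"
      using w by (intro sum.cong) auto
    also have "\<dots> = \<Psi> (f w)" using S w by simp
    finally show "\<Psi> (f w) = (\<Sum>s\<in>S. \<Psi> s * indicator {w\<in>space M. f w = s} w)" ..
  qed
  also have "\<dots> = (\<Sum>s\<in>S. \<integral>w. \<Psi> s * indicator {w\<in>space M. f w = s} w \<partial>M)"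
    using A by (intro Bochner_Integration.integral_sum integrable_mult_right) (auto intro: integrable_real_indicator simp: less_top[symmetric])
  also have "\<dots> = (\<Sum>s\<in>S. \<Psi> s * measure M {w\<in>space M. f w = s})"
    using A by simp
  finally show ?thesis .
qed

section \<open>Grid approximation\<close>

definition cell2 :: "nat \<Rightarrow> real \<times> real \<Rightarrow> int \<times> int" where
  "cell2 N w = (cell N (fst w), cell N (snd w))"

lemma cell2_measurable:
  assumes "fst \<in> borel_measurable M" "snd \<in> borel_measurable M"
  shows "cell2 N \<in> measurable M (count_space UNIV)"
proof -
  have "cell2 N -` {s} \<inter> space M \<in> sets M" for s
  proof -
    have "cell2 N -` {s} \<inter> space M =
      ((\<lambda>w. cell N (fst w)) -` {fst s} \<inter> space M) \<inter> ((\<lambda>w. cell N (snd w)) -` {snd s} \<inter> space M)"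
      by (auto simp: cell2_def)
    also have "\<dots> \<in> sets M"
      by (intro sets.Int measurable_sets[OF measurable_compose[OF assms(1) cell_measurable]]
          measurable_sets[OF measurable_compose[OF assms(2) cell_measurable]]) auto
    finally show ?thesis .
  qed
  then show ?thesis by (subst measurable_count_space_eq2_countable) auto
qed

context fibre
begin

lemma cell_measurable_\<sigma>: "cell N \<in> measurable \<sigma>X (count_space UNIV)" "cell N \<in> measurable \<sigma>Z (count_space UNIV)"
  using measurable_compose[OF ident_measurable(1) cell_measurable] measurable_compose[OF ident_measurable(2) cell_measurable]
  by auto

lemma finite_cells_XZ: "finite (cell N ` X)" "finite (cell N ` Z)"
  using compact by (auto intro: finite_cells compact_imp_bounded)

text \<open>On each grid rectangle \<open>\<pi>\<close> is replaced by the multiple of the product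
  law with the same mass, so \<open>d\<close> is the ratio of these masses. Functions of the cell
  keep their integrals, and the marginals are kept. The barycentre is exact only up to
  \<open>2 / N\<close>: \<open>z\<close> is replaced by a grid point once under
  \<open>\<sigma>Z\<close> and once under \<open>\<pi>\<close>, where the barycentre is exact, and
  each replacement costs at most \<open>1 / N\<close>.\<close>

lemma grid_density:
  assumes \<pi>: "\<pi> \<in> couplings \<sigma>X \<sigma>Z" and N: "N > 0"
    and bary: "\<And>A. A \<in> sets \<sigma>X \<Longrightarrow> (\<integral>v. indicator A (fst v) * (snd v - y) \<partial>\<pi>) = 0"
  shows "\<exists>d :: int \<times> int \<Rightarrow> real. (\<forall>s. 0 \<le> d s) \<and>
    (\<forall>x\<in>X. (\<integral>z. d (cell N x, cell N z) \<partial>\<sigma>Z) = 1) \<and>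
    (\<forall>z\<in>Z. (\<integral>x. d (cell N x, cell N z) \<partial>\<sigma>X) = 1) \<and>
    (\<forall>x\<in>X. \<bar>\<integral>z. d (cell N x, cell N z) * (z - y) \<partial>\<sigma>Z\<bar> \<le> 2 / real N) \<and>
    (\<forall>\<Psi> :: int \<times> int \<Rightarrow> real. (\<integral>w. \<Psi> (cell2 N w) * d (cell2 N w) \<partial>\<rho>) = (\<integral>w. \<Psi> (cell2 N w) \<partial>\<pi>))"
proof -
  note c = couplings_cong_sets[OF \<pi> refl refl]
  interpret \<pi>: prob_space \<pi> by (rule c(1))
  note sp\<pi> = c(7)[unfolded spaces]
  have m\<pi>: "fst \<in> borel_measurable \<pi>" "snd \<in> borel_measurable \<pi>"
    using coord_measurable(1,2) by (auto simp: measurable_cong_sets[OF c(2) refl])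
  note cm\<pi> = cell2_measurable[OF m\<pi>, of N] and cm\<rho> = cell2_measurable[OF coord_measurable(1,2), of N]
  define SX where "SX = cell N ` X"
  define SZ where "SZ = cell N ` Z"
  have fin: "finite SX" "finite SZ" "finite (SX \<times> SZ)" using finite_cells_XZ by (auto simp: SX_def SZ_def)
  define a where "a i = measure \<sigma>X {x\<in>space \<sigma>X. cell N x = i}" for i
  define b where "b j = measure \<sigma>Z {z\<in>space \<sigma>Z. cell N z = j}" for j
  define p where "p s = measure \<pi> {w\<in>space \<pi>. cell2 N w = s}" for s
  have setsX: "{x\<in>space \<sigma>X. cell N x = i} \<in> sets \<sigma>X" for i
    using measurable_sets[OF cell_measurable_\<sigma>(1), of "{i}"] by (simp add: vimage_def Int_def conj_commute)
  have setsZ: "{z\<in>space \<sigma>Z. cell N z = i} \<in> sets \<sigma>Z" for i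
    using measurable_sets[OF cell_measurable_\<sigma>(2), of "{i}"] by (simp add: vimage_def Int_def conj_commute)
  have intX: "(\<integral>x. \<Psi> (cell N x) \<partial>\<sigma>X) = (\<Sum>i\<in>SX. \<Psi> i * a i)" for \<Psi> :: "int \<Rightarrow> real"
    unfolding a_def by (rule integral_finite_range[OF prob(1) cell_measurable_\<sigma>(1) fin(1)]) (auto simp: SX_def spaces)
  have intZ: "(\<integral>z. \<Psi> (cell N z) \<partial>\<sigma>Z) = (\<Sum>j\<in>SZ. \<Psi> j * b j)" for \<Psi> :: "int \<Rightarrow> real"
    unfolding b_def by (rule integral_finite_range[OF prob(2) cell_measurable_\<sigma>(2) fin(2)]) (auto simp: SZ_def spaces)
  have int\<pi>: "(\<integral>w. \<Psi> (cell2 N w) \<partial>\<pi>) = (\<Sum>s\<in>SX \<times> SZ. \<Psi> s * p s)" for \<Psi> :: "int \<times> int \<Rightarrow> real"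
    unfolding p_def by (rule integral_finite_range[OF c(1) cm\<pi> fin(3)]) (auto simp: SX_def SZ_def sp\<pi> cell2_def)
  have int\<rho>: "(\<integral>w. \<Psi> (cell2 N w) \<partial>\<rho>) = (\<Sum>s\<in>SX \<times> SZ. \<Psi> s * (a (fst s) * b (snd s)))" for \<Psi> :: "int \<times> int \<Rightarrow> real"
  proof -
    have "(\<integral>w. \<Psi> (cell2 N w) \<partial>\<rho>) = (\<Sum>s\<in>SX \<times> SZ. \<Psi> s * measure \<rho> {w\<in>space \<rho>. cell2 N w = s})"
      by (rule integral_finite_range[OF P.prob_space_axioms cm\<rho> fin(3)]) (auto simp: SX_def SZ_def spaces cell2_def)
    moreover have "measure \<rho> {w\<in>space \<rho>. cell2 N w = s} = a (fst s) * b (snd s)" for s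
    proof -
      have "{w\<in>space \<rho>. cell2 N w = s} = {x\<in>space \<sigma>X. cell N x = fst s} \<times> {z\<in>space \<sigma>Z. cell N z = snd s}"
        by (auto simp: cell2_def space_pair_measure)
      then show ?thesis
        unfolding a_def b_def measure_def
        by (simp add: Z.emeasure_pair_measure_Times[OF setsX setsZ] enn2real_mult)
    qed
    ultimately show ?thesis by simp
  qed
  have nonneg: "0 \<le> a i" "0 \<le> b j" "0 \<le> p s" for i j s by (auto simp: a_def b_def p_def)
  have cart: "(\<Sum>s\<in>SX \<times> SZ. g s) = (\<Sum>i\<in>SX. \<Sum>j\<in>SZ. g (i, j))" for g :: "int \<times> int \<Rightarrow> real"
    by (simp add: sum.cartesian_product split_beta')
  have rowsum: "(\<Sum>j\<in>SZ. p (i, j)) = a i" if i: "i \<in> SX" for i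
  proof -
    let ?\<Psi> = "\<lambda>s. of_bool (fst s = i) :: real"
    have "(\<Sum>j\<in>SZ. p (i, j)) = (\<Sum>i'\<in>SX. if i' = i then \<Sum>j\<in>SZ. p (i', j) else 0)" using fin i by simp
    also have "\<dots> = (\<Sum>s\<in>SX \<times> SZ. ?\<Psi> s * p s)"
      unfolding cart by (intro sum.cong refl) simp
    also have "\<dots> = (\<integral>w. ?\<Psi> (cell2 N w) \<partial>\<pi>)" by (rule int\<pi>[symmetric])
    also have "\<dots> = (\<integral>w. of_bool (cell N (fst w) = i) \<partial>\<pi>)" by (simp add: cell2_def)
    also have "\<dots> = (\<integral>x. of_bool (cell N x = i) \<partial>distr \<pi> \<sigma>X fst)"
      by (rule integral_distr[symmetric, OF c(5)])
         (rule measurable_compose[OF cell_measurable_\<sigma>(1), where g="\<lambda>k. of_bool (k = i)"], simp)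
    also have "\<dots> = (\<Sum>i'\<in>SX. of_bool (i' = i) * a i')" unfolding c(3) by (rule intX)
    also have "\<dots> = (\<Sum>i'\<in>SX. if i' = i then a i' else 0)" by (intro sum.cong) auto
    also have "\<dots> = a i" using i fin by simp
    finally show ?thesis .
  qed
  have colsum: "(\<Sum>i\<in>SX. p (i, j)) = b j" if j: "j \<in> SZ" for j
  proof -
    let ?\<Psi> = "\<lambda>s. of_bool (snd s = j) :: real"
    have "(\<Sum>i\<in>SX. p (i, j)) = (\<Sum>i\<in>SX. \<Sum>j'\<in>SZ. if j' = j then p (i, j') else 0)" using fin j by simp
    also have "\<dots> = (\<Sum>s\<in>SX \<times> SZ. ?\<Psi> s * p s)"
      unfolding cart by (intro sum.cong refl) simp
    also have "\<dots> = (\<integral>w. ?\<Psi> (cell2 N w) \<partial>\<pi>)" by (rule int\<pi>[symmetric])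
    also have "\<dots> = (\<integral>w. of_bool (cell N (snd w) = j) \<partial>\<pi>)" by (simp add: cell2_def)
    also have "\<dots> = (\<integral>z. of_bool (cell N z = j) \<partial>distr \<pi> \<sigma>Z snd)"
      by (rule integral_distr[symmetric, OF c(6)])
         (rule measurable_compose[OF cell_measurable_\<sigma>(2), where g="\<lambda>k. of_bool (k = j)"], simp)
    also have "\<dots> = (\<Sum>j'\<in>SZ. of_bool (j' = j) * b j')" unfolding c(4) by (rule intZ)
    also have "\<dots> = (\<Sum>j'\<in>SZ. if j' = j then b j' else 0)" by (intro sum.cong) auto
    also have "\<dots> = b j" using j fin by simp
    finally show ?thesis .
  qed
  \<comment> \<open>A rectangle with a null side carries no mass of \<open>\<pi>\<close>. Hence
    \<open>dab\<close> also holds where \<open>d\<close> has a conventional value.\<close>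
  have p_le: "p (i, j) \<le> a i" "p (i, j) \<le> b j" if "i \<in> SX" "j \<in> SZ" for i j
    using member_le_sum[of j SZ "\<lambda>j. p (i, j)"] member_le_sum[of i SX "\<lambda>i. p (i, j)"]
      rowsum[OF that(1)] colsum[OF that(2)] that fin nonneg by auto
  \<comment> \<open>The value 1 on null cells makes the row and column masses equal to 1 everywhere, not just almost everywhere.\<close>
  define d where "d s = (if a (fst s) * b (snd s) = 0 then 1 else p s / (a (fst s) * b (snd s)))" for s
  have d_nonneg: "0 \<le> d s" for s using nonneg by (simp add: d_def)
  have dab: "d (i, j) * (a i * b j) = p (i, j)" if "i \<in> SX" "j \<in> SZ" for i j
    using p_le[OF that] nonneg(3)[of "(i, j)"] by (auto simp: d_def)
  have db: "d (i, j) * b j = p (i, j) / a i" if "i \<in> SX" "j \<in> SZ" "a i \<noteq> 0" for i j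
    using dab[OF that(1,2)] that(3) by (simp add: field_simps)
  have da: "d (i, j) * a i = p (i, j) / b j" if "i \<in> SX" "j \<in> SZ" "b j \<noteq> 0" for i j
    using dab[OF that(1,2)] that(3) by (simp add: field_simps)
  have row: "(\<integral>z. d (cell N x, cell N z) \<partial>\<sigma>Z) = 1" if x: "x \<in> X" for x
  proof (cases "a (cell N x) = 0")
    case True
    then show ?thesis by (simp add: d_def Z.prob_space)
  next
    case False
    have i: "cell N x \<in> SX" using x by (simp add: SX_def)
    have "(\<integral>z. d (cell N x, cell N z) \<partial>\<sigma>Z) = (\<Sum>j\<in>SZ. d (cell N x, j) * b j)" by (rule intZ)
    also have "\<dots> = (\<Sum>j\<in>SZ. p (cell N x, j) / a (cell N x))" using db[OF i _ False] by (intro sum.cong) auto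
    also have "\<dots> = 1" using rowsum[OF i] False by (simp flip: sum_divide_distrib)
    finally show ?thesis .
  qed
  have col: "(\<integral>x. d (cell N x, cell N z) \<partial>\<sigma>X) = 1" if z: "z \<in> Z" for z
  proof (cases "b (cell N z) = 0")
    case True
    then show ?thesis by (simp add: d_def X.prob_space)
  next
    case False
    have j: "cell N z \<in> SZ" using z by (simp add: SZ_def)
    have "(\<integral>x. d (cell N x, cell N z) \<partial>\<sigma>X) = (\<Sum>i\<in>SX. d (i, cell N z) * a i)" by (rule intX)
    also have "\<dots> = (\<Sum>i\<in>SX. p (i, cell N z) / b (cell N z))" using da[OF _ j False] by (intro sum.cong) auto
    also have "\<dots> = 1" using colsum[OF j] False by (simp flip: sum_divide_distrib)
    finally show ?thesis .
  qed
  have rowbary: "\<bar>\<integral>z. d (cell N x, cell N z) * (z - y) \<partial>\<sigma>Z\<bar> \<le> 2 / real N" if x: "x \<in> X" for x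
  proof (cases "a (cell N x) = 0")
    case True
    then show ?thesis using integral_centered by (simp add: d_def)
  next
    case False
    \<comment> \<open>\<open>?\<psi> j\<close> is \<open>z - y\<close> with \<open>z\<close>
      replaced by the left endpoint of cell \<open>j\<close>. It depends on the cell only, so its
      integrals can be moved between the product law and \<open>\<pi>\<close>.\<close>
    let ?i = "cell N x" and ?\<psi> = "\<lambda>j. of_int j / real N - y"
    have i: "?i \<in> SX" using x by (simp add: SX_def)
    have apos: "a ?i > 0" using False nonneg(1)[of ?i] by simp
    have close: "\<bar>z - y - ?\<psi> (cell N z)\<bar> \<le> 1 / real N" for z using cell_approx[OF N, of z] by simp
    have mcell: "(\<lambda>z. g (cell N z)) \<in> borel_measurable \<sigma>Z" for g :: "int \<Rightarrow> real"
      by (rule measurable_compose[OF cell_measurable_\<sigma>(2)]) simp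
    have mcell2: "(\<lambda>w. g (cell2 N w)) \<in> borel_measurable \<pi>" for g :: "int \<times> int \<Rightarrow> real"
      by (rule measurable_compose[OF cm\<pi>]) simp
    have bnd: "integrable \<sigma>Z (\<lambda>z. g (cell N z))" for g :: "int \<Rightarrow> real"
    proof (rule integrable_bounded_Z[OF mcell, where C="Max (insert 0 ((\<lambda>j. \<bar>g j\<bar>) ` SZ))"])
      show "\<bar>g (cell N z)\<bar> \<le> Max (insert 0 ((\<lambda>j. \<bar>g j\<bar>) ` SZ))" if "z \<in> Z" for z
        using fin that by (intro Max_ge) (auto simp: SZ_def)
    qed
    have int_d: "integrable \<sigma>Z (\<lambda>z. d (?i, cell N z))" by (rule bnd)
    have int1: "integrable \<sigma>Z (\<lambda>z. d (?i, cell N z) * ?\<psi> (cell N z))" by (rule bnd)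
    have int2: "integrable \<sigma>Z (\<lambda>z. d (?i, cell N z) * (z - y - ?\<psi> (cell N z)))"
    proof (rule Bochner_Integration.integrable_bound[OF integrable_mult_left[OF int_d, of "1 / real N"]])
      show "(\<lambda>z. d (?i, cell N z) * (z - y - ?\<psi> (cell N z))) \<in> borel_measurable \<sigma>Z"
        by (intro borel_measurable_times borel_measurable_diff mcell shift_measurable)
      show "AE z in \<sigma>Z. norm (d (?i, cell N z) * (z - y - ?\<psi> (cell N z))) \<le> norm (d (?i, cell N z) * (1 / real N))"
        unfolding real_norm_def abs_mult using close d_nonneg by (intro AE_I2 mult_left_mono order_trans[OF close abs_ge_self]) auto
    qed
    have "(\<integral>z. d (?i, cell N z) * (z - y) \<partial>\<sigma>Z) =
      (\<integral>z. d (?i, cell N z) * ?\<psi> (cell N z) + d (?i, cell N z) * (z - y - ?\<psi> (cell N z)) \<partial>\<sigma>Z)"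
      by (simp add: algebra_simps)
    also have "\<dots> = (\<integral>z. d (?i, cell N z) * ?\<psi> (cell N z) \<partial>\<sigma>Z) + (\<integral>z. d (?i, cell N z) * (z - y - ?\<psi> (cell N z)) \<partial>\<sigma>Z)"
      by (rule Bochner_Integration.integral_add[OF int1 int2])
    finally have split: "(\<integral>z. d (?i, cell N z) * (z - y) \<partial>\<sigma>Z) = \<dots>" .
    have e2: "\<bar>\<integral>z. d (?i, cell N z) * (z - y - ?\<psi> (cell N z)) \<partial>\<sigma>Z\<bar> \<le> 1 / real N"
    proof -
      have "\<bar>\<integral>z. d (?i, cell N z) * (z - y - ?\<psi> (cell N z)) \<partial>\<sigma>Z\<bar> \<le> (\<integral>z. \<bar>d (?i, cell N z) * (z - y - ?\<psi> (cell N z))\<bar> \<partial>\<sigma>Z)"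
        by (rule integral_abs_bound)
      also have "\<dots> \<le> (\<integral>z. d (?i, cell N z) * (1 / real N) \<partial>\<sigma>Z)"
      proof (rule integral_mono)
        show "integrable \<sigma>Z (\<lambda>z. \<bar>d (?i, cell N z) * (z - y - ?\<psi> (cell N z))\<bar>)" using int2 by (rule integrable_abs)
        show "integrable \<sigma>Z (\<lambda>z. d (?i, cell N z) * (1 / real N))" using int_d by (rule integrable_mult_left)
        show "\<bar>d (?i, cell N z) * (z - y - ?\<psi> (cell N z))\<bar> \<le> d (?i, cell N z) * (1 / real N)" for z
          unfolding abs_mult using mult_mono[OF order_refl close[of z] d_nonneg[of "(?i, cell N z)"]] d_nonneg[of "(?i, cell N z)"] by simp
      qed
      also have "\<dots> = (\<integral>z. d (?i, cell N z) \<partial>\<sigma>Z) * (1 / real N)" by (rule integral_mult_left_zero)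
      also have "\<dots> = 1 / real N" using row[OF x] by simp
      finally show ?thesis .
    qed
    let ?I = "\<lambda>w. of_bool (cell N (fst w) = ?i) :: real"
    have "(\<integral>z. d (?i, cell N z) * ?\<psi> (cell N z) \<partial>\<sigma>Z) = (\<Sum>j\<in>SZ. d (?i, j) * ?\<psi> j * b j)" by (rule intZ)
    also have "\<dots> = (\<Sum>j\<in>SZ. ?\<psi> j * p (?i, j)) / a ?i"
      unfolding sum_divide_distrib
    proof (intro sum.cong refl)
      fix j assume j: "j \<in> SZ"
      have "d (?i, j) * ?\<psi> j * b j = ?\<psi> j * (d (?i, j) * b j)" by (simp only: ac_simps)
      then show "d (?i, j) * ?\<psi> j * b j = ?\<psi> j * p (?i, j) / a ?i" unfolding db[OF i j False] by simp
    qed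
    also have "(\<Sum>j\<in>SZ. ?\<psi> j * p (?i, j)) = (\<integral>w. ?I w * ?\<psi> (cell N (snd w)) \<partial>\<pi>)"
    proof -
      have "(\<Sum>j\<in>SZ. ?\<psi> j * p (?i, j)) = (\<Sum>i'\<in>SX. if i' = ?i then \<Sum>j\<in>SZ. ?\<psi> j * p (i', j) else 0)" using fin i by simp
      also have "\<dots> = (\<Sum>s\<in>SX \<times> SZ. of_bool (fst s = ?i) * ?\<psi> (snd s) * p s)"
        unfolding cart by (intro sum.cong refl) simp
      also have "\<dots> = (\<integral>w. of_bool (fst (cell2 N w) = ?i) * ?\<psi> (snd (cell2 N w)) \<partial>\<pi>)"
        by (rule int\<pi>[symmetric])
      finally show ?thesis by (simp add: cell2_def)
    qed
    finally have first: "(\<integral>z. d (?i, cell N z) * ?\<psi> (cell N z) \<partial>\<sigma>Z) = (\<integral>w. ?I w * ?\<psi> (cell N (snd w)) \<partial>\<pi>) / a ?i" .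
    have mI: "?I \<in> borel_measurable \<pi>"
      using mcell2[of "\<lambda>s. of_bool (fst s = ?i)"] by (simp add: cell2_def)
    have m\<psi>: "(\<lambda>w. ?\<psi> (cell N (snd w))) \<in> borel_measurable \<pi>"
      using mcell2[of "\<lambda>s. ?\<psi> (snd s)"] by (simp add: cell2_def)
    have iI: "integrable \<pi> ?I"
      by (rule prob_space_integrable_bounded[OF c(1) mI, where C=1]) auto
    have iz: "integrable \<pi> (\<lambda>w. ?I w * (snd w - y))"
    proof (rule prob_space_integrable_bounded[OF c(1), where C="2 * R"])
      show "(\<lambda>w. ?I w * (snd w - y)) \<in> borel_measurable \<pi>"
        by (rule borel_measurable_times[OF mI borel_measurable_diff[OF m\<pi>(2) borel_measurable_const]])
      show "\<bar>?I w * (snd w - y)\<bar> \<le> 2 * R" if w: "w \<in> space \<pi>" for w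
      proof -
        have "\<bar>snd w - y\<bar> \<le> 2 * R" using dist_y[of "snd w"] w unfolding sp\<pi> by auto
        then show ?thesis using R_nonneg by (simp add: of_bool_def)
      qed
    qed
    have idiff: "integrable \<pi> (\<lambda>w. ?I w * (?\<psi> (cell N (snd w)) - (snd w - y)))"
    proof (rule prob_space_integrable_bounded[OF c(1), where C="1 / real N"])
      show "(\<lambda>w. ?I w * (?\<psi> (cell N (snd w)) - (snd w - y))) \<in> borel_measurable \<pi>"
        by (rule borel_measurable_times[OF mI borel_measurable_diff[OF m\<psi> borel_measurable_diff[OF m\<pi>(2) borel_measurable_const]]])
      show "\<bar>?I w * (?\<psi> (cell N (snd w)) - (snd w - y))\<bar> \<le> 1 / real N" for w
        using close[of "snd w"] N unfolding abs_minus_commute[of "snd w - y"] by (simp add: of_bool_def)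
    qed
    \<comment> \<open>The points of \<open>X\<close> in the cell of \<open>x\<close> form an
      admissible test set, so the barycentre condition of \<open>\<pi>\<close> applies to them
      without error.\<close>
    have zero: "(\<integral>w. ?I w * (snd w - y) \<partial>\<pi>) = 0"
    proof -
      have "(\<integral>w. ?I w * (snd w - y) \<partial>\<pi>) = (\<integral>v. indicator {x\<in>space \<sigma>X. cell N x = ?i} (fst v) * (snd v - y) \<partial>\<pi>)"
        using sp\<pi> by (intro Bochner_Integration.integral_cong refl) (auto simp: spaces indicator_def)
      then show ?thesis using bary[OF setsX] by simp
    qed
    have "(\<integral>w. ?I w * ?\<psi> (cell N (snd w)) \<partial>\<pi>) =
      (\<integral>w. ?I w * (?\<psi> (cell N (snd w)) - (snd w - y)) + ?I w * (snd w - y) \<partial>\<pi>)"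
      by (simp add: algebra_simps)
    also have "\<dots> = (\<integral>w. ?I w * (?\<psi> (cell N (snd w)) - (snd w - y)) \<partial>\<pi>)"
      using Bochner_Integration.integral_add[OF idiff iz] zero by simp
    also have "\<bar>\<dots>\<bar> \<le> (\<integral>w. \<bar>?I w * (?\<psi> (cell N (snd w)) - (snd w - y))\<bar> \<partial>\<pi>)"
      by (rule integral_abs_bound)
    also have "\<dots> \<le> (\<integral>w. ?I w * (1 / real N) \<partial>\<pi>)"
    proof (rule integral_mono)
      show "\<bar>?I w * (?\<psi> (cell N (snd w)) - (snd w - y))\<bar> \<le> ?I w * (1 / real N)" for w
        using close[of "snd w"] unfolding abs_minus_commute[of "snd w - y"] by (simp add: of_bool_def)
    qed (use idiff iI in auto)
    also have "\<dots> = (\<integral>w. ?I w \<partial>\<pi>) * (1 / real N)" by (rule integral_mult_left_zero)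
    also have "(\<integral>w. ?I w \<partial>\<pi>) = a ?i"
    proof -
      have "(\<integral>w. ?I w \<partial>\<pi>) = (\<integral>x. of_bool (cell N x = ?i) \<partial>distr \<pi> \<sigma>X fst)"
        by (rule integral_distr[symmetric, OF c(5)])
           (rule measurable_compose[OF cell_measurable_\<sigma>(1), where g="\<lambda>k. of_bool (k = ?i)"], simp)
      also have "\<dots> = (\<Sum>i'\<in>SX. of_bool (i' = ?i) * a i')" unfolding c(3) by (rule intX)
      also have "\<dots> = (\<Sum>i'\<in>SX. if i' = ?i then a i' else 0)" by (intro sum.cong) auto
      also have "\<dots> = a ?i" using i fin by simp
      finally show ?thesis .
    qed
    finally have "\<bar>\<integral>w. ?I w * ?\<psi> (cell N (snd w)) \<partial>\<pi>\<bar> / a ?i \<le> a ?i * (1 / real N) / a ?i"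
      using apos by (intro divide_right_mono) auto
    then have "\<bar>\<integral>z. d (?i, cell N z) * ?\<psi> (cell N z) \<partial>\<sigma>Z\<bar> \<le> 1 / real N"
      unfolding first using apos by (simp add: abs_divide)
    then have "\<bar>\<integral>z. d (?i, cell N z) * (z - y) \<partial>\<sigma>Z\<bar> \<le> 1 / real N + 1 / real N"
      unfolding split using e2 by linarith
    then show ?thesis by simp
  qed
  have cost: "(\<integral>w. \<Psi> (cell2 N w) * d (cell2 N w) \<partial>\<rho>) = (\<integral>w. \<Psi> (cell2 N w) \<partial>\<pi>)" for \<Psi> :: "int \<times> int \<Rightarrow> real"
  proof -
    have "(\<integral>w. \<Psi> (cell2 N w) * d (cell2 N w) \<partial>\<rho>) = (\<Sum>s\<in>SX \<times> SZ. \<Psi> s * d s * (a (fst s) * b (snd s)))"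
      by (rule int\<rho>)
    also have "\<dots> = (\<Sum>s\<in>SX \<times> SZ. \<Psi> s * p s)"
      using dab by (intro sum.cong refl) (auto simp: mult.assoc)
    finally show ?thesis using int\<pi> by simp
  qed
  show ?thesis by (intro exI[of _ d] conjI allI ballI d_nonneg row col rowbary cost)
qed

end

text \<open>Lists of integer cells with rational values form a countable type, so the null sets
  belonging to the individual candidates can be united. Cells not listed get the value 0; a bounded
  set meets only finitely many cells.\<close>

definition step :: "nat \<Rightarrow> ((int \<times> int) \<times> rat) list \<Rightarrow> real \<times> real \<Rightarrow> real" where
  "step N L w = (case map_of L (cell2 N w) of None \<Rightarrow> 0 | Some a \<Rightarrow> real_of_rat a)"

lemma step_measurable:
  assumes "fst \<in> borel_measurable M" "snd \<in> borel_measurable M"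
  shows "step N L \<in> borel_measurable M"
  unfolding step_def[abs_def] by (rule measurable_compose[OF cell2_measurable[OF assms]]) simp

lemma step_bounded: "\<exists>C. \<forall>w. \<bar>step N L w\<bar> \<le> C"
proof -
  let ?A = "insert 0 ((\<lambda>a. \<bar>real_of_rat a\<bar>) ` snd ` set L)"
  have "\<bar>step N L w\<bar> \<le> Max ?A" for w
    by (rule Max_ge) (auto simp: step_def split: option.split dest!: map_of_SomeD intro: rev_image_eqI)
  then show ?thesis by blast
qed

context fibre
begin

text \<open>The chain is \<open>\<pi>\<close>, its grid density, a rational step function close to
  it, the repaired function, the mixture. The grid density nearly satisfies the constraints, so the
  repair moves it uniformly by at most \<open>\<eta>\<close>; adding \<open>\<eta>\<close> then
  restores nonnegativity, and the cost changes by a multiple of \<open>\<eta>\<close>.\<close>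

lemma weight_approx:
  fixes c :: "real \<times> real \<Rightarrow> real"
  assumes \<pi>: "\<pi> \<in> couplings \<sigma>X \<sigma>Z"
    and bary: "\<And>A. A \<in> sets \<sigma>X \<Longrightarrow> (\<integral>v. indicator A (fst v) * (snd v - y) \<partial>\<pi>) = 0"
    and c: "continuous_on (X \<times> Z) c" and e: "e > 0"
  obtains N L k where "\<And>w. w \<in> X \<times> Z \<Longrightarrow> 0 \<le> weight \<sigma>X \<sigma>Z y (step N L) (1 / real (Suc k)) w"
    "(\<integral>w. weight \<sigma>X \<sigma>Z y (step N L) (1 / real (Suc k)) w * c w \<partial>\<rho>) < (\<integral>w. c w \<partial>\<pi>) + e"
proof -
  note cc = couplings_cong_sets[OF \<pi> refl refl]
  interpret \<pi>: prob_space \<pi> by (rule cc(1))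
  note sp\<pi> = cc(7)[unfolded spaces]
  have cpt: "compact (X \<times> Z)" using compact by (rule compact_Times)
  obtain Cc where Cc: "\<And>w. w \<in> X \<times> Z \<Longrightarrow> \<bar>c w\<bar> \<le> Cc" "Cc \<ge> 0"
    using compact_continuous_abs_bounded[OF cpt c] by blast
  have cm: "c \<in> borel_measurable \<rho>"
    using borel_measurable_continuous_on_Times[OF c] sets_pair_measure_cong[OF sets_\<sigma>] by (simp cong: measurable_cong_sets)
  have cm\<pi>: "c \<in> borel_measurable \<pi>" using cm by (simp add: measurable_cong_sets[OF cc(2) refl])
  have ic\<pi>: "integrable \<pi> c" by (rule prob_space_integrable_bounded[OF cc(1) cm\<pi>, where C=Cc]) (use Cc sp\<pi> in auto)
  \<comment> \<open>The repaired function differs from the grid density by at most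
    \<open>K * \<tau>\<close>: the errors of \<open>q\<close>, row mass, column mass and total mass
    contribute 4, the barycentre correction the rest. If \<open>var_y\<close> is 0 the quotient is 0
    and \<open>K\<close> is 4, matching \<open>repair\<close>. \<open>K\<close> may depend on the
    fibre, since the grid is chosen after it.\<close>
  define K where "K = 4 + 2 * (2 + 2 * R) * (2 * R) / \<bar>var_y\<bar>"
  have K: "K \<ge> 4" unfolding K_def using R_nonneg by simp
  \<comment> \<open>The total cost error is at most \<open>(2 + 3 * Cc) * \<eta>\<close>: two errors
    \<open>\<tau> \<le> \<eta>\<close> from making \<open>c\<close> constant on cells, and
    \<open>3 * Cc * \<eta>\<close> from passing from the grid density to the weight.\<close>
  obtain k :: nat where k: "(2 + 3 * Cc) / e < real k" using reals_Archimedean2 by blast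
  define \<eta> where "\<eta> = 1 / real (Suc k)"
  have \<eta>: "\<eta> > 0" by (simp add: \<eta>_def)
  have \<eta>e: "(2 + 3 * Cc) * \<eta> < e"
  proof -
    have "2 + 3 * Cc < e * real k" using k e by (simp add: field_simps)
    also have "\<dots> < e * real (Suc k)" using e by simp
    finally show ?thesis unfolding \<eta>_def by (simp add: field_simps)
  qed
  define \<tau> where "\<tau> = \<eta> / (K + 1)"
  have \<tau>: "\<tau> > 0" "\<tau> \<le> \<eta>" "K * \<tau> \<le> \<eta>"
    using \<eta> K by (auto simp: \<tau>_def field_simps)
  have "uniformly_continuous_on (X \<times> Z) c" by (rule compact_uniformly_continuous[OF c cpt])
  then obtain \<delta> where \<delta>: "\<delta> > 0" "\<And>w w'. w \<in> X \<times> Z \<Longrightarrow> w' \<in> X \<times> Z \<Longrightarrow> dist w' w < \<delta> \<Longrightarrow> dist (c w') (c w) < \<tau>"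
    unfolding uniformly_continuous_on_def using \<tau>(1) by meson
  \<comment> \<open>\<open>1 / N \<le> \<tau>\<close> controls the barycentre of the grid density.
    \<open>4 / N < \<delta>\<close> controls \<open>c\<close>: through the common left endpoints,
    two points of one cell differ by at most \<open>2 / N\<close> in each coordinate.\<close>
  obtain N :: nat where N0: "max (1 / \<tau>) (4 / \<delta>) < real N" using reals_Archimedean2 by blast
  have N: "N > 0"
  proof -
    have "0 < 1 / \<tau>" using \<tau>(1) by simp
    also have "1 / \<tau> < real N" using N0 by simp
    finally show ?thesis by simp
  qed
  have N\<tau>: "1 / real N \<le> \<tau>" and N\<delta>: "4 / real N < \<delta>"
  proof -
    have "1 / \<tau> < real N" "4 / \<delta> < real N" using N0 by simp_all
    then have "1 < real N * \<tau>" "4 < real N * \<delta>" using \<tau>(1) \<delta>(1) by (simp_all only: pos_divide_less_eq)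
    then show "1 / real N \<le> \<tau>" "4 / real N < \<delta>"
      using N by (simp_all add: pos_divide_le_eq pos_divide_less_eq mult.commute)
  qed
  have "\<exists>d :: int \<times> int \<Rightarrow> real. (\<forall>s. 0 \<le> d s) \<and>
    (\<forall>x\<in>X. (\<integral>z. d (cell N x, cell N z) \<partial>\<sigma>Z) = 1) \<and>
    (\<forall>z\<in>Z. (\<integral>x. d (cell N x, cell N z) \<partial>\<sigma>X) = 1) \<and>
    (\<forall>x\<in>X. \<bar>\<integral>z. d (cell N x, cell N z) * (z - y) \<partial>\<sigma>Z\<bar> \<le> 2 / real N) \<and>
    (\<forall>\<Psi> :: int \<times> int \<Rightarrow> real. (\<integral>w. \<Psi> (cell2 N w) * d (cell2 N w) \<partial>\<rho>) = (\<integral>w. \<Psi> (cell2 N w) \<partial>\<pi>))"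
    by (rule grid_density[OF \<pi> N bary])
  then obtain d where d: "\<And>s. 0 \<le> d s"
    and row: "\<And>x. x \<in> X \<Longrightarrow> (\<integral>z. d (cell N x, cell N z) \<partial>\<sigma>Z) = 1"
    and col: "\<And>z. z \<in> Z \<Longrightarrow> (\<integral>x. d (cell N x, cell N z) \<partial>\<sigma>X) = 1"
    and rowb: "\<And>x. x \<in> X \<Longrightarrow> \<bar>\<integral>z. d (cell N x, cell N z) * (z - y) \<partial>\<sigma>Z\<bar> \<le> 2 / real N"
    and cost: "\<And>\<Psi> :: int \<times> int \<Rightarrow> real. (\<integral>w. \<Psi> (cell2 N w) * d (cell2 N w) \<partial>\<rho>) = (\<integral>w. \<Psi> (cell2 N w) \<partial>\<pi>)"
    by blast
  define S where "S = cell N ` X \<times> cell N ` Z"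
  have S: "finite S" "\<And>w. w \<in> X \<times> Z \<Longrightarrow> cell2 N w \<in> S"
    using finite_cells_XZ by (auto simp: S_def cell2_def)
  obtain xs where xs: "set xs = S" using finite_list[OF S(1)] by blast
  have "\<exists>g. \<bar>real_of_rat g - d s\<bar> \<le> \<tau>" for s
  proof -
    obtain g where g: "g \<in> \<rat>" "d s < g" "g < d s + \<tau>" using Rats_dense_in_real[of "d s" "d s + \<tau>"] \<tau>(1) by auto
    then obtain g' where "g = real_of_rat g'" by (auto elim: Rats_cases)
    then show ?thesis using g by (intro exI[of _ g']) auto
  qed
  then obtain g where g: "\<And>s. \<bar>real_of_rat (g s) - d s\<bar> \<le> \<tau>" by metis
  define L where "L = map (\<lambda>s. (s, g s)) xs"
  define q where "q = step N L"
  define D where "D w = d (cell2 N w)" for w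
  have qD: "\<bar>q w - D w\<bar> \<le> \<tau>" if "w \<in> X \<times> Z" for w
  proof -
    have "map_of L (cell2 N w) = Some (g (cell2 N w))"
      using S(2)[OF that] xs by (simp add: L_def map_of_map_restrict)
    then show ?thesis using g by (simp add: q_def D_def step_def)
  qed
  define CD where "CD = Max (insert 0 (d ` S))"
  have CD: "\<bar>D w\<bar> \<le> CD" if "w \<in> X \<times> Z" for w
    unfolding D_def CD_def using S that d by (intro Max_ge) (auto intro: abs_of_nonneg)
  have Dm: "D \<in> borel_measurable \<rho>"
    unfolding D_def[abs_def] by (rule measurable_compose[OF cell2_measurable[OF coord_measurable(1,2)]]) simp
  have qm: "q \<in> borel_measurable \<rho>" unfolding q_def by (rule step_measurable[OF coord_measurable(1,2)])
  have Cq: "\<bar>q w\<bar> \<le> CD + \<tau>" if "w \<in> X \<times> Z" for w using qD[OF that] CD[OF that] by linarith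
  have Cqb: "\<forall>w\<in>X \<times> Z. \<bar>q w\<bar> \<le> CD + \<tau>" and CDb: "\<forall>w\<in>X \<times> Z. \<bar>D w\<bar> \<le> CD" using Cq CD by auto
  have Dx: "D (x, z) = d (cell N x, cell N z)" for x z by (simp add: D_def cell2_def)
  have i\<rho>: "integrable \<rho> D" by (rule integrable_bounded_\<rho>[OF Dm CD])
  have massD: "(\<integral>w. D w \<partial>\<rho>) = 1"
    using cost[of "\<lambda>_. 1"] by (simp add: D_def \<pi>.prob_space)
  note secq = repair_section[OF qm Cqb] and secD = repair_section[OF Dm CDb]
  have iZ: "integrable \<sigma>Z (\<lambda>z. q (x, z))" "integrable \<sigma>Z (\<lambda>z. D (x, z))"
    "integrable \<sigma>Z (\<lambda>z. q (x, z) * (z - y))" "integrable \<sigma>Z (\<lambda>z. D (x, z) * (z - y))" if x: "x \<in> X" for x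
  proof -
    have w: "(x, z) \<in> X \<times> Z" if "z \<in> Z" for z using x that by simp
    show "integrable \<sigma>Z (\<lambda>z. q (x, z))" by (rule integrable_bounded_Z[OF secq(1)[OF x] Cq[OF w]])
    show "integrable \<sigma>Z (\<lambda>z. D (x, z))" by (rule integrable_bounded_Z[OF secD(1)[OF x] CD[OF w]])
    show "integrable \<sigma>Z (\<lambda>z. q (x, z) * (z - y))"
      by (rule integrable_bounded_Z[OF borel_measurable_times[OF secq(1)[OF x] shift_measurable]])
         (use q_centered_le[OF qm Cqb w] in auto)
    show "integrable \<sigma>Z (\<lambda>z. D (x, z) * (z - y))"
      by (rule integrable_bounded_Z[OF borel_measurable_times[OF secD(1)[OF x] shift_measurable]])
         (use q_centered_le[OF Dm CDb w] in auto)
  qed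
  have r: "\<bar>row_mass q x - 1\<bar> \<le> \<tau>" if x: "x \<in> X" for x
  proof -
    have "row_mass q x - 1 = (\<integral>z. q (x, z) - D (x, z) \<partial>\<sigma>Z)"
      using row[OF x] iZ(1,2)[OF x] by (simp add: row_mass_def[OF qm Cqb] Dx)
    also have "\<bar>\<dots>\<bar> \<le> \<tau>"
      by (rule integral_abs_le_Z[OF borel_measurable_diff[OF secq(1)[OF x] secD(1)[OF x]]]) (use qD x in auto)
    finally show ?thesis .
  qed
  have s: "\<bar>col_mass q z - 1\<bar> \<le> \<tau>" if z: "z \<in> Z" for z
  proof -
    have w: "(x, z) \<in> X \<times> Z" if "x \<in> X" for x using z that by simp
    note integrable_bounded_X[OF secq(2)[OF z] Cq[OF w]] integrable_bounded_X[OF secD(2)[OF z] CD[OF w]]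
    then have "col_mass q z - 1 = (\<integral>x. q (x, z) - D (x, z) \<partial>\<sigma>X)"
      using col[OF z] by (simp add: col_mass_def[OF qm Cqb] Dx)
    also have "\<bar>\<dots>\<bar> \<le> \<tau>"
      by (rule integral_abs_le_X[OF borel_measurable_diff[OF secq(2)[OF z] secD(2)[OF z]]]) (use qD z in auto)
    finally show ?thesis .
  qed
  note meas = repair_meas[OF qm Cqb]
  have m: "\<bar>mass q - 1\<bar> \<le> \<tau>"
  proof -
    have "integrable \<sigma>X (row_mass q)"
      by (rule integrable_bounded_X[OF meas(1) repair_bounds(1)[OF qm Cqb]])
    then have "mass q - 1 = (\<integral>x. row_mass q x - 1 \<partial>\<sigma>X)" by (simp add: mass_def[OF qm Cqb] X.prob_space)
    also have "\<bar>\<dots>\<bar> \<le> \<tau>"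
      by (rule integral_abs_le_X[OF borel_measurable_diff[OF meas(1) borel_measurable_const] r])
    finally show ?thesis .
  qed
  \<comment> \<open>The summand 2 comes from the barycentre error \<open>2 / N\<close> of the grid
    density, and \<open>2 * R\<close> from the rational rounding, which is multiplied by a factor
    \<open>z - y\<close> of size at most \<open>2 * R\<close>.\<close>
  define \<beta> where "\<beta> = (2 + 2 * R) * \<tau>"
  have b: "\<bar>row_bary q x\<bar> \<le> \<beta>" if x: "x \<in> X" for x
  proof -
    have "row_bary q x = (\<integral>z. D (x, z) * (z - y) \<partial>\<sigma>Z) + (\<integral>z. q (x, z) * (z - y) - D (x, z) * (z - y) \<partial>\<sigma>Z)"
      using iZ[OF x] by (simp add: row_bary_def[OF qm Cqb])
    moreover have "\<bar>\<integral>z. q (x, z) * (z - y) - D (x, z) * (z - y) \<partial>\<sigma>Z\<bar> \<le> \<tau> * (2 * R)"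
    proof (rule integral_abs_le_Z)
      show "(\<lambda>z. q (x, z) * (z - y) - D (x, z) * (z - y)) \<in> borel_measurable \<sigma>Z"
        using iZ(3,4)[OF x] by (intro borel_measurable_diff) auto
      show "\<bar>q (x, z) * (z - y) - D (x, z) * (z - y)\<bar> \<le> \<tau> * (2 * R)" if "z \<in> Z" for z
        unfolding left_diff_distrib[symmetric] abs_mult using qD[of "(x, z)"] dist_y[OF that] x that \<tau>(1)
        by (intro mult_mono) auto
    qed
    moreover have "\<bar>\<integral>z. D (x, z) * (z - y) \<partial>\<sigma>Z\<bar> \<le> 2 * \<tau>"
      using rowb[OF x] N\<tau> by (simp add: Dx)
    ultimately show ?thesis unfolding \<beta>_def by (simp add: algebra_simps abs_le_iff)
  qed
  have B: "\<bar>total_bary q\<bar> \<le> \<beta>"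
    unfolding total_bary_def[OF qm Cqb] by (rule integral_abs_le_X[OF meas(3) b])
  \<comment> \<open>With all masses equal to 1 and no barycentre defect, \<open>repair\<close> would
    return the density unchanged. Only the deviations from these ideal values remain.\<close>
  have pD: "\<bar>repair \<sigma>X \<sigma>Z y q w - D w\<bar> \<le> \<eta>" if w: "w \<in> X \<times> Z" for w
  proof -
    have fs: "fst w \<in> X" "snd w \<in> Z" using w by auto
    have "\<bar>(row_bary q (fst w) - total_bary q) * (snd w - y) / var_y\<bar> \<le> (2 * \<beta>) * (2 * R) / \<bar>var_y\<bar>"
      unfolding abs_divide abs_mult using b[OF fs(1)] B dist_y[OF fs(2)]
      by (intro divide_right_mono mult_mono) auto
    also have "\<dots> = (K - 4) * \<tau>" by (simp add: K_def \<beta>_def)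
    finally have h: "\<bar>(row_bary q (fst w) - total_bary q) * (snd w - y) / var_y\<bar> \<le> (K - 4) * \<tau>" .
    have tri: "\<bar>(a - e' - f + g' + 1 - h) - D'\<bar> \<le> 4 * t + u"
      if "\<bar>a - D'\<bar> \<le> t" "\<bar>e' - 1\<bar> \<le> t" "\<bar>f - 1\<bar> \<le> t" "\<bar>g' - 1\<bar> \<le> t" "\<bar>h\<bar> \<le> u" for a D' e' f g' h t u :: real
      using that by linarith
    have "\<bar>repair \<sigma>X \<sigma>Z y q w - D w\<bar> \<le> 4 * \<tau> + (K - 4) * \<tau>"
      unfolding repair_eq[OF qm Cqb] by (rule tri[OF qD[OF w] r[OF fs(1)] s[OF fs(2)] m h])
    also have "\<dots> = K * \<tau>" by (simp add: algebra_simps)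
    finally show ?thesis using \<tau>(3) by linarith
  qed
  define W where "W = weight \<sigma>X \<sigma>Z y q \<eta>"
  have W0: "0 \<le> W w" if w: "w \<in> X \<times> Z" for w
  proof -
    have "0 \<le> D w" using d by (simp add: D_def)
    then have "0 \<le> repair \<sigma>X \<sigma>Z y q w + \<eta>" using pD[OF w] by linarith
    then show ?thesis using \<eta> by (simp add: W_def weight_def)
  qed
  \<comment> \<open>The term \<open>\<eta> * D w\<close> stems from the normalization by
    \<open>1 + \<eta>\<close>. It is kept as a multiple of \<open>D\<close>, which integrates to 1,
    because the supremum of \<open>D\<close> is not controlled as the grid is refined.\<close>
  have WD: "\<bar>W w - D w\<bar> \<le> 2 * \<eta> + \<eta> * D w" if w: "w \<in> X \<times> Z" for w
  proof -
    have D0: "0 \<le> D w" using d by (simp add: D_def)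
    have "W w - D w = (repair \<sigma>X \<sigma>Z y q w - D w + \<eta> - \<eta> * D w) / (1 + \<eta>)"
      using \<eta> by (simp add: W_def weight_def field_simps)
    also have "\<bar>\<dots>\<bar> = \<bar>repair \<sigma>X \<sigma>Z y q w - D w + \<eta> - \<eta> * D w\<bar> / (1 + \<eta>)" using \<eta> by simp
    also have "\<dots> \<le> \<bar>repair \<sigma>X \<sigma>Z y q w - D w + \<eta> - \<eta> * D w\<bar> / 1" using \<eta> by (intro divide_left_mono) auto
    also have "\<dots> \<le> 2 * \<eta> + \<eta> * D w"
    proof -
      have "0 \<le> \<eta> * D w" using \<eta> D0 by simp
      then show ?thesis using pD[OF w] \<eta> by (simp add: abs_le_iff)
    qed
    finally show ?thesis .
  qed
  have Wm: "W \<in> borel_measurable \<rho>" unfolding W_def by (rule weight_measurable[OF qm Cqb])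
  have "\<exists>CW. \<forall>v\<in>X \<times> Z. \<bar>W v\<bar> \<le> CW" unfolding W_def by (rule weight_bounded[OF qm Cqb])
  then obtain CW where CW: "\<And>v. v \<in> X \<times> Z \<Longrightarrow> \<bar>W v\<bar> \<le> CW" by blast
  \<comment> \<open>Evaluating \<open>c\<close> at one representative per cell gives a function of
    the cell, whose integrals under the grid density and under \<open>\<pi>\<close> agree exactly by
    \<open>cost\<close>.\<close>
  define rep where "rep s = (SOME w. w \<in> X \<times> Z \<and> cell2 N w = s)" for s
  have rep: "\<bar>c w - c (rep (cell2 N w))\<bar> \<le> \<tau>" and repb: "\<bar>c (rep (cell2 N w))\<bar> \<le> Cc" if w: "w \<in> X \<times> Z" for w
  proof -
    have *: "rep (cell2 N w) \<in> X \<times> Z \<and> cell2 N (rep (cell2 N w)) = cell2 N w"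
      unfolding rep_def by (rule someI[of _ w]) (use w in auto)
    show "\<bar>c (rep (cell2 N w))\<bar> \<le> Cc" by (rule Cc(1)[OF conjunct1[OF *]])
    define w' where "w' = rep (cell2 N w)"
    have ceq: "cell N (fst w') = cell N (fst w)" "cell N (snd w') = cell N (snd w)"
      using * by (auto simp: cell2_def w'_def)
    have tri: "\<bar>a - a'\<bar> \<le> 2 * u" if "\<bar>a - t\<bar> \<le> u" "\<bar>a' - t\<bar> \<le> u" for a a' t u :: real
      using that by linarith
    have "\<bar>fst w - fst w'\<bar> \<le> 2 * (1 / real N)" "\<bar>snd w - snd w'\<bar> \<le> 2 * (1 / real N)"
      using tri[OF cell_approx[OF N] cell_approx[OF N, of "fst w'", unfolded ceq]]
        tri[OF cell_approx[OF N] cell_approx[OF N, of "snd w'", unfolded ceq]] by simp_all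
    moreover have "dist w w' \<le> \<bar>fst w - fst w'\<bar> + \<bar>snd w - snd w'\<bar>"
      unfolding dist_prod_def dist_real_def using sqrt_sum_squares_le_sum_abs[of "fst w - fst w'" "snd w - snd w'"] by simp
    ultimately have "dist w w' \<le> 4 / real N" by simp
    also have "\<dots> < \<delta>" using N\<delta> by simp
    finally have "dist (c w) (c w') < \<tau>" using \<delta>(2)[of w' w] * w by (simp add: w'_def)
    then show "\<bar>c w - c (rep (cell2 N w))\<bar> \<le> \<tau>" by (simp add: dist_real_def w'_def)
  qed
  have crm: "(\<lambda>w. c (rep (cell2 N w))) \<in> borel_measurable \<rho>" "(\<lambda>w. c (rep (cell2 N w))) \<in> borel_measurable \<pi>"
  proof -
    show "(\<lambda>w. c (rep (cell2 N w))) \<in> borel_measurable \<rho>"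
      by (rule measurable_compose[OF cell2_measurable[OF coord_measurable(1,2)]]) simp
    then show "(\<lambda>w. c (rep (cell2 N w))) \<in> borel_measurable \<pi>" by (simp add: measurable_cong_sets[OF cc(2) refl])
  qed
  have CD0: "CD \<ge> 0" using S(1) by (auto simp: CD_def)
  have icr\<pi>: "integrable \<pi> (\<lambda>w. c (rep (cell2 N w)))"
    by (rule prob_space_integrable_bounded[OF cc(1) crm(2), where C=Cc]) (use repb sp\<pi> in auto)
  have icD: "integrable \<rho> (\<lambda>w. D w * c w)"
    by (rule integrable_bounded_\<rho>[OF borel_measurable_times[OF Dm cm], where C="CD * Cc"])
       (use CD Cc CD0 in \<open>auto simp: abs_mult intro!: mult_mono\<close>)
  have icrD: "integrable \<rho> (\<lambda>w. c (rep (cell2 N w)) * D w)"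
    by (rule integrable_bounded_\<rho>[OF borel_measurable_times[OF crm(1) Dm], where C="Cc * CD"])
       (use CD Cc CD0 repb in \<open>auto simp: abs_mult intro!: mult_mono\<close>)
  have icW: "integrable \<rho> (\<lambda>w. W w * c w)"
  proof (rule integrable_bounded_\<rho>[OF borel_measurable_times[OF Wm cm], where C="CW * Cc"])
    show "\<bar>W w * c w\<bar> \<le> CW * Cc" if "w \<in> X \<times> Z" for w
      unfolding abs_mult using CW[OF that] Cc(1)[OF that] by (intro mult_mono) (auto intro: order_trans[OF abs_ge_zero])
  qed
  \<comment> \<open>The estimate passes from \<open>W\<close> to \<open>D\<close>, then from
    \<open>c\<close> to its representatives under the product law, crosses to \<open>\<pi>\<close>
    by the exact identity \<open>cost\<close>, and returns from representatives to
    \<open>c\<close>.\<close>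
  have "(\<integral>w. W w * c w \<partial>\<rho>) \<le> (\<integral>w. D w * c w + Cc * (2 * \<eta> + \<eta> * D w) \<partial>\<rho>)"
  proof (rule integral_mono)
    fix w assume "w \<in> space \<rho>"
    then have w: "w \<in> X \<times> Z" using spaces by simp
    have "(W w - D w) * c w \<le> \<bar>W w - D w\<bar> * \<bar>c w\<bar>" unfolding abs_mult[symmetric] by (rule abs_ge_self)
    also have "\<dots> \<le> (2 * \<eta> + \<eta> * D w) * Cc" using WD[OF w] Cc(1)[OF w] by (intro mult_mono) auto
    finally show "W w * c w \<le> D w * c w + Cc * (2 * \<eta> + \<eta> * D w)" by (simp add: algebra_simps)
  qed (use icW icD i\<rho> in auto)
  also have "\<dots> = (\<integral>w. D w * c w \<partial>\<rho>) + Cc * (2 * \<eta> + \<eta> * 1)"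
    using icD i\<rho> massD by (simp add: P.prob_space)
  also have "(\<integral>w. D w * c w \<partial>\<rho>) \<le> (\<integral>w. c (rep (cell2 N w)) * D w + \<tau> * D w \<partial>\<rho>)"
  proof (rule integral_mono)
    fix w assume "w \<in> space \<rho>"
    then have w: "w \<in> X \<times> Z" using spaces by simp
    have "D w * c w \<le> D w * (c (rep (cell2 N w)) + \<tau>)"
      using rep[OF w] d by (intro mult_left_mono) (auto simp: D_def)
    then show "D w * c w \<le> c (rep (cell2 N w)) * D w + \<tau> * D w" by (simp add: algebra_simps)
  qed (use icrD icD i\<rho> in auto)
  also have "(\<integral>w. c (rep (cell2 N w)) * D w + \<tau> * D w \<partial>\<rho>) = (\<integral>w. c (rep (cell2 N w)) * D w \<partial>\<rho>) + \<tau> * 1"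
    using icrD i\<rho> massD by simp
  also have "(\<integral>w. c (rep (cell2 N w)) * D w \<partial>\<rho>) = (\<integral>w. c (rep (cell2 N w)) \<partial>\<pi>)"
    unfolding D_def by (rule cost[of "\<lambda>s. c (rep s)"])
  also have "\<dots> \<le> (\<integral>w. c w + \<tau> \<partial>\<pi>)"
  proof (rule integral_mono)
    fix w assume "w \<in> space \<pi>"
    then show "c (rep (cell2 N w)) \<le> c w + \<tau>" using rep[of w] sp\<pi> by auto
  qed (use icr\<pi> ic\<pi> in auto)
  also have "\<dots> = (\<integral>w. c w \<partial>\<pi>) + \<tau>" using ic\<pi> by (simp add: \<pi>.prob_space)
  finally have "(\<integral>w. W w * c w \<partial>\<rho>) \<le> (\<integral>w. c w \<partial>\<pi>) + \<tau> + \<tau> * 1 + Cc * (2 * \<eta> + \<eta> * 1)" by simp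
  also have "\<dots> \<le> (\<integral>w. c w \<partial>\<pi>) + (2 + 3 * Cc) * \<eta>" using \<tau>(2) by (simp add: algebra_simps)
  also have "\<dots> < (\<integral>w. c w \<partial>\<pi>) + e" using \<eta>e by simp
  finally have "(\<integral>w. W w * c w \<partial>\<rho>) < (\<integral>w. c w \<partial>\<pi>) + e" .
  then show ?thesis
    by (intro that[of N L k]) (use W0 in \<open>auto simp: W_def q_def \<eta>_def\<close>)
qed

end

section \<open>Optimality in the limit\<close>

lemma pair_kernels:
  assumes k: "k1 \<in> prob_kernels M N1" "k2 \<in> prob_kernels M N2"
  shows "(\<lambda>x. k1 x \<Otimes>\<^sub>M k2 x) \<in> prob_kernels M (N1 \<Otimes>\<^sub>M N2)"
  unfolding prob_kernels_def
proof (rule measurable_prob_algebraI)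
  show "prob_space (k1 x \<Otimes>\<^sub>M k2 x)" if "x \<in> space M" for x
    by (rule prob_space_pair[OF prob_kernelsD(1)[OF k(1) that] prob_kernelsD(1)[OF k(2) that]])
  show "(\<lambda>x. k1 x \<Otimes>\<^sub>M k2 x) \<in> measurable M (subprob_algebra (N1 \<Otimes>\<^sub>M N2))"
    using k unfolding prob_kernels_def by (intro measurable_pair_measure measurable_prob_algebraD)
qed

context three_marginals
begin

context
  fixes c1 c2 c3 :: "real \<times> real \<Rightarrow> real"
  assumes c: "continuous_on (X \<times> Y) c1" "continuous_on (Y \<times> Z) c2" "continuous_on (X \<times> Z) c3"
begin

lemma c_measurable:
  "c1 \<in> borel_measurable (borel_on X \<Otimes>\<^sub>M borel_on Y)" "c2 \<in> borel_measurable (borel_on Y \<Otimes>\<^sub>M borel_on Z)"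
  "c3 \<in> borel_measurable Q"
  using c by (auto intro: borel_measurable_continuous_on_Times)

lemma c_bounded: "\<exists>C. \<forall>w\<in>X \<times> Y. \<bar>c1 w\<bar> \<le> C" "\<exists>C. \<forall>w\<in>Y \<times> Z. \<bar>c2 w\<bar> \<le> C" "\<exists>C. \<forall>w\<in>X \<times> Z. \<bar>c3 w\<bar> \<le> C"
  using compact_continuous_abs_bounded[OF compact_Times[OF compact(1,2)] c(1)]
    compact_continuous_abs_bounded[OF compact_Times[OF compact(2,3)] c(2)]
    compact_continuous_abs_bounded[OF compact_Times[OF compact(1,3)] c(3)] by meson+

definition "I1 \<pi> = (\<integral>w. c1 (fst w, fst (snd w)) \<partial>\<pi>)"
definition "I2 \<pi> = (\<integral>w. c2 (snd w) \<partial>\<pi>)"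
definition "I3 \<pi> = (\<integral>w. c3 (fst w, snd (snd w)) \<partial>\<pi>)"

lemma cost_measurable:
  "(\<lambda>w. c1 (fst w, fst (snd w))) \<in> borel_measurable P" "(\<lambda>w. c2 (snd w)) \<in> borel_measurable P"
  "(\<lambda>w. c3 (fst w, snd (snd w))) \<in> borel_measurable P"
  using measurable_compose[OF P_proj_measurable(4) c_measurable(1)] measurable_compose[OF P_proj_measurable(5) c_measurable(2)]
    measurable_compose[OF P_proj_measurable(6) c_measurable(3)] by auto

lemma cost_integrable:
  assumes "prob_space \<pi>" "sets \<pi> = sets P"
  shows "integrable \<pi> (\<lambda>w. c1 (fst w, fst (snd w)))" "integrable \<pi> (\<lambda>w. c2 (snd w))"
    "integrable \<pi> (\<lambda>w. c3 (fst w, snd (snd w)))"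
proof -
  note sp = space_P[OF assms(2)]
  obtain C1 C2 C3 where C: "\<And>w. w \<in> X \<times> Y \<Longrightarrow> \<bar>c1 w\<bar> \<le> C1" "\<And>w. w \<in> Y \<times> Z \<Longrightarrow> \<bar>c2 w\<bar> \<le> C2" "\<And>w. w \<in> X \<times> Z \<Longrightarrow> \<bar>c3 w\<bar> \<le> C3"
    using c_bounded by meson
  show "integrable \<pi> (\<lambda>w. c1 (fst w, fst (snd w)))"
    by (rule prob_space_integrable_bounded[OF assms(1), where C=C1])
       (use cost_measurable C sp in \<open>auto simp: measurable_cong_sets[OF assms(2) refl]\<close>)
  show "integrable \<pi> (\<lambda>w. c2 (snd w))"
    by (rule prob_space_integrable_bounded[OF assms(1), where C=C2])
       (use cost_measurable C sp in \<open>auto simp: measurable_cong_sets[OF assms(2) refl]\<close>)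
  show "integrable \<pi> (\<lambda>w. c3 (fst w, snd (snd w)))"
    by (rule prob_space_integrable_bounded[OF assms(1), where C=C3])
       (use cost_measurable C sp in \<open>auto simp: measurable_cong_sets[OF assms(2) refl]\<close>)
qed

lemma cost_split:
  assumes "\<pi> \<in> mart_couplings3 \<mu>X \<mu>Y \<mu>Z"
  shows "(\<integral>w. (case w of (x, y, z) \<Rightarrow> c1 (x, y) + c2 (y, z) + \<epsilon> * c3 (x, z)) \<partial>\<pi>) = I1 \<pi> + I2 \<pi> + \<epsilon> * I3 \<pi>"
proof -
  have "prob_space \<pi>" "sets \<pi> = sets P" using assms by (auto simp: mart_couplings3_def couplings3_alt)
  from cost_integrable[OF this] show ?thesis by (simp add: I1_def I2_def I3_def case_prod_beta')
qed

lemma limit_optimality: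
  assumes opt: "\<And>\<epsilon>. \<epsilon> > 0 \<Longrightarrow>
      is_optimal (\<lambda>(x, y, z). c1 (x, y) + c2 (y, z) + \<epsilon> * c3 (x, z)) (mart_couplings3 \<mu>X \<mu>Y \<mu>Z) (\<pi>\<epsilon> \<epsilon>)"
    and \<pi>0: "prob_space \<pi>0" "sets \<pi>0 = sets P" and lim: "weak_limit_point_at_0 \<pi>\<epsilon> \<pi>0"
  shows "\<pi>0 \<in> mart_couplings3 \<mu>X \<mu>Y \<mu>Z"
    and "\<pi> \<in> mart_couplings3 \<mu>X \<mu>Y \<mu>Z \<Longrightarrow> I1 \<pi>0 + I2 \<pi>0 \<le> I1 \<pi> + I2 \<pi>"
    and "\<pi> \<in> mart_couplings3 \<mu>X \<mu>Y \<mu>Z \<Longrightarrow> I1 \<pi> + I2 \<pi> = I1 \<pi>0 + I2 \<pi>0 \<Longrightarrow> I3 \<pi>0 \<le> I3 \<pi>"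
proof -
  obtain e0 :: "nat \<Rightarrow> real" where e0: "filterlim e0 (at_right 0) sequentially" "weakly_converges (\<lambda>n. \<pi>\<epsilon> (e0 n)) \<pi>0"
    using lim by (auto simp: weak_limit_point_at_0_def)
  have "eventually (\<lambda>n. e0 n > 0) sequentially" and e0lim: "e0 \<longlonglongrightarrow> 0"
    using e0(1) by (auto simp: filterlim_at elim: eventually_mono)
  then obtain n0 where n0: "\<And>n. n \<ge> n0 \<Longrightarrow> e0 n > 0" by (auto simp: eventually_sequentially)
  \<comment> \<open>Positivity of \<open>e0\<close> holds only eventually; dropping an initial
    segment gives it for every index.\<close>
  define e where "e n = e0 (n + n0)" for n
  define \<pi>s where "\<pi>s n = \<pi>\<epsilon> (e n)" for n
  have e: "e n > 0" for n using n0 by (simp add: e_def)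
  have elim: "e \<longlonglongrightarrow> 0" unfolding e_def using LIMSEQ_ignore_initial_segment[OF e0lim] .
  have conv: "weakly_converges \<pi>s \<pi>0"
    unfolding weakly_converges_def \<pi>s_def e_def
    using e0(2)[unfolded weakly_converges_def] LIMSEQ_ignore_initial_segment[where k=n0] by blast
  have M3: "\<pi>s n \<in> mart_couplings3 \<mu>X \<mu>Y \<mu>Z" for n
    using opt[OF e] by (simp add: is_optimal_def is_arg_min_def \<pi>s_def)
  have ineq: "I1 (\<pi>s n) + I2 (\<pi>s n) + e n * I3 (\<pi>s n) \<le> I1 \<pi> + I2 \<pi> + e n * I3 \<pi>"
    if "\<pi> \<in> mart_couplings3 \<mu>X \<mu>Y \<mu>Z" for n \<pi>
    using opt[OF e, of n] that cost_split[OF M3, of n "e n"] cost_split[OF that, of "e n"]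
    by (fastforce simp: is_optimal_def is_arg_min_def \<pi>s_def not_less)
  have sp: "space \<pi>0 = X \<times> Y \<times> Z" by (rule space_P[OF \<pi>0(2)])
  have L: "(\<lambda>n. \<integral>w. f w \<partial>\<pi>s n) \<longlonglongrightarrow> (\<integral>w. f w \<partial>\<pi>0)" if "continuous_on (X \<times> Y \<times> Z) f" for f :: "_ \<Rightarrow> real"
  proof -
    have "compact (f ` (X \<times> Y \<times> Z))" using that compact by (intro compact_continuous_image compact_Times)
    then show ?thesis using conv that sp by (auto simp: weakly_converges_def intro: compact_imp_bounded)
  qed
  have "continuous_on (X \<times> Y \<times> Z) (\<lambda>w. c1 (fst w, fst (snd w)))"
    by (rule continuous_on_compose2[OF c(1)]) (auto intro!: continuous_intros)
  from L[OF this] have l1: "(\<lambda>n. I1 (\<pi>s n)) \<longlonglongrightarrow> I1 \<pi>0" by (simp add: I1_def)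
  have "continuous_on (X \<times> Y \<times> Z) (\<lambda>w. c2 (snd w))"
    by (rule continuous_on_compose2[OF c(2)]) (auto intro!: continuous_intros)
  from L[OF this] have l2: "(\<lambda>n. I2 (\<pi>s n)) \<longlonglongrightarrow> I2 \<pi>0" by (simp add: I2_def)
  have "continuous_on (X \<times> Y \<times> Z) (\<lambda>w. c3 (fst w, snd (snd w)))"
    by (rule continuous_on_compose2[OF c(3)]) (auto intro!: continuous_intros)
  from L[OF this] have l3: "(\<lambda>n. I3 (\<pi>s n)) \<longlonglongrightarrow> I3 \<pi>0" by (simp add: I3_def)
  show "\<pi>0 \<in> mart_couplings3 \<mu>X \<mu>Y \<mu>Z"
    by (rule weak_limit_in_mart_couplings3[OF M3 conv \<pi>0])
  show first: "I1 \<pi>0 + I2 \<pi>0 \<le> I1 \<pi> + I2 \<pi>" if \<pi>: "\<pi> \<in> mart_couplings3 \<mu>X \<mu>Y \<mu>Z" for \<pi>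
  proof -
    have "(\<lambda>n. I1 (\<pi>s n) + I2 (\<pi>s n) + e n * I3 (\<pi>s n)) \<longlonglongrightarrow> I1 \<pi>0 + I2 \<pi>0 + 0 * I3 \<pi>0"
      by (intro tendsto_intros l1 l2 l3 elim)
    moreover have "(\<lambda>n. I1 \<pi> + I2 \<pi> + e n * I3 \<pi>) \<longlonglongrightarrow> I1 \<pi> + I2 \<pi> + 0 * I3 \<pi>"
      by (intro tendsto_intros elim)
    ultimately have "I1 \<pi>0 + I2 \<pi>0 + 0 * I3 \<pi>0 \<le> I1 \<pi> + I2 \<pi> + 0 * I3 \<pi>"
      by (rule LIMSEQ_le) (use ineq[OF \<pi>] in auto)
    then show ?thesis by simp
  qed
  show "I3 \<pi>0 \<le> I3 \<pi>" if \<pi>: "\<pi> \<in> mart_couplings3 \<mu>X \<mu>Y \<mu>Z" and eq: "I1 \<pi> + I2 \<pi> = I1 \<pi>0 + I2 \<pi>0"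
  proof (rule LIMSEQ_le_const2[OF l3])
    have "I3 (\<pi>s n) \<le> I3 \<pi>" for n
    proof -
      \<comment> \<open>\<open>\<pi>\<close> attains the minimum of \<open>I1 + I2\<close>, so
        \<open>\<pi>s n\<close> cannot do better there. What remains of the comparison is the
        perturbation, and the positive factor \<open>e n\<close> cancels.\<close>
      have "e n * I3 (\<pi>s n) \<le> e n * I3 \<pi>" using ineq[OF \<pi>, of n] first[OF M3, of n] eq by linarith
      then show ?thesis using e[of n] by simp
    qed
    then show "\<exists>N. \<forall>n\<ge>N. I3 (\<pi>s n) \<le> I3 \<pi>" by blast
  qed
qed

text \<open>\<open>c1\<close> and \<open>c2\<close> see only one coordinate of the fibre law. How
  \<open>x\<close> and \<open>z\<close> are coupled inside a fibre affects \<open>c3\<close>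
  alone.\<close>

lemma glue_costs:
  assumes K: "K \<in> prob_kernels \<mu>Y Q"
  shows "I1 (glue K) = (\<integral>y. \<integral>v. c1 (fst v, y) \<partial>K y \<partial>\<mu>Y)" "I2 (glue K) = (\<integral>y. \<integral>v. c2 (y, snd v) \<partial>K y \<partial>\<mu>Y)"
    "I3 (glue K) = (\<integral>y. \<integral>v. c3 v \<partial>K y \<partial>\<mu>Y)"
proof -
  obtain C1 C2 C3 where C: "\<And>w. w \<in> X \<times> Y \<Longrightarrow> \<bar>c1 w\<bar> \<le> C1" "\<And>w. w \<in> Y \<times> Z \<Longrightarrow> \<bar>c2 w\<bar> \<le> C2" "\<And>w. w \<in> X \<times> Z \<Longrightarrow> \<bar>c3 w\<bar> \<le> C3"
    using c_bounded by meson
  show "I1 (glue K) = (\<integral>y. \<integral>v. c1 (fst v, y) \<partial>K y \<partial>\<mu>Y)"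
    unfolding I1_def by (subst integral_glue[OF K cost_measurable(1), where C=C1]) (use C in auto)
  show "I2 (glue K) = (\<integral>y. \<integral>v. c2 (y, snd v) \<partial>K y \<partial>\<mu>Y)"
    unfolding I2_def by (subst integral_glue[OF K cost_measurable(2), where C=C2]) (use C in auto)
  show "I3 (glue K) = (\<integral>y. \<integral>v. c3 v \<partial>K y \<partial>\<mu>Y)"
    unfolding I3_def by (subst integral_glue[OF K cost_measurable(3), where C=C3]) (use C in auto)
qed

text \<open>With product fibres, the integral of an indicator of \<open>x\<close> times
  \<open>z - y\<close> factorizes, and the second factor vanishes by \<open>mean\<close>. The
  \<open>c1\<close>- and \<open>c2\<close>-costs can thus be prescribed independently, so minimality
  of their sum yields minimality of each. The first martingale condition is inherited from
  \<open>\<pi>1\<close>, the second comes from \<open>mean\<close>.\<close>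

lemma product_glue:
  assumes kX: "kX \<in> prob_kernels \<mu>Y (borel_on X)" and kZ: "kZ \<in> prob_kernels \<mu>Y (borel_on Z)"
    and \<pi>1: "\<pi>1 \<in> mart_couplings \<mu>X \<mu>Y" and \<pi>2: "\<pi>2 \<in> couplings \<mu>Y \<mu>Z"
    and eq1: "\<And>f :: real \<times> real \<Rightarrow> real. f \<in> borel_measurable (borel_on X \<Otimes>\<^sub>M borel_on Y) \<Longrightarrow> (\<exists>C. \<forall>w\<in>X \<times> Y. \<bar>f w\<bar> \<le> C) \<Longrightarrow>
        (\<integral>y. \<integral>x. f (x, y) \<partial>kX y \<partial>\<mu>Y) = (\<integral>w. f w \<partial>\<pi>1)"
    and eq2: "\<And>f :: real \<times> real \<Rightarrow> real. f \<in> borel_measurable (borel_on Y \<Otimes>\<^sub>M borel_on Z) \<Longrightarrow> (\<exists>C. \<forall>w\<in>Y \<times> Z. \<bar>f w\<bar> \<le> C) \<Longrightarrow>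
        (\<integral>y. \<integral>z. f (y, z) \<partial>kZ y \<partial>\<mu>Y) = (\<integral>w. f w \<partial>\<pi>2)"
    and mean: "AE y in \<mu>Y. (\<integral>z. z \<partial>kZ y) = y"
  shows "\<exists>\<pi>\<in>mart_couplings3 \<mu>X \<mu>Y \<mu>Z. I1 \<pi> = (\<integral>w. c1 w \<partial>\<pi>1) \<and> I2 \<pi> = (\<integral>w. c2 w \<partial>\<pi>2)"
proof -
  define K where "K y = kX y \<Otimes>\<^sub>M kZ y" for y
  have K: "K \<in> prob_kernels \<mu>Y Q" unfolding K_def[abs_def] by (rule pair_kernels[OF kX kZ])
  have fst_eq: "(\<integral>v. f (fst v) \<partial>K y) = (\<integral>x. f x \<partial>kX y)" if "f \<in> borel_measurable (borel_on X)" "y \<in> Y" for f :: "real \<Rightarrow> real" and y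
  proof -
    note k1 = prob_kernelsD[OF kX, of y, unfolded space_marginals, OF that(2)] and k2 = prob_kernelsD[OF kZ, of y, unfolded space_marginals, OF that(2)]
    have "(\<integral>v. f (fst v) \<partial>K y) = (\<integral>x. f x \<partial>distr (K y) (kX y) fst)"
      unfolding K_def by (rule integral_distr[symmetric]) (use that(1) in \<open>auto simp: measurable_cong_sets[OF k1(2) refl]\<close>)
    then show ?thesis unfolding K_def prob_space.distr_pair_fst[OF k2(1)] .
  qed
  have snd_eq: "(\<integral>v. f (snd v) \<partial>K y) = (\<integral>z. f z \<partial>kZ y)" if "f \<in> borel_measurable (borel_on Z)" "y \<in> Y" for f :: "real \<Rightarrow> real" and y
  proof -
    note k1 = prob_kernelsD[OF kX, of y, unfolded space_marginals, OF that(2)] and k2 = prob_kernelsD[OF kZ, of y, unfolded space_marginals, OF that(2)]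
    interpret k1: prob_space "kX y" by (rule k1)
    interpret k2: prob_space "kZ y" by (rule k2)
    interpret pair_prob_space "kX y" "kZ y" ..
    have d: "distr (K y) (kZ y) snd = kZ y"
    proof (rule measure_eqI)
      fix A assume "A \<in> sets (distr (K y) (kZ y) snd)"
      then have A: "A \<in> sets (kZ y)" by simp
      have "snd -` A \<inter> space (kX y \<Otimes>\<^sub>M kZ y) = space (kX y) \<times> A"
        using sets.sets_into_space[OF A] by (auto simp: space_pair_measure)
      then show "emeasure (distr (K y) (kZ y) snd) A = emeasure (kZ y) A"
        using A unfolding K_def by (simp add: emeasure_distr k2.emeasure_pair_measure_Times k1.emeasure_space_1)
    qed simp
    have "(\<integral>v. f (snd v) \<partial>K y) = (\<integral>x. f x \<partial>distr (K y) (kZ y) snd)"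
      unfolding K_def by (rule integral_distr[symmetric]) (use that(1) in \<open>auto simp: measurable_cong_sets[OF k2(2) refl]\<close>)
    then show ?thesis unfolding d .
  qed
  have sec: "(\<lambda>x. f (x, y)) \<in> borel_measurable (borel_on X)" if "f \<in> borel_measurable (borel_on X \<Otimes>\<^sub>M borel_on Y)" "y \<in> Y" for f :: "_ \<Rightarrow> real" and y
    using measurable_Pair1[OF that(1)] that(2) by (simp add: space_borel_on_real)
  have sec2: "(\<lambda>z. f (y, z)) \<in> borel_measurable (borel_on Z)" if "f \<in> borel_measurable (borel_on Y \<Otimes>\<^sub>M borel_on Z)" "y \<in> Y" for f :: "_ \<Rightarrow> real" and y
    using measurable_Pair2[OF that(1)] that(2) by (simp add: space_borel_on_real)
  have eqXY: "(\<integral>y. \<integral>v. f (fst v, y) \<partial>K y \<partial>\<mu>Y) = (\<integral>w. f w \<partial>\<pi>1)"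
    if "f \<in> borel_measurable (borel_on X \<Otimes>\<^sub>M borel_on Y)" "\<exists>C. \<forall>w\<in>X \<times> Y. \<bar>f w\<bar> \<le> C" for f :: "_ \<Rightarrow> real"
    unfolding eq1[OF that, symmetric]
    by (intro Bochner_Integration.integral_cong refl fst_eq[OF sec[OF that(1)]]) (simp_all add: space_marginals)
  have eqYZ: "(\<integral>y. \<integral>v. f (y, snd v) \<partial>K y \<partial>\<mu>Y) = (\<integral>w. f w \<partial>\<pi>2)"
    if "f \<in> borel_measurable (borel_on Y \<Otimes>\<^sub>M borel_on Z)" "\<exists>C. \<forall>w\<in>Y \<times> Z. \<bar>f w\<bar> \<le> C" for f :: "_ \<Rightarrow> real"
    unfolding eq2[OF that, symmetric]
    by (intro Bochner_Integration.integral_cong refl snd_eq[OF sec2[OF that(1)]]) (simp_all add: space_marginals)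
  have "AE y in \<mu>Y. \<forall>A\<in>sets (borel_on X). (\<integral>v. indicator A (fst v) * (snd v - y) \<partial>K y) = 0"
    using mean AE_space
  proof eventually_elim
    case (elim y)
    then have y: "y \<in> Y" by (simp add: space_marginals)
    note k1 = prob_kernelsD[OF kX, of y, unfolded space_marginals, OF y] and k2 = prob_kernelsD[OF kZ, of y, unfolded space_marginals, OF y]
    interpret k1: prob_space "kX y" by (rule k1)
    interpret k2: prob_space "kZ y" by (rule k2)
    interpret pair_prob_space "kX y" "kZ y" ..
    have "(\<lambda>z. z) \<in> borel_measurable (kZ y)"
      by (rule borel_measurable_borel_on_ident[OF k2(2)])
    then have iz: "integrable (kZ y) (\<lambda>z. z)"
      by (rule prob_space_integrable_bounded[OF k2(1), where C=R]) (use R(4) k2(3) space_borel_on_real in auto)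
    show ?case
    proof
      fix A assume A: "A \<in> sets (borel_on X)"
      have m: "(\<lambda>v. indicator A (fst v) * (snd v - y)) \<in> borel_measurable (kX y \<Otimes>\<^sub>M kZ y)"
      proof -
        have "(\<lambda>v. indicat_real A (fst v)) \<in> borel_measurable (kX y \<Otimes>\<^sub>M kZ y)"
          using A k1(2) by (intro measurable_compose[OF measurable_fst borel_measurable_indicator]) simp
        moreover have "(\<lambda>v. snd v - y) \<in> borel_measurable (kX y \<Otimes>\<^sub>M kZ y)"
          by (intro borel_measurable_diff borel_measurable_const measurable_compose[OF measurable_snd borel_measurable_borel_on_ident[OF k2(2)]])
        ultimately show ?thesis by (rule borel_measurable_times)
      qed
      have "integrable (kX y \<Otimes>\<^sub>M kZ y) (\<lambda>v. indicator A (fst v) * (snd v - y))"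
      proof (rule prob_space_integrable_bounded[OF P.prob_space_axioms m, where C="2 * R"])
        fix v assume "v \<in> space (kX y \<Otimes>\<^sub>M kZ y)"
        then have "snd v \<in> Z" using k2(3) by (auto simp: space_pair_measure space_borel_on_real)
        then show "\<bar>indicator A (fst v) * (snd v - y)\<bar> \<le> 2 * R"
          using R(4)[of "snd v"] R(3)[OF y] R(1) by (auto split: split_indicator)
      qed
      then have "(\<integral>v. indicator A (fst v) * (snd v - y) \<partial>K y) = (\<integral>x. \<integral>z. indicator A x * (z - y) \<partial>kZ y \<partial>kX y)"
        unfolding K_def by (subst integral_fst'[symmetric]) auto
      also have "\<dots> = 0" using iz elim(1) by (simp add: k2.prob_space)
      finally show "(\<integral>v. indicator A (fst v) * (snd v - y) \<partial>K y) = 0" .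
    qed
  qed
  then have "glue K \<in> mart_couplings3 \<mu>X \<mu>Y \<mu>Z"
    by (rule glue_in_mart_couplings3[OF K \<pi>1 \<pi>2, rotated 2]) (auto intro: eqXY eqYZ)
  then show ?thesis
    using glue_costs[OF K] eqXY[OF c_measurable(1) c_bounded(1)] eqYZ[OF c_measurable(2) c_bounded(2)] by auto
qed

end


section \<open>Fibre marginals and two-period marginals of a glued coupling\<close>

context
  fixes K :: "real \<Rightarrow> (real \<times> real) measure"
  assumes K: "K \<in> prob_kernels \<mu>Y Q" and M3: "glue K \<in> mart_couplings3 \<mu>X \<mu>Y \<mu>Z"
begin

definition "kerX y = distr (K y) (borel_on X) fst"
definition "kerZ y = distr (K y) (borel_on Z) snd"
definition "marXY = distr (kernel_product \<mu>Y kerX) (borel_on X \<Otimes>\<^sub>M borel_on Y) (\<lambda>(y, x). (x, y))"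
definition "marYZ = kernel_product \<mu>Y kerZ"

lemma kerX: "kerX \<in> prob_kernels \<mu>Y (borel_on X)"
  unfolding kerX_def[abs_def] by (rule kernel_product_distr(1)[OF prob_marginals(2) K measurable_fst])

lemma kerZ: "kerZ \<in> prob_kernels \<mu>Y (borel_on Z)"
  unfolding kerZ_def[abs_def] by (rule kernel_product_distr(1)[OF prob_marginals(2) K measurable_snd])

lemma fst_snd_K:
  assumes "y \<in> Y" shows "fst \<in> measurable (K y) (borel_on X)" "snd \<in> measurable (K y) (borel_on Z)"
  by (simp_all add: measurable_cong_sets[OF kernelD(2)[OF K assms] refl])

lemma integral_kerX:
  fixes f :: "real \<Rightarrow> real"
  assumes "f \<in> borel_measurable (borel_on X)" "y \<in> Y" shows "(\<integral>x. f x \<partial>kerX y) = (\<integral>v. f (fst v) \<partial>K y)"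
  unfolding kerX_def by (rule integral_distr[OF fst_snd_K(1)[OF assms(2)] assms(1)])

lemma integral_kerZ:
  fixes f :: "real \<Rightarrow> real"
  assumes "f \<in> borel_measurable (borel_on Z)" "y \<in> Y" shows "(\<integral>x. f x \<partial>kerZ y) = (\<integral>v. f (snd v) \<partial>K y)"
  unfolding kerZ_def by (rule integral_distr[OF fst_snd_K(2)[OF assms(2)] assms(1)])

lemma sections:
  fixes f :: "real \<times> real \<Rightarrow> real"
  shows "f \<in> borel_measurable (borel_on X \<Otimes>\<^sub>M borel_on Y) \<Longrightarrow> y \<in> Y \<Longrightarrow> (\<lambda>x. f (x, y)) \<in> borel_measurable (borel_on X)"
    "f \<in> borel_measurable (borel_on Y \<Otimes>\<^sub>M borel_on Z) \<Longrightarrow> y \<in> Y \<Longrightarrow> (\<lambda>z. f (y, z)) \<in> borel_measurable (borel_on Z)"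
  using measurable_Pair1[of f "borel_on X" "borel_on Y" borel y] measurable_Pair2[of f "borel_on Y" "borel_on Z" borel y]
  by (simp_all add: space_borel_on_real)

text \<open>Three forms for three uses: the kernel form feeds \<open>product_glue\<close>, the fibre
  form compares gluings with the same fibre marginals, and the three-period form transfers
  constraints and costs.\<close>

lemma integral_marXY:
  fixes f :: "real \<times> real \<Rightarrow> real"
  assumes f: "f \<in> borel_measurable (borel_on X \<Otimes>\<^sub>M borel_on Y)" and C: "\<exists>C. \<forall>w\<in>X \<times> Y. \<bar>f w\<bar> \<le> C"
  shows "(\<integral>w. f w \<partial>marXY) = (\<integral>y. \<integral>x. f (x, y) \<partial>kerX y \<partial>\<mu>Y)"
    "(\<integral>w. f w \<partial>marXY) = (\<integral>y. \<integral>v. f (fst v, y) \<partial>K y \<partial>\<mu>Y)"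
    "(\<integral>w. f w \<partial>marXY) = (\<integral>w. f (fst w, fst (snd w)) \<partial>glue K)"
proof -
  obtain D where D: "\<And>w. w \<in> X \<times> Y \<Longrightarrow> \<bar>f w\<bar> \<le> D" using C by blast
  have sw: "(\<lambda>(y, x). (x, y)) \<in> measurable (\<mu>Y \<Otimes>\<^sub>M borel_on X) (borel_on X \<Otimes>\<^sub>M borel_on Y)" by measurable
  then have sw': "(\<lambda>(y, x). (x, y)) \<in> measurable (kernel_product \<mu>Y kerX) (borel_on X \<Otimes>\<^sub>M borel_on Y)"
    by (simp add: measurable_cong_sets[OF sets_kernel_product[OF kerX Y.not_empty] refl])
  have "(\<integral>w. f w \<partial>marXY) = (\<integral>u. f (case u of (y, x) \<Rightarrow> (x, y)) \<partial>kernel_product \<mu>Y kerX)"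
    unfolding marXY_def by (rule integral_distr[OF sw' f])
  also have "\<dots> = (\<integral>y. \<integral>x. f (case (y, x) of (y, x) \<Rightarrow> (x, y)) \<partial>kerX y \<partial>\<mu>Y)"
    by (rule integral_kernel_product[OF prob_marginals(2) kerX measurable_compose[OF sw f], where C=D])
       (use D in \<open>auto simp: space_marginals space_borel_on_real\<close>)
  finally show 1: "(\<integral>w. f w \<partial>marXY) = (\<integral>y. \<integral>x. f (x, y) \<partial>kerX y \<partial>\<mu>Y)" by simp
  also have "\<dots> = (\<integral>y. \<integral>v. f (fst v, y) \<partial>K y \<partial>\<mu>Y)"
    by (intro Bochner_Integration.integral_cong refl integral_kerX sections(1)[OF f]) (simp_all add: space_marginals)
  finally show 2: "(\<integral>w. f w \<partial>marXY) = (\<integral>y. \<integral>v. f (fst v, y) \<partial>K y \<partial>\<mu>Y)" .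
  also have "\<dots> = (\<integral>w. f (fst w, fst (snd w)) \<partial>glue K)"
    by (subst integral_glue[OF K measurable_compose[OF P_proj_measurable(4) f], where C=D]) (use D in auto)
  finally show "(\<integral>w. f w \<partial>marXY) = (\<integral>w. f (fst w, fst (snd w)) \<partial>glue K)" .
qed

lemma integral_marYZ:
  fixes f :: "real \<times> real \<Rightarrow> real"
  assumes f: "f \<in> borel_measurable (borel_on Y \<Otimes>\<^sub>M borel_on Z)" and C: "\<exists>C. \<forall>w\<in>Y \<times> Z. \<bar>f w\<bar> \<le> C"
  shows "(\<integral>w. f w \<partial>marYZ) = (\<integral>y. \<integral>z. f (y, z) \<partial>kerZ y \<partial>\<mu>Y)"
    "(\<integral>w. f w \<partial>marYZ) = (\<integral>y. \<integral>v. f (y, snd v) \<partial>K y \<partial>\<mu>Y)"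
    "(\<integral>w. f w \<partial>marYZ) = (\<integral>w. f (snd w) \<partial>glue K)"
proof -
  obtain D where D: "\<And>w. w \<in> Y \<times> Z \<Longrightarrow> \<bar>f w\<bar> \<le> D" using C by blast
  have f': "f \<in> borel_measurable (\<mu>Y \<Otimes>\<^sub>M borel_on Z)"
    using f by (simp add: measurable_cong_sets[OF sets_pair_measure_cong[OF sets_marginals(2) refl] refl])
  show 1: "(\<integral>w. f w \<partial>marYZ) = (\<integral>y. \<integral>z. f (y, z) \<partial>kerZ y \<partial>\<mu>Y)"
    unfolding marYZ_def by (rule integral_kernel_product[OF prob_marginals(2) kerZ f', where C=D])
       (use D in \<open>auto simp: space_marginals space_borel_on_real\<close>)
  also have "\<dots> = (\<integral>y. \<integral>v. f (y, snd v) \<partial>K y \<partial>\<mu>Y)"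
    by (intro Bochner_Integration.integral_cong refl integral_kerZ sections(2)[OF f]) (simp_all add: space_marginals)
  finally show 2: "(\<integral>w. f w \<partial>marYZ) = (\<integral>y. \<integral>v. f (y, snd v) \<partial>K y \<partial>\<mu>Y)" .
  also have "\<dots> = (\<integral>w. f (snd w) \<partial>glue K)"
    by (subst integral_glue[OF K measurable_compose[OF P_proj_measurable(5) f], where C=D]) (use D in auto)
  finally show "(\<integral>w. f w \<partial>marYZ) = (\<integral>w. f (snd w) \<partial>glue K)" .
qed

lemma marXY_prob: "prob_space marXY" "sets marXY = sets (\<mu>X \<Otimes>\<^sub>M \<mu>Y)"
proof -
  have sw: "(\<lambda>(y, x). (x, y)) \<in> measurable (kernel_product \<mu>Y kerX) (borel_on X \<Otimes>\<^sub>M borel_on Y)"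
    unfolding measurable_cong_sets[OF sets_kernel_product[OF kerX Y.not_empty] refl] by measurable
  show "prob_space marXY"
    unfolding marXY_def by (rule prob_space.prob_space_distr[OF prob_space_kernel_product[OF prob_marginals(2) kerX] sw])
  show "sets marXY = sets (\<mu>X \<Otimes>\<^sub>M \<mu>Y)"
    unfolding marXY_def using sets_pair_measure_cong[OF sets_marginals(1,2)] by simp
qed

lemma marYZ_prob: "prob_space marYZ" "sets marYZ = sets (\<mu>Y \<Otimes>\<^sub>M \<mu>Z)"
  unfolding marYZ_def
  using prob_space_kernel_product[OF prob_marginals(2) kerZ] sets_kernel_product[OF kerZ Y.not_empty]
    sets_pair_measure_cong[OF refl sets_marginals(3)] by auto

lemma glue_marginals:
  "A \<in> sets \<mu>X \<Longrightarrow> (\<integral>w. indicat_real A (fst w) \<partial>glue K) = measure \<mu>X A"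
  "A \<in> sets \<mu>Y \<Longrightarrow> (\<integral>w. indicat_real A (fst (snd w)) \<partial>glue K) = measure \<mu>Y A"
  "A \<in> sets \<mu>Z \<Longrightarrow> (\<integral>w. indicat_real A (snd (snd w)) \<partial>glue K) = measure \<mu>Z A"
proof -
  have d: "distr (glue K) \<mu>X fst = \<mu>X" "distr (glue K) \<mu>Y (\<lambda>w. fst (snd w)) = \<mu>Y" "distr (glue K) \<mu>Z (\<lambda>w. snd (snd w)) = \<mu>Z"
    using M3 by (auto simp: mart_couplings3_def couplings3_alt)
  note p = P_projections[OF glue_prob(2)[OF K]]
  show "A \<in> sets \<mu>X \<Longrightarrow> (\<integral>w. indicat_real A (fst w) \<partial>glue K) = measure \<mu>X A"
    using measure_eq_integral_indicator[OF p(4), of A] d(1) by simp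
  show "A \<in> sets \<mu>Y \<Longrightarrow> (\<integral>w. indicat_real A (fst (snd w)) \<partial>glue K) = measure \<mu>Y A"
    using measure_eq_integral_indicator[OF p(5), of A] d(2) by simp
  show "A \<in> sets \<mu>Z \<Longrightarrow> (\<integral>w. indicat_real A (snd (snd w)) \<partial>glue K) = measure \<mu>Z A"
    using measure_eq_integral_indicator[OF p(6), of A] d(3) by simp
qed

lemma indicator_test:
  assumes "T \<in> measurable M N" "A \<in> sets N"
  shows "(\<lambda>w. indicat_real A (T w)) \<in> borel_measurable M" "\<exists>C. \<forall>w\<in>S. \<bar>indicat_real A (T w)\<bar> \<le> C"
  using measurable_compose[OF assms(1) borel_measurable_indicator[OF assms(2)]]
  by (auto intro!: exI[of _ 1] split: split_indicator)

lemma marXY_mart: "marXY \<in> mart_couplings \<mu>X \<mu>Y"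
proof -
  have m: "fst \<in> measurable (borel_on X \<Otimes>\<^sub>M borel_on Y) \<mu>X" "snd \<in> measurable (borel_on X \<Otimes>\<^sub>M borel_on Y) \<mu>Y" by measurable
  have m': "fst \<in> measurable marXY \<mu>X" "snd \<in> measurable marXY \<mu>Y"
    unfolding measurable_cong_sets[OF marXY_prob(2) refl] by auto
  have "distr marXY \<mu>X fst = \<mu>X"
    by (rule distr_eqI_integral_indicator[OF marXY_prob(1) m'(1) prob_marginals(1)])
       (simp add: integral_marXY(3)[OF indicator_test[OF m(1)]] glue_marginals)
  moreover have "distr marXY \<mu>Y snd = \<mu>Y"
    by (rule distr_eqI_integral_indicator[OF marXY_prob(1) m'(2) prob_marginals(2)])
       (simp add: integral_marXY(3)[OF indicator_test[OF m(2)]] glue_marginals)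
  moreover have "(\<integral>w. indicator A (fst w) * (snd w - fst w) \<partial>marXY) = 0" if A: "A \<in> sets \<mu>X" for A
  proof -
    have "(\<integral>w. indicator A (fst w) * (snd w - fst w) \<partial>marXY) =
      (\<integral>w. indicator A (fst (fst w, fst (snd w))) * (snd (fst w, fst (snd w)) - fst (fst w, fst (snd w))) \<partial>glue K)"
    proof (rule integral_marXY(3))
      show "(\<lambda>w. indicator A (fst w) * (snd w - fst w)) \<in> borel_measurable (borel_on X \<Otimes>\<^sub>M borel_on Y)"
        by (intro borel_measurable_times borel_measurable_diff indicator_test(1)[OF m(1) A]
            measurable_compose[OF measurable_fst ident_measurable] measurable_compose[OF measurable_snd ident_measurable])
      show "\<exists>C. \<forall>w\<in>X \<times> Y. \<bar>indicator A (fst w) * (snd w - fst w)\<bar> \<le> C"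
        using R by (intro exI[of _ "2 * R"]) (fastforce split: split_indicator)
    qed
    also have "\<dots> = 0"
      using mart_couplings3_test(1)[OF M3 borel_measurable_indicator[OF A], of 1] by simp
    finally show ?thesis .
  qed
  ultimately show ?thesis
    using marXY_prob by (subst mart_couplings_iff[OF prob_marginals(1) sets_marginals(1) compact(1) sets_marginals(2) compact(2)])
      (auto simp: couplings_def)
qed

text \<open>A tower property: mean \<open>y\<close> given \<open>(x, y)\<close> implies mean
  \<open>y\<close> given \<open>y\<close>, as tests in \<open>y\<close> are particular tests in
  \<open>(x, y)\<close>.\<close>

lemma marYZ_mart: "marYZ \<in> mart_couplings \<mu>Y \<mu>Z"
proof -
  have m: "fst \<in> measurable (borel_on Y \<Otimes>\<^sub>M borel_on Z) \<mu>Y" "snd \<in> measurable (borel_on Y \<Otimes>\<^sub>M borel_on Z) \<mu>Z" by measurable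
  have m': "fst \<in> measurable marYZ \<mu>Y" "snd \<in> measurable marYZ \<mu>Z"
    unfolding measurable_cong_sets[OF marYZ_prob(2) refl] by auto
  have "distr marYZ \<mu>Y fst = \<mu>Y"
    by (rule distr_eqI_integral_indicator[OF marYZ_prob(1) m'(1) prob_marginals(2)])
       (simp add: integral_marYZ(3)[OF indicator_test[OF m(1)]] glue_marginals)
  moreover have "distr marYZ \<mu>Z snd = \<mu>Z"
    by (rule distr_eqI_integral_indicator[OF marYZ_prob(1) m'(2) prob_marginals(3)])
       (simp add: integral_marYZ(3)[OF indicator_test[OF m(2)]] glue_marginals)
  moreover have "(\<integral>w. indicator A (fst w) * (snd w - fst w) \<partial>marYZ) = 0" if A: "A \<in> sets \<mu>Y" for A
  proof -
    have "(\<integral>w. indicator A (fst w) * (snd w - fst w) \<partial>marYZ) =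
      (\<integral>w. indicator A (fst (snd w)) * (snd (snd w) - fst (snd w)) \<partial>glue K)"
    proof (rule integral_marYZ(3))
      show "(\<lambda>w. indicator A (fst w) * (snd w - fst w)) \<in> borel_measurable (borel_on Y \<Otimes>\<^sub>M borel_on Z)"
        by (intro borel_measurable_times borel_measurable_diff indicator_test(1)[OF m(1) A]
            measurable_compose[OF measurable_fst ident_measurable] measurable_compose[OF measurable_snd ident_measurable])
      show "\<exists>C. \<forall>w\<in>Y \<times> Z. \<bar>indicator A (fst w) * (snd w - fst w)\<bar> \<le> C"
        using R by (intro exI[of _ "2 * R"]) (fastforce split: split_indicator)
    qed
    also have "\<dots> = 0"
      using mart_couplings3_test(2)[OF M3 indicator_test(1)[OF measurable_snd A], of 1] by simp
    finally show ?thesis .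
  qed
  ultimately show ?thesis
    using marYZ_prob by (subst mart_couplings_iff[OF prob_marginals(2) sets_marginals(2) compact(2) sets_marginals(3) compact(3)])
      (auto simp: couplings_def)
qed

text \<open>The test set is all of \<open>X\<close>, whose indicator is 1 on the fibre.\<close>

lemma fibre_mean:
  assumes y: "y \<in> Y" and "\<forall>A\<in>sets (borel_on X). (\<integral>v. indicator A (fst v) * (snd v - y) \<partial>K y) = 0"
  shows "(\<integral>z. z \<partial>kerZ y) = y"
proof -
  interpret Ky: prob_space "K y" by (rule kernelD(1)[OF K y])
  have "(\<integral>v. indicator X (fst v) * (snd v - y) \<partial>K y) = 0"
    using assms(2) sets.top[of "borel_on X"] by (simp add: space_borel_on_real)
  moreover have "(\<integral>v. indicator X (fst v) * (snd v - y) \<partial>K y) = (\<integral>v. snd v - y \<partial>K y)"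
    by (intro Bochner_Integration.integral_cong refl) (auto simp: kernelD(3)[OF K y])
  ultimately have "(\<integral>v. snd v \<partial>K y) = y" using kernelD(7)[OF K y] by (simp add: Ky.prob_space)
  then show ?thesis using integral_kerZ[OF ident_measurable y] by simp
qed

lemma fibre_kernels:
  assumes y: "y \<in> Y" and mean: "(\<integral>z. z \<partial>kerZ y) = y"
  shows "fibre X Z (kerX y) (kerZ y) y R"
proof (rule fibre.intro)
  note k1 = prob_kernelsD[OF kerX, of y, unfolded space_marginals, OF y] and k2 = prob_kernelsD[OF kerZ, of y, unfolded space_marginals, OF y]
  show "prob_space (kerX y)" "prob_space (kerZ y)" "sets (kerX y) = sets (borel_on X)" "sets (kerZ y) = sets (borel_on Z)"
    using k1 k2 by auto
qed (use compact R y mean in auto)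

lemma K_coupling:
  assumes y: "y \<in> Y" shows "K y \<in> couplings (kerX y) (kerZ y)"
proof -
  have "sets (kerX y) = sets (borel_on X)" "sets (kerZ y) = sets (borel_on Z)"
    by (simp_all add: kerX_def kerZ_def)
  then have "sets (kerX y \<Otimes>\<^sub>M kerZ y) = sets Q" by (rule sets_pair_measure_cong)
  moreover have "distr (K y) (kerX y) fst = kerX y" "distr (K y) (kerZ y) snd = kerZ y"
    by (simp_all add: kerX_def kerZ_def cong: distr_cong)
  ultimately show ?thesis using kernelD(1,2)[OF K y] by (simp add: couplings_def)
qed

end

end

section \<open>Fibrewise optimality\<close>

lemma couplings_integral:
  fixes f :: "_ \<Rightarrow> real"
  assumes "\<pi> \<in> couplings \<sigma>X \<sigma>Z"
  shows "f \<in> borel_measurable \<sigma>X \<Longrightarrow> (\<integral>v. f (fst v) \<partial>\<pi>) = (\<integral>x. f x \<partial>\<sigma>X)"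
    and "g \<in> borel_measurable \<sigma>Z \<Longrightarrow> (\<integral>v. g (snd v) \<partial>\<pi>) = (\<integral>z. g z \<partial>\<sigma>Z :: real)"
proof -
  note c = couplings_cong_sets[OF assms refl refl]
  show "f \<in> borel_measurable \<sigma>X \<Longrightarrow> (\<integral>v. f (fst v) \<partial>\<pi>) = (\<integral>x. f x \<partial>\<sigma>X)"
    using integral_distr[OF c(5), of f] c(3) by simp
  show "g \<in> borel_measurable \<sigma>Z \<Longrightarrow> (\<integral>v. g (snd v) \<partial>\<pi>) = (\<integral>z. g z \<partial>\<sigma>Z)"
    using integral_distr[OF c(6), of g] c(4) by simp
qed

context three_marginals
begin

text \<open>Here the explicit formula replaces a measurable selection: every ingredient of
  \<open>repair\<close> is an integral of a jointly measurable function against \<open>kX\<close> or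
  \<open>kZ\<close>, so the weight is measurable in \<open>y\<close> together with
  \<open>(x, z)\<close>.\<close>

lemma weight_kernel_measurable:
  fixes q :: "real \<times> real \<Rightarrow> real"
  assumes kX: "kX \<in> prob_kernels \<mu>Y (borel_on X)" and kZ: "kZ \<in> prob_kernels \<mu>Y (borel_on Z)"
    and q: "q \<in> borel_measurable Q"
  shows "(\<lambda>u. weight (kX (fst u)) (kZ (fst u)) (fst u) q \<eta> (snd u)) \<in> borel_measurable (\<mu>Y \<Otimes>\<^sub>M Q)"
proof -
  let ?E = "\<mu>Y \<Otimes>\<^sub>M Q"
  note kX' = kX[unfolded prob_kernels_def] and kZ' = kZ[unfolded prob_kernels_def]
  note EX = measurable_compose[OF measurable_fst kX'] and EZ = measurable_compose[OF measurable_fst kZ']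
  note idY = borel_measurable_borel_on_ident[OF sets_marginals(2)]
  have y: "fst \<in> borel_measurable ?E" using measurable_compose[OF measurable_fst idY] by simp
  have z: "(\<lambda>u. snd (snd u)) \<in> borel_measurable ?E"
    using measurable_compose[OF measurable_compose[OF measurable_snd measurable_snd] ident_measurable] by simp
  have row: "(\<lambda>u. \<integral>z. q (fst (snd u), z) \<partial>kZ (fst u)) \<in> borel_measurable ?E"
  proof -
    have "(\<lambda>p. (fst (snd (fst p)), snd p)) \<in> measurable (?E \<Otimes>\<^sub>M borel_on Z) Q" by measurable
    from measurable_prob_kernel_integral[OF measurable_compose[OF this q] EZ] show ?thesis by simp
  qed
  have col: "(\<lambda>u. \<integral>x. q (x, snd (snd u)) \<partial>kX (fst u)) \<in> borel_measurable ?E"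
  proof -
    have "(\<lambda>p. (snd p, snd (snd (fst p)))) \<in> measurable (?E \<Otimes>\<^sub>M borel_on X) Q" by measurable
    from measurable_prob_kernel_integral[OF measurable_compose[OF this q] EX] show ?thesis by simp
  qed
  have m: "(\<lambda>u. \<integral>x. \<integral>z. q (x, z) \<partial>kZ (fst u) \<partial>kX (fst u)) \<in> borel_measurable ?E"
  proof -
    have "(\<lambda>p. (snd (fst p), snd p)) \<in> measurable ((\<mu>Y \<Otimes>\<^sub>M borel_on X) \<Otimes>\<^sub>M borel_on Z) Q" by measurable
    from measurable_prob_kernel_integral[OF measurable_compose[OF this q] measurable_compose[OF measurable_fst kZ']]
    have "(\<lambda>p. \<integral>z. q (snd p, z) \<partial>kZ (fst p)) \<in> borel_measurable (\<mu>Y \<Otimes>\<^sub>M borel_on X)" by simp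
    from measurable_prob_kernel_integral[OF this kX']
    have "(\<lambda>y. \<integral>x. \<integral>z. q (x, z) \<partial>kZ y \<partial>kX y) \<in> borel_measurable \<mu>Y" by simp
    from measurable_compose[OF measurable_fst this] show ?thesis .
  qed
  have b: "(\<lambda>u. \<integral>z. q (fst (snd u), z) * (z - fst u) \<partial>kZ (fst u)) \<in> borel_measurable ?E"
  proof -
    have "(\<lambda>p. (fst (snd (fst p)), snd p)) \<in> measurable (?E \<Otimes>\<^sub>M borel_on Z) Q" by measurable
    note borel_measurable_times[OF measurable_compose[OF this q] borel_measurable_diff[OF
        measurable_compose[OF measurable_snd ident_measurable] measurable_compose[OF measurable_fst y]]]
    from measurable_prob_kernel_integral[OF this EZ] show ?thesis by simp
  qed
  have B: "(\<lambda>u. \<integral>x. \<integral>z. q (x, z) * (z - fst u) \<partial>kZ (fst u) \<partial>kX (fst u)) \<in> borel_measurable ?E"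
  proof -
    have "(\<lambda>p. (snd (fst p), snd p)) \<in> measurable ((\<mu>Y \<Otimes>\<^sub>M borel_on X) \<Otimes>\<^sub>M borel_on Z) Q" by measurable
    note borel_measurable_times[OF measurable_compose[OF this q] borel_measurable_diff[OF
        measurable_compose[OF measurable_snd ident_measurable] measurable_compose[OF measurable_fst measurable_compose[OF measurable_fst idY]]]]
    from measurable_prob_kernel_integral[OF this measurable_compose[OF measurable_fst kZ']]
    have "(\<lambda>p. \<integral>z. q (snd p, z) * (z - fst p) \<partial>kZ (fst p)) \<in> borel_measurable (\<mu>Y \<Otimes>\<^sub>M borel_on X)" by simp
    from measurable_prob_kernel_integral[OF this kX']
    have "(\<lambda>y. \<integral>x. \<integral>z. q (x, z) * (z - y) \<partial>kZ y \<partial>kX y) \<in> borel_measurable \<mu>Y" by simp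
    from measurable_compose[OF measurable_fst this] show ?thesis .
  qed
  have V: "(\<lambda>u. \<integral>z. (z - fst u)\<^sup>2 \<partial>kZ (fst u)) \<in> borel_measurable ?E"
  proof -
    have "(\<lambda>p. (snd p - fst p)\<^sup>2) \<in> borel_measurable (\<mu>Y \<Otimes>\<^sub>M borel_on Z)"
      by (intro borel_measurable_power borel_measurable_diff measurable_compose[OF measurable_snd ident_measurable]
          measurable_compose[OF measurable_fst idY])
    from measurable_prob_kernel_integral[OF this kZ']
    have "(\<lambda>y. \<integral>z. (z - y)\<^sup>2 \<partial>kZ y) \<in> borel_measurable \<mu>Y" by simp
    from measurable_compose[OF measurable_fst this] show ?thesis .
  qed
  show ?thesis
    unfolding weight_def repair_def
    by (intro borel_measurable_divide borel_measurable_times borel_measurable_add borel_measurable_diff borel_measurable_const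
        row col m b B V y z measurable_compose[OF measurable_snd q])
qed

context
  fixes c1 c2 c3 :: "real \<times> real \<Rightarrow> real" and K :: "real \<Rightarrow> (real \<times> real) measure"
  assumes c: "continuous_on (X \<times> Y) c1" "continuous_on (Y \<times> Z) c2" "continuous_on (X \<times> Z) c3"
    and K: "K \<in> prob_kernels \<mu>Y Q" and M3: "glue K \<in> mart_couplings3 \<mu>X \<mu>Y \<mu>Z"
    and opt3: "\<And>\<pi>. \<pi> \<in> mart_couplings3 \<mu>X \<mu>Y \<mu>Z \<Longrightarrow> I1 c1 \<pi> + I2 c2 \<pi> = I1 c1 (glue K) + I2 c2 (glue K) \<Longrightarrow>
      I3 c3 (glue K) \<le> I3 c3 \<pi>"
begin

text \<open>For one fixed index, the candidate is inserted on the set \<open>G\<close> of fibres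
  where it is admissible and strictly cheaper. The modified coupling is admissible with the same
  \<open>I1\<close> and \<open>I2\<close>, so \<open>opt3\<close> forbids a smaller
  \<open>I3\<close> and \<open>G\<close> must be null.\<close>

lemma competitor_null:
  fixes N k :: nat and L :: "((int \<times> int) \<times> rat) list"
  defines "w \<equiv> \<lambda>y. weight (kerX K y) (kerZ K y) y (step N L) (1 / real (Suc k))"
  shows "AE y in \<mu>Y. \<not> ((\<integral>z. z \<partial>kerZ K y) = y \<and> (\<integral>v. max 0 (- w y v) \<partial>(kerX K y \<Otimes>\<^sub>M kerZ K y)) = 0 \<and>
    (\<integral>v. w y v * c3 v \<partial>(kerX K y \<Otimes>\<^sub>M kerZ K y)) < (\<integral>v. c3 v \<partial>K y))"
proof -
  define kX where "kX = kerX K"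
  define kZ where "kZ = kerZ K"
  define q where "q = step N L"
  define \<eta> where "\<eta> = 1 / real (Suc k)"
  have w: "w y = weight (kX y) (kZ y) y q \<eta>" for y by (simp add: w_def kX_def kZ_def q_def \<eta>_def)
  have \<eta>: "\<eta> > 0" by (simp add: \<eta>_def)
  note kX = kerX[OF K M3, folded kX_def] and kZ = kerZ[OF K M3, folded kZ_def]
  have qm: "q \<in> borel_measurable M" if "fst \<in> borel_measurable M" "snd \<in> borel_measurable M" for M
    unfolding q_def by (rule step_measurable[OF that])
  have qQ: "q \<in> borel_measurable Q"
    by (rule qm) (use measurable_compose[OF measurable_fst ident_measurable] measurable_compose[OF measurable_snd ident_measurable] in simp_all)
  obtain Cq where Cq: "\<And>v. \<bar>q v\<bar> \<le> Cq" using step_bounded unfolding q_def by blast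
  then have Cqb: "\<forall>v\<in>X \<times> Z. \<bar>q v\<bar> \<le> Cq" by simp
  obtain C3 where C3: "\<And>v. v \<in> X \<times> Z \<Longrightarrow> \<bar>c3 v\<bar> \<le> C3" using c_bounded(3)[OF c] by blast
  note c3m = c_measurable(3)[OF c]
  have wm: "(\<lambda>u. w (fst u) (snd u)) \<in> borel_measurable (\<mu>Y \<Otimes>\<^sub>M Q)"
    unfolding w by (rule weight_kernel_measurable[OF kX kZ qQ])
  define \<rho> where "\<rho> y = kX y \<Otimes>\<^sub>M kZ y" for y
  have \<rho>: "\<rho> \<in> prob_kernels \<mu>Y Q" unfolding \<rho>_def[abs_def] by (rule pair_kernels[OF kX kZ])
  note \<rho>' = \<rho>[unfolded prob_kernels_def]
  have mean_m: "(\<lambda>y. \<integral>z. z \<partial>kZ y) \<in> borel_measurable \<mu>Y"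
    using measurable_prob_kernel_integral[OF measurable_compose[OF measurable_snd ident_measurable] kZ[unfolded prob_kernels_def]] by simp
  have neg_m: "(\<lambda>y. \<integral>v. max 0 (- w y v) \<partial>\<rho> y) \<in> borel_measurable \<mu>Y"
    using measurable_prob_kernel_integral[OF borel_measurable_max[OF borel_measurable_const borel_measurable_uminus[OF wm]] \<rho>', of 0] by (simp add: max.commute)
  have cst_m: "(\<lambda>y. \<integral>v. w y v * c3 v \<partial>\<rho> y) \<in> borel_measurable \<mu>Y"
    using measurable_prob_kernel_integral[OF borel_measurable_times[OF wm measurable_compose[OF measurable_snd c3m]] \<rho>'] by simp
  have c0_m: "(\<lambda>y. \<integral>v. c3 v \<partial>K y) \<in> borel_measurable \<mu>Y"
    using measurable_prob_kernel_integral[OF measurable_compose[OF measurable_snd c3m] K[unfolded prob_kernels_def]] by simp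
  \<comment> \<open>Each of the three conditions compares integrals that are measurable in
    \<open>y\<close>. Almost sure nonnegativity is encoded by the integral of the negative part for
    this reason, and the mean condition makes the \<open>fibre\<close> results available on
    \<open>G\<close>.\<close>
  define G where "G = {y \<in> space \<mu>Y. (\<integral>z. z \<partial>kZ y) = y \<and> (\<integral>v. max 0 (- w y v) \<partial>\<rho> y) = 0 \<and>
    (\<integral>v. w y v * c3 v \<partial>\<rho> y) < (\<integral>v. c3 v \<partial>K y)}"
  have G: "G \<in> sets \<mu>Y"
  proof -
    have "{y \<in> space \<mu>Y. (\<integral>z. z \<partial>kZ y) = y} \<in> sets \<mu>Y"
      by (rule borel_measurable_eq[OF mean_m borel_measurable_borel_on_ident[OF sets_marginals(2)]])
    moreover have "{y \<in> space \<mu>Y. (\<integral>v. max 0 (- w y v) \<partial>\<rho> y) = 0} \<in> sets \<mu>Y"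
      by (rule borel_measurable_eq[OF neg_m borel_measurable_const])
    moreover have "{y \<in> space \<mu>Y. (\<integral>v. w y v * c3 v \<partial>\<rho> y) < (\<integral>v. c3 v \<partial>K y)} \<in> sets \<mu>Y"
      by (rule borel_measurable_less[OF cst_m c0_m])
    moreover have "G = {y \<in> space \<mu>Y. (\<integral>z. z \<partial>kZ y) = y} \<inter> {y \<in> space \<mu>Y. (\<integral>v. max 0 (- w y v) \<partial>\<rho> y) = 0} \<inter>
      {y \<in> space \<mu>Y. (\<integral>v. w y v * c3 v \<partial>\<rho> y) < (\<integral>v. c3 v \<partial>K y)}"
      by (auto simp: G_def)
    ultimately show ?thesis by (simp only: sets.Int)
  qed
  have sets_k: "sets (kX y) = sets (borel_on X)" "sets (kZ y) = sets (borel_on Z)" for y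
    by (simp_all add: kX_def kZ_def kerX_def[OF K M3] kerZ_def[OF K M3])
  have sets_\<rho>: "sets (\<rho> y) = sets Q" for y unfolding \<rho>_def by (rule sets_pair_measure_cong[OF sets_k])
  have inG: "density (\<rho> y) (w y) \<in> couplings (kX y) (kZ y)"
    "\<forall>A\<in>sets (borel_on X). (\<integral>v. indicator A (fst v) * (snd v - y) \<partial>density (\<rho> y) (w y)) = 0"
    "(\<integral>v. c3 v \<partial>density (\<rho> y) (w y)) = (\<integral>v. w y v * c3 v \<partial>\<rho> y)" if y: "y \<in> G" for y
  proof -
    have yY: "y \<in> Y" using y by (simp add: G_def space_marginals)
    have "fibre X Z (kX y) (kZ y) y R"
      unfolding kX_def kZ_def by (rule fibre_kernels[OF K M3 yY]) (use y in \<open>simp add: G_def kZ_def\<close>)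
    then interpret f: fibre X Z "kX y" "kZ y" y R .
    have qr: "q \<in> borel_measurable (\<rho> y)" using qQ by (simp add: measurable_cong_sets[OF sets_\<rho> refl])
    note qr' = qr[unfolded \<rho>_def]
    have wr: "w y \<in> borel_measurable (\<rho> y)" unfolding w \<rho>_def by (rule f.weight_measurable[OF qr' Cqb])
    obtain D where D: "\<And>v. v \<in> X \<times> Z \<Longrightarrow> \<bar>w y v\<bar> \<le> D"
      using f.weight_bounded[OF qr' Cqb, of \<eta>] unfolding w by blast
    have "integrable (\<rho> y) (\<lambda>v. max 0 (- w y v))"
      unfolding \<rho>_def
    proof (rule f.integrable_bounded_\<rho>[where C=D])
      show "(\<lambda>v. max 0 (- w y v)) \<in> borel_measurable (kX y \<Otimes>\<^sub>M kZ y)"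
        using wr unfolding \<rho>_def by (intro borel_measurable_max borel_measurable_uminus borel_measurable_const)
      show "\<bar>max 0 (- w y v)\<bar> \<le> D" if "v \<in> X \<times> Z" for v using D[OF that] by (auto simp: max_def)
    qed
    moreover have "(\<integral>v. max 0 (- w y v) \<partial>\<rho> y) = 0" using y by (simp add: G_def)
    ultimately have "AE v in \<rho> y. max 0 (- w y v) = 0"
      by (subst (asm) integral_nonneg_eq_0_iff_AE) auto
    then have nonneg: "AE v in \<rho> y. 0 \<le> w y v" by eventually_elim (auto simp: max_def split: if_splits)
    note n' = nonneg[unfolded \<rho>_def w]
    show "density (\<rho> y) (w y) \<in> couplings (kX y) (kZ y)"
      unfolding \<rho>_def w by (rule f.weight_density_coupling(1)[OF qr' Cqb \<eta> n'])
    show "\<forall>A\<in>sets (borel_on X). (\<integral>v. indicator A (fst v) * (snd v - y) \<partial>density (\<rho> y) (w y)) = 0"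
      unfolding \<rho>_def w using f.weight_density_coupling(2)[OF qr' Cqb \<eta> n'] sets_k by blast
    show "(\<integral>v. c3 v \<partial>density (\<rho> y) (w y)) = (\<integral>v. w y v * c3 v \<partial>\<rho> y)"
      by (rule integral_real_density[OF wr nonneg]) (use c3m in \<open>simp add: measurable_cong_sets[OF sets_\<rho> refl]\<close>)
  qed
  \<comment> \<open>Switching to the candidate exactly where it is cheaper keeps both two-period marginals.\<close>
  define K' where "K' y = (if y \<in> G then density (\<rho> y) (w y) else K y)" for y
  have K'c: "K' y \<in> couplings (kX y) (kZ y)" if "y \<in> Y" for y
    using inG(1)[of y] K_coupling[OF K M3 that] by (auto simp: K'_def kX_def kZ_def)
  have K': "K' \<in> prob_kernels \<mu>Y Q"
    unfolding prob_kernels_def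
  proof (rule measurable_prob_algebraI)
    show prob: "prob_space (K' y)" if "y \<in> space \<mu>Y" for y
      using K'c[of y] that by (simp add: couplings_def space_marginals)
    show "K' \<in> measurable \<mu>Y (subprob_algebra Q)"
    proof (rule measurable_subprob_algebra)
      show "subprob_space (K' y)" if "y \<in> space \<mu>Y" for y
        using prob[OF that] by (rule prob_space_imp_subprob_space)
      show "sets (K' y) = sets Q" if "y \<in> space \<mu>Y" for y
        using couplings_cong_sets(2)[OF K'c sets_k] that by (simp add: space_marginals)
      fix A assume A: "A \<in> sets Q"
      \<comment> \<open>Evaluated at \<open>A\<close>, the density is a kernel integral of the
        weight against \<open>\<rho> y\<close>, which exhibits its measurability in
        \<open>y\<close>.\<close>
      have "(\<lambda>y. if y \<in> G then \<integral>\<^sup>+v. ennreal (w y v) * indicator A v \<partial>\<rho> y else emeasure (K y) A) \<in> borel_measurable \<mu>Y"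
      proof (rule measurable_If_set)
        have "(\<lambda>u. ennreal (w (fst u) (snd u)) * indicator A (snd u)) \<in> borel_measurable (\<mu>Y \<Otimes>\<^sub>M Q)"
          by (intro borel_measurable_times_ennreal measurable_compose[OF wm measurable_ennreal]
              measurable_compose[OF measurable_snd borel_measurable_indicator[OF A]])
        then show "(\<lambda>y. \<integral>\<^sup>+v. ennreal (w y v) * indicator A v \<partial>\<rho> y) \<in> borel_measurable \<mu>Y"
          by (intro nn_integral_measurable_subprob_algebra2[where N=Q] measurable_prob_algebraD[OF \<rho>']) (simp add: split_beta')
        show "(\<lambda>y. emeasure (K y) A) \<in> borel_measurable \<mu>Y"
          by (rule measurable_emeasure_kernel[OF measurable_prob_algebraD[OF K[unfolded prob_kernels_def]] A])
        show "G \<inter> space \<mu>Y \<in> sets \<mu>Y" using G by auto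
      qed
      then show "(\<lambda>y. emeasure (K' y) A) \<in> borel_measurable \<mu>Y"
      proof (rule measurable_cong[THEN iffD1, rotated])
        fix y assume "y \<in> space \<mu>Y"
        have "emeasure (density (\<rho> y) (w y)) A = (\<integral>\<^sup>+v. ennreal (w y v) * indicator A v \<partial>\<rho> y)" if "y \<in> G"
        proof (rule emeasure_density)
          have "w y \<in> borel_measurable (\<rho> y)"
            using measurable_Pair2[OF wm \<open>y \<in> space \<mu>Y\<close>] by (simp add: measurable_cong_sets[OF sets_\<rho> refl])
          then show "(\<lambda>v. ennreal (w y v)) \<in> borel_measurable (\<rho> y)" by (rule measurable_compose[OF _ measurable_ennreal])
          show "A \<in> sets (\<rho> y)" using A sets_\<rho> by simp
        qed
        then show "(if y \<in> G then \<integral>\<^sup>+v. ennreal (w y v) * indicator A v \<partial>\<rho> y else emeasure (K y) A) = emeasure (K' y) A"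
          by (simp add: K'_def)
      qed
    qed
  qed
  note kX_eq = couplings_integral(1)[OF K'c, unfolded measurable_cong_sets[OF sets_k(1) refl]]
    and kZ_eq = couplings_integral(2)[OF K'c, unfolded measurable_cong_sets[OF sets_k(2) refl]]
  have eqXY: "(\<integral>y. \<integral>v. f (fst v, y) \<partial>K' y \<partial>\<mu>Y) = (\<integral>w. f w \<partial>marXY K)"
    if f: "f \<in> borel_measurable (borel_on X \<Otimes>\<^sub>M borel_on Y)" "\<exists>C. \<forall>w\<in>X \<times> Y. \<bar>f w\<bar> \<le> C" for f :: "_ \<Rightarrow> real"
  proof -
    have "(\<integral>y. \<integral>v. f (fst v, y) \<partial>K' y \<partial>\<mu>Y) = (\<integral>y. \<integral>x. f (x, y) \<partial>kX y \<partial>\<mu>Y)"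
    proof (intro Bochner_Integration.integral_cong refl)
      fix y assume "y \<in> space \<mu>Y"
      then have y: "y \<in> Y" by (simp add: space_marginals)
      show "(\<integral>v. f (fst v, y) \<partial>K' y) = (\<integral>x. f (x, y) \<partial>kX y)"
        by (rule kX_eq[OF y sections(1)[OF K M3 f(1) y]])
    qed
    then show ?thesis using integral_marXY(1)[OF K M3 f] by (simp add: kX_def)
  qed
  have eqYZ: "(\<integral>y. \<integral>v. f (y, snd v) \<partial>K' y \<partial>\<mu>Y) = (\<integral>w. f w \<partial>marYZ K)"
    if f: "f \<in> borel_measurable (borel_on Y \<Otimes>\<^sub>M borel_on Z)" "\<exists>C. \<forall>w\<in>Y \<times> Z. \<bar>f w\<bar> \<le> C" for f :: "_ \<Rightarrow> real"
  proof -
    have "(\<integral>y. \<integral>v. f (y, snd v) \<partial>K' y \<partial>\<mu>Y) = (\<integral>y. \<integral>z. f (y, z) \<partial>kZ y \<partial>\<mu>Y)"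
    proof (intro Bochner_Integration.integral_cong refl)
      fix y assume "y \<in> space \<mu>Y"
      then have y: "y \<in> Y" by (simp add: space_marginals)
      show "(\<integral>v. f (y, snd v) \<partial>K' y) = (\<integral>z. f (y, z) \<partial>kZ y)"
        by (rule kZ_eq[OF y sections(2)[OF K M3 f(1) y]])
    qed
    then show ?thesis using integral_marYZ(1)[OF K M3 f] by (simp add: kZ_def)
  qed
  have fib: "AE y in \<mu>Y. \<forall>A\<in>sets (borel_on X). (\<integral>v. indicator A (fst v) * (snd v - y) \<partial>K' y) = 0"
    using glue_mart_couplings3_fibres[OF K M3]
  proof eventually_elim
    case (elim y)
    then show ?case using inG(2)[of y] by (cases "y \<in> G") (simp_all add: K'_def)
  qed
  have M3': "glue K' \<in> mart_couplings3 \<mu>X \<mu>Y \<mu>Z"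
    using marYZ_mart[OF K M3] fib
    by (intro glue_in_mart_couplings3[OF K' marXY_mart[OF K M3], of "marYZ K"] eqXY eqYZ) (auto simp: mart_couplings_def)
  have "I1 c1 (glue K') = I1 c1 (glue K)"
    using glue_costs(1)[OF c K'] eqXY[OF c_measurable(1)[OF c] c_bounded(1)[OF c]]
      integral_marXY(2)[OF K M3 c_measurable(1)[OF c] c_bounded(1)[OF c]] glue_costs(1)[OF c K] by simp
  moreover have "I2 c2 (glue K') = I2 c2 (glue K)"
    using glue_costs(2)[OF c K'] eqYZ[OF c_measurable(2)[OF c] c_bounded(2)[OF c]]
      integral_marYZ(2)[OF K M3 c_measurable(2)[OF c] c_bounded(2)[OF c]] glue_costs(2)[OF c K] by simp
  ultimately have "I3 c3 (glue K) \<le> I3 c3 (glue K')" by (intro opt3 M3') simp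
  then have le: "(\<integral>y. \<integral>v. c3 v \<partial>K y \<partial>\<mu>Y) \<le> (\<integral>y. \<integral>v. c3 v \<partial>K' y \<partial>\<mu>Y)"
    unfolding glue_costs(3)[OF c K] glue_costs(3)[OF c K'] .
  have int: "integrable \<mu>Y (\<lambda>y. \<integral>v. c3 v \<partial>J y)" if J: "J \<in> prob_kernels \<mu>Y Q" for J
  proof (rule prob_space_integrable_bounded[OF prob_marginals(2), where C=C3])
    show "(\<lambda>y. \<integral>v. c3 v \<partial>J y) \<in> borel_measurable \<mu>Y"
      using measurable_prob_kernel_integral[OF measurable_compose[OF measurable_snd c3m] J[unfolded prob_kernels_def]] by simp
    fix y assume "y \<in> space \<mu>Y"
    then have y: "y \<in> Y" by (simp add: space_marginals)
    show "\<bar>\<integral>v. c3 v \<partial>J y\<bar> \<le> C3"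
      by (rule prob_space_integral_abs_le[OF kernelD(1)[OF J y]])
         (use c3m C3 kernelD(3)[OF J y] in \<open>simp_all add: measurable_cong_sets[OF kernelD(2)[OF J y] refl]\<close>)
  qed
  have K'_le: "(\<integral>v. c3 v \<partial>K' y) \<le> (\<integral>v. c3 v \<partial>K y)" for y
    using inG(3)[of y] by (cases "y \<in> G") (auto simp: K'_def G_def)
  have i: "integrable \<mu>Y (\<lambda>y. (\<integral>v. c3 v \<partial>K y) - (\<integral>v. c3 v \<partial>K' y))"
    by (rule Bochner_Integration.integrable_diff[OF int[OF K] int[OF K']])
  \<comment> \<open>The cost difference is nonnegative in every fibre and strictly positive on
    \<open>G\<close>, while minimality makes its integral nonpositive.\<close>
  have "(\<integral>y. (\<integral>v. c3 v \<partial>K y) - (\<integral>v. c3 v \<partial>K' y) \<partial>\<mu>Y) = 0"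
  proof (rule antisym)
    show "(\<integral>y. (\<integral>v. c3 v \<partial>K y) - (\<integral>v. c3 v \<partial>K' y) \<partial>\<mu>Y) \<le> 0"
      using le int[OF K] int[OF K'] by simp
    show "0 \<le> (\<integral>y. (\<integral>v. c3 v \<partial>K y) - (\<integral>v. c3 v \<partial>K' y) \<partial>\<mu>Y)"
      using K'_le by (intro integral_nonneg_AE AE_I2) (simp add: le_diff_eq)
  qed
  then have "AE y in \<mu>Y. (\<integral>v. c3 v \<partial>K y) - (\<integral>v. c3 v \<partial>K' y) = 0"
    using integral_nonneg_eq_0_iff_AE[OF i] K'_le by simp
  with AE_space show ?thesis
  proof eventually_elim
    case (elim y)
    then have "y \<notin> G" using inG(3)[of y] by (auto simp: K'_def G_def)
    then show ?case using elim(1) by (auto simp: G_def kZ_def kX_def \<rho>_def)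
  qed
qed

text \<open>A strictly cheaper barycentric coupling in a fibre would, by density of the candidates
  in cost, produce a strictly cheaper candidate from the countable family. Outside one null set no
  such candidate exists.\<close>

lemma fibrewise_optimal:
  "AE y in \<mu>Y. is_optimal c3 (bary_couplings (\<lambda>x. y) (kerX K y) (kerZ K y)) (K y)"
proof -
  define bad where "bad = (\<lambda>(N, L, k) y. (\<integral>z. z \<partial>kerZ K y) = y \<and>
    (\<integral>v. max 0 (- weight (kerX K y) (kerZ K y) y (step N L) (1 / real (Suc k)) v) \<partial>(kerX K y \<Otimes>\<^sub>M kerZ K y)) = 0 \<and>
    (\<integral>v. weight (kerX K y) (kerZ K y) y (step N L) (1 / real (Suc k)) v * c3 v \<partial>(kerX K y \<Otimes>\<^sub>M kerZ K y)) < (\<integral>v. c3 v \<partial>K y))"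
  \<comment> \<open>The index consists of two naturals and a list over a countable type, so the
    union of the exceptional sets is still null. The parameter \<open>\<eta>\<close> runs through
    reciprocals of positive integers to keep the index countable.\<close>
  have "AE y in \<mu>Y. \<forall>\<theta>. \<not> bad \<theta> y"
    unfolding AE_all_countable bad_def using competitor_null by (auto simp: split_beta')
  with glue_mart_couplings3_fibres[OF K M3] AE_space show ?thesis
  proof eventually_elim
    case (elim y)
    then have y: "y \<in> Y" by (simp add: space_marginals)
    have mean: "(\<integral>z. z \<partial>kerZ K y) = y" by (rule fibre_mean[OF K M3 y elim(1)])
    have "fibre X Z (kerX K y) (kerZ K y) y R" by (rule fibre_kernels[OF K M3 y mean])
    then interpret f: fibre X Z "kerX K y" "kerZ K y" y R .
    have iff: "\<pi> \<in> bary_couplings (\<lambda>x. y) (kerX K y) (kerZ K y) \<longleftrightarrow> \<pi> \<in> couplings (kerX K y) (kerZ K y) \<and>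
      (\<forall>A\<in>sets (kerX K y). (\<integral>w. indicator A (fst w) * (snd w - y) \<partial>\<pi>) = 0)" for \<pi>
      by (rule bary_couplings_iff[OF f.prob(1) f.sets_\<sigma>(2) f.compact(2) borel_measurable_const, where C=R]) (use f.R in auto)
    have "K y \<in> bary_couplings (\<lambda>x. y) (kerX K y) (kerZ K y)"
      unfolding iff using K_coupling[OF K M3 y] elim(1) f.sets_\<sigma>(1) by simp
    moreover have "\<not> (\<integral>v. c3 v \<partial>\<pi>) < (\<integral>v. c3 v \<partial>K y)"
      if \<pi>: "\<pi> \<in> bary_couplings (\<lambda>x. y) (kerX K y) (kerZ K y)" for \<pi>
    proof
      assume less: "(\<integral>v. c3 v \<partial>\<pi>) < (\<integral>v. c3 v \<partial>K y)"
      have p: "\<pi> \<in> couplings (kerX K y) (kerZ K y)"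
        "\<And>A. A \<in> sets (kerX K y) \<Longrightarrow> (\<integral>w. indicator A (fst w) * (snd w - y) \<partial>\<pi>) = 0"
        using \<pi> unfolding iff by auto
      \<comment> \<open>The tolerance is the whole cost gap, so the approximating candidate is still
        strictly cheaper than \<open>K y\<close>.\<close>
      obtain N L k where a: "\<And>w. w \<in> X \<times> Z \<Longrightarrow> 0 \<le> weight (kerX K y) (kerZ K y) y (step N L) (1 / real (Suc k)) w"
        "(\<integral>w. weight (kerX K y) (kerZ K y) y (step N L) (1 / real (Suc k)) w * c3 w \<partial>(kerX K y \<Otimes>\<^sub>M kerZ K y))
          < (\<integral>w. c3 w \<partial>\<pi>) + ((\<integral>v. c3 v \<partial>K y) - (\<integral>v. c3 v \<partial>\<pi>))"
        by (rule f.weight_approx[OF p c(3), of "(\<integral>v. c3 v \<partial>K y) - (\<integral>v. c3 v \<partial>\<pi>)"]) (use less in auto)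
      have "(\<integral>v. max 0 (- weight (kerX K y) (kerZ K y) y (step N L) (1 / real (Suc k)) v) \<partial>(kerX K y \<Otimes>\<^sub>M kerZ K y)) =
        (\<integral>v. 0 \<partial>(kerX K y \<Otimes>\<^sub>M kerZ K y))"
        by (intro Bochner_Integration.integral_cong refl) (use a(1) f.spaces in auto)
      then have "bad (N, L, k) y" using a(2) mean by (simp add: bad_def)
      then show False using elim(3) by blast
    qed
    ultimately show ?case by (auto simp: is_optimal_def is_arg_min_def)
  qed
qed

end

end

theorem theorem3p1:
  fixes X Y Z :: "real set"
    and \<mu>X \<mu>Y \<mu>Z :: "real measure"
    and c1 c2 c3 :: "real \<times> real \<Rightarrow> real"
    and \<pi>\<epsilon> :: "real \<Rightarrow> (real \<times> real \<times> real) measure"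
    and \<pi>0 :: "(real \<times> real \<times> real) measure"
    and \<kappa>XZ :: "real \<Rightarrow> (real \<times> real) measure"
  assumes "compact X" "compact Y" "compact Z"
    and "\<mu>X \<in> borel_probs X" "\<mu>Y \<in> borel_probs Y" "\<mu>Z \<in> borel_probs Z"
    and "\<mu>X \<preceq>\<^sub>c \<mu>Y" "\<mu>Y \<preceq>\<^sub>c \<mu>Z"
    and "continuous_on (X \<times> Y) c1" "continuous_on (Y \<times> Z) c2" "continuous_on (X \<times> Z) c3"
    and "\<And>\<epsilon>. \<epsilon> > 0 \<Longrightarrow>
      is_optimal (\<lambda>(x, y, z). c1 (x, y) + c2 (y, z) + \<epsilon> * c3 (x, z))
        (mart_couplings3 \<mu>X \<mu>Y \<mu>Z) (\<pi>\<epsilon> \<epsilon>)"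
    and "prob_space \<pi>0" "sets \<pi>0 = sets (borel_on X \<Otimes>\<^sub>M borel_on Y \<Otimes>\<^sub>M borel_on Z)"
    and "weak_limit_point_at_0 \<pi>\<epsilon> \<pi>0"
    and "\<kappa>XZ \<in> prob_kernels \<mu>Y (borel_on X \<Otimes>\<^sub>M borel_on Z)"
    and "\<pi>0 = distr (kernel_product \<mu>Y \<kappa>XZ) (borel_on X \<Otimes>\<^sub>M borel_on Y \<Otimes>\<^sub>M borel_on Z)
                (\<lambda>(y, x, z). (x, y, z))"
  shows "\<exists>\<pi>XY \<pi>YZ \<kappa>X \<kappa>Z.
      \<kappa>X \<in> prob_kernels \<mu>Y (borel_on X) \<and>
      \<pi>XY = distr (kernel_product \<mu>Y \<kappa>X) (borel_on X \<Otimes>\<^sub>M borel_on Y) (\<lambda>(y, x). (x, y)) \<and>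
      is_optimal c1 (mart_couplings \<mu>X \<mu>Y) \<pi>XY \<and>
      \<kappa>Z \<in> prob_kernels \<mu>Y (borel_on Z) \<and>
      \<pi>YZ = kernel_product \<mu>Y \<kappa>Z \<and>
      is_optimal c2 (mart_couplings \<mu>Y \<mu>Z) \<pi>YZ \<and>
      (AE y in \<mu>Y. is_optimal c3 (bary_couplings (\<lambda>x. y) (\<kappa>X y) (\<kappa>Z y)) (\<kappa>XZ y))"
proof -
  interpret three_marginals X Y Z \<mu>X \<mu>Y \<mu>Z using assms(1-6) by unfold_locales
  note c = assms(9-11)
  note K = assms(16)
  have glue: "\<pi>0 = glue \<kappa>XZ" using assms(17) by (simp add: glue_def)
  have M3: "glue \<kappa>XZ \<in> mart_couplings3 \<mu>X \<mu>Y \<mu>Z"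
    unfolding glue[symmetric] by (rule limit_optimality(1)[OF c _ assms(13-15)]) (rule assms(12))
  have min12: "I1 c1 (glue \<kappa>XZ) + I2 c2 (glue \<kappa>XZ) \<le> I1 c1 \<pi> + I2 c2 \<pi>" if "\<pi> \<in> mart_couplings3 \<mu>X \<mu>Y \<mu>Z" for \<pi>
    unfolding glue[symmetric] by (rule limit_optimality(2)[OF c _ assms(13-15) that]) (rule assms(12))
  have min3: "I3 c3 (glue \<kappa>XZ) \<le> I3 c3 \<pi>"
    if "\<pi> \<in> mart_couplings3 \<mu>X \<mu>Y \<mu>Z" "I1 c1 \<pi> + I2 c2 \<pi> = I1 c1 (glue \<kappa>XZ) + I2 c2 (glue \<kappa>XZ)" for \<pi>
    unfolding glue[symmetric] by (rule limit_optimality(3)[OF c _ assms(13-15) that[folded glue]]) (rule assms(12))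
  note cm = c_measurable[OF c] and cb = c_bounded[OF c]
  have I1: "I1 c1 (glue \<kappa>XZ) = (\<integral>w. c1 w \<partial>marXY \<kappa>XZ)"
    by (rule trans[OF I1_def[OF c] integral_marXY(3)[OF K M3 cm(1) cb(1), symmetric]])
  have I2: "I2 c2 (glue \<kappa>XZ) = (\<integral>w. c2 w \<partial>marYZ \<kappa>XZ)"
    by (rule trans[OF I2_def[OF c] integral_marYZ(3)[OF K M3 cm(2) cb(2), symmetric]])
  have marYZc: "marYZ \<kappa>XZ \<in> couplings \<mu>Y \<mu>Z" using marYZ_mart[OF K M3] by (simp add: mart_couplings_def)
  have "is_optimal c1 (mart_couplings \<mu>X \<mu>Y) (marXY \<kappa>XZ)"
  proof -
    have "(\<integral>w. c1 w \<partial>marXY \<kappa>XZ) \<le> (\<integral>w. c1 w \<partial>\<pi>)" if \<pi>: "\<pi> \<in> mart_couplings \<mu>X \<mu>Y" for \<pi>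
    proof -
      have \<pi>c: "\<pi> \<in> couplings \<mu>X \<mu>Y" using \<pi> by (simp add: mart_couplings_def)
      note cc = couplings_cong_sets[OF \<pi>c sets_marginals(1,2)]
      let ?s = "\<lambda>w. (snd w, fst w)"
      \<comment> \<open>A martingale coupling of \<open>\<mu>X\<close> and \<open>\<mu>Y\<close>
        comes with a kernel from \<open>x\<close> to \<open>y\<close>, but gluing needs conditional
        laws given \<open>y\<close>; the coordinates are swapped before disintegrating.\<close>
      have sw: "?s \<in> measurable \<pi> (\<mu>Y \<Otimes>\<^sub>M borel_on X)"
        unfolding measurable_cong_sets[OF cc(2) refl] by measurable
      define \<pi>' where "\<pi>' = distr \<pi> (\<mu>Y \<Otimes>\<^sub>M borel_on X) ?s"
      have "\<exists>k\<in>prob_kernels \<mu>Y (borel_on X). \<pi>' = kernel_product \<mu>Y k"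
      proof (rule exists_kernel_borel_on)
        show "prob_space \<pi>'" unfolding \<pi>'_def by (rule prob_space.prob_space_distr[OF cc(1) sw])
        show "distr \<pi>' \<mu>Y fst = \<mu>Y"
          unfolding \<pi>'_def distr_distr[OF measurable_fst sw] using cc(4) by (simp add: comp_def)
      qed (use compact in \<open>simp_all add: \<pi>'_def\<close>)
      then obtain k where k: "k \<in> prob_kernels \<mu>Y (borel_on X)" "\<pi>' = kernel_product \<mu>Y k" by blast
      have eq1: "(\<integral>y. \<integral>x. f (x, y) \<partial>k y \<partial>\<mu>Y) = (\<integral>w. f w \<partial>\<pi>)"
        if f: "f \<in> borel_measurable (borel_on X \<Otimes>\<^sub>M borel_on Y)" "\<exists>C. \<forall>w\<in>X \<times> Y. \<bar>f w\<bar> \<le> C" for f :: "_ \<Rightarrow> real"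
      proof -
        obtain C where C: "\<And>w. w \<in> X \<times> Y \<Longrightarrow> \<bar>f w\<bar> \<le> C" using f(2) by blast
        have "?s \<in> measurable (\<mu>Y \<Otimes>\<^sub>M borel_on X) (borel_on X \<Otimes>\<^sub>M borel_on Y)" by measurable
        note fs = measurable_compose[OF this f(1)]
        have "(\<integral>w. f w \<partial>\<pi>) = (\<integral>w. f (?s w) \<partial>\<pi>')"
          unfolding \<pi>'_def by (subst integral_distr[OF sw fs]) simp
        also have "\<dots> = (\<integral>y. \<integral>x. f (?s (y, x)) \<partial>k y \<partial>\<mu>Y)"
          unfolding k(2) by (rule integral_kernel_product[OF prob_marginals(2) k(1) fs, where C=C])
            (use C in \<open>simp add: space_marginals space_borel_on_real\<close>)
        finally show ?thesis by simp
      qed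
      have mean: "AE y in \<mu>Y. (\<integral>z. z \<partial>kerZ \<kappa>XZ y) = y"
        using glue_mart_couplings3_fibres[OF K M3] AE_space
        by eventually_elim (use fibre_mean[OF K M3] in \<open>simp add: space_marginals\<close>)
      \<comment> \<open>The conditional laws of \<open>x\<close> come from the competitor and those
        of \<open>z\<close> from \<open>\<kappa>XZ\<close>. The \<open>c2\<close>-cost is then the
        same as for the limit, so minimality of the sum compares the
        \<open>c1\<close>-costs.\<close>
      have "\<exists>\<pi>'\<in>mart_couplings3 \<mu>X \<mu>Y \<mu>Z. I1 c1 \<pi>' = (\<integral>w. c1 w \<partial>\<pi>) \<and> I2 c2 \<pi>' = (\<integral>w. c2 w \<partial>marYZ \<kappa>XZ)"
        by (rule product_glue[OF c k(1) kerZ[OF K M3] \<pi> marYZc eq1 integral_marYZ(1)[OF K M3, symmetric] mean])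
      then show ?thesis using min12 I1 I2 by fastforce
    qed
    then show ?thesis
      using marXY_mart[OF K M3] by (auto simp: is_optimal_def is_arg_min_def not_less)
  qed
  moreover have "is_optimal c2 (mart_couplings \<mu>Y \<mu>Z) (marYZ \<kappa>XZ)"
  proof -
    have "(\<integral>w. c2 w \<partial>marYZ \<kappa>XZ) \<le> (\<integral>w. c2 w \<partial>\<pi>)" if \<pi>: "\<pi> \<in> mart_couplings \<mu>Y \<mu>Z" for \<pi>
    proof -
      obtain k where "k \<in> prob_kernels \<mu>Y \<mu>Z" and k2: "\<pi> = kernel_product \<mu>Y k" and mean: "AE y in \<mu>Y. (\<integral>z. z \<partial>k y) = y"
        and \<pi>c: "\<pi> \<in> couplings \<mu>Y \<mu>Z"
        using \<pi> by (auto simp: mart_couplings_def)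
      then have k: "k \<in> prob_kernels \<mu>Y (borel_on Z)"
        using prob_kernels_cong_sets[OF refl[of "sets \<mu>Y"] sets_marginals(3)] by auto
      have eq2: "(\<integral>y. \<integral>z. f (y, z) \<partial>k y \<partial>\<mu>Y) = (\<integral>w. f w \<partial>\<pi>)"
        if f: "f \<in> borel_measurable (borel_on Y \<Otimes>\<^sub>M borel_on Z)" "\<exists>C. \<forall>w\<in>Y \<times> Z. \<bar>f w\<bar> \<le> C" for f :: "_ \<Rightarrow> real"
      proof -
        obtain C where C: "\<And>w. w \<in> Y \<times> Z \<Longrightarrow> \<bar>f w\<bar> \<le> C" using f(2) by blast
        have f': "f \<in> borel_measurable (\<mu>Y \<Otimes>\<^sub>M borel_on Z)"
          using f(1) by (simp add: measurable_cong_sets[OF sets_pair_measure_cong[OF sets_marginals(2) refl] refl])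
        show ?thesis
          unfolding k2 by (rule integral_kernel_product[OF prob_marginals(2) k f', symmetric, where C=C])
            (use C in \<open>simp add: space_marginals space_borel_on_real\<close>)
      qed
      \<comment> \<open>Now the laws of \<open>x\<close> are kept and those of \<open>z\<close> are
        exchanged, which isolates the \<open>c2\<close>-costs.\<close>
      have "\<exists>\<pi>'\<in>mart_couplings3 \<mu>X \<mu>Y \<mu>Z. I1 c1 \<pi>' = (\<integral>w. c1 w \<partial>marXY \<kappa>XZ) \<and> I2 c2 \<pi>' = (\<integral>w. c2 w \<partial>\<pi>)"
        by (rule product_glue[OF c kerX[OF K M3] k marXY_mart[OF K M3] \<pi>c integral_marXY(1)[OF K M3, symmetric] eq2 mean])
      then show ?thesis using min12 I1 I2 by fastforce
    qed
    then show ?thesis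
      using marYZ_mart[OF K M3] by (auto simp: is_optimal_def is_arg_min_def not_less)
  qed
  moreover have "AE y in \<mu>Y. is_optimal c3 (bary_couplings (\<lambda>x. y) (kerX \<kappa>XZ y) (kerZ \<kappa>XZ y)) (\<kappa>XZ y)"
    by (rule fibrewise_optimal[OF c K M3]) (rule min3)
  ultimately show ?thesis
    using kerX[OF K M3] kerZ[OF K M3] marXY_def[OF K M3] marYZ_def[OF K M3] by blast
qed

end
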